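(* Let $\mathcal{C}$ be a model bicategory. If $\mathcal{C}_{fc}$ is locally small (in particular when $\mathcal{C}$ is so), then so is $\mathcal{H}o(\mathcal{C})$.
   Context: A bicategory is locally small if each hom-category has a set of objects and a set of arrows. **Conventions.** $\circ$ is vertical composition, $\ast$ is horizontal composition (also composition of arrows); $\ast$ binds tighter than $\circ$; associators and unitors are suppressed. "2-functor" means strict homomorphism. biLimits are bicategorical limits (universal property up to equivalence of hom-categories); the biPullback of $B\xrightarrow{f}D\xleftarrow{g}C$ is the bi-universal square over it commuting up to an invertible 2-cell. **Lifting property.** Let $i:A\to X$, $p:Y\to B$. Let $\mathbf{P}$ be the category with objects triples $(a,\gamma,b)$, $a:A\to Y$, $b:X\to B$, $\gamma: p\ast a\Rightarrow b\ast i$ invertible, and arrows $(a,\gamma,b)\to(a',\gamma',b')$ the pairs of 2-cells $\alpha:a\Rightarrow a'$, $\beta:b\Rightarrow b'$ with $\beta\ast i\circ\gamma=\gamma'\circ p\ast\alpha$. Let $h:\mathcal{C}(X,Y)\to\mathbf{P}$, $h(f)=(f\ast i,\cong,p\ast f)$. The pair $(i,p)$ has the lifting property if $h$ is essentially surjective and essentially full, where $F:\mathbf{X}\to\mathbf{A}$ is essentially full if for every $g:FX\to FY$ there are $f:X'\to Y'$ and isomorphisms $a:FX'\to FX$, $b:FY'\to FY$ with $g\circ a=b\circ Ff$. **Model bicategory.** A bicategory $\mathcal{C}$ with three classes of arrows $\mathcal{F}$ (fibrations), $co\mathcal{F}$ (cofibrations), $\mathcal{W}$ (weak equivalences) such that: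 (M0) $\mathcal{C}$ has biterminal objects, biPullbacks and the dual colimits. (M1) If $i$ is a cofibration, $p$ a fibration and one of them is a weak equivalence, $(i,p)$ has the lifting property. (M2) Every arrow $f$ factors as $f\cong p\ast i$ with $i$ a cofibration, $p$ a fibration; in addition one may require $i$ to be a weak equivalence, or one may require $p$ to be so. (M3) Fibrations (cofibrations) are closed under composition and biPullbacks (biPushouts); every equivalence is a fibration and a cofibration; both classes are closed under invertible 2-cells $f\cong g$. (M4) A biPullback of a fibration in $\mathcal{W}$ is in $\mathcal{W}$; a biPushout of a cofibration in $\mathcal{W}$ is in $\mathcal{W}$. (M5) If $gf\cong h$ and two of $f,g,h$ are in $\mathcal{W}$, so is the third; every equivalence is in $\mathcal{W}$. $X$ is fibrant if $X\to *$ ($*$ biterminal) is a fibration, cofibrant if $0\to X$ ($0$ biinitial) is a cofibration. $\mathcal{C}_{fc}$: full sub-bicategory of fibrant-cofibrant objects. **Homotopies.** A $w$-cylinder for $X$ is $C=(W,Z,d_0,d_1,x,s,\alpha_0,\alpha_1)$ with $d_0,d_1:X\to W$, $x:X\to Z$, $s:W\to Z$ in $\mathcal{W}$, and invertible $\alpha_j:s\ast d_j\Rightarrow x$; put $\alpha=\alpha_1^{-1}\circ\alpha_0$. A left $w$-homotopy $H:f\rightsquigarrow g$ between $f,g:X\to Y$ is $H=(C,h,\eta,\varepsilon)$, $h:W\to Y$, $\eta:f\Rightarrow h\ast d_0$, $\varepsilon:h\ast d_1\Rightarrow g$. **Classes.** $f:X\to Y$ in a bicategory $\mathcal{D}$ is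 a quasiequivalence if $f_*:\mathcal{D}(Z,X)\to\mathcal{D}(Z,Y)$ and $f^*:\mathcal{D}(Y,Z)\to\mathcal{D}(X,Z)$ are full and faithful for all $Z$. For a 2-functor $F:\mathcal{C}\to\mathcal{D}$ sending $\mathcal{W}$ to quasiequivalences, $H$ determines $\widehat{FH}=F\varepsilon\circ(Fh\ast\widehat{FC})\circ F\eta:Ff\Rightarrow Fg$, where $\widehat{FC}:Fd_0\Rightarrow Fd_1$ is the unique 2-cell with $Fs\ast\widehat{FC}=F\alpha$. Two finite composable sequences of $w$-homotopies from $f$ to $g$ are in the same class if for all such $F$ and $\mathcal{D}$ the composites of the associated 2-cells agree. **Homotopy bicategory.** $\mathcal{H}o(\mathcal{C},\mathcal{W})$ has the objects and arrows of $\mathcal{C}$; its 2-cells are the classes $[H^n,\dots,H^1]$ of finite composable sequences of left $w$-homotopies. Vertical composition is juxtaposition; whiskering is given by $r\ast H=(C,r\ast h,r\ast\eta,r\ast\varepsilon)$ and $H\ast l=(C\ast l,h,\eta\ast l,\varepsilon\ast l)$, $C\ast l=(W,Z,d_0\ast l,d_1\ast l,x\ast l,s,\alpha_0\ast l,\alpha_1\ast l)$. The 2-functor $i:\mathcal{C}\to\mathcal{H}o(\mathcal{C},\mathcal{W})$ is the identity on objects and arrows and sends $\mu:f\Rightarrow g$ to $[I^\mu]$, $I^\mu$ having $W=Z=X$, $d_0=d_1=x=s=id_X$, $h=g$, $\eta=\mu$, and all other 2-cells identities; the structural 2-cells are the images under $i$ of those of $\mathcal{C}$. $\mathcal{H}o(\mathcal{C}):=\mathcal{H}o_{fc}(\mathcal{C},\mathcal{W})$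 is the full sub-bicategory of $\mathcal{H}o(\mathcal{C},\mathcal{W})$ on the fibrant-cofibrant objects. *)

theory Defs
  imports Main
begin

unbundle cardinal_syntax

section \<open>Categories\<close>

text \<open>Categories are given by an object set and hom-sets; the latter need not be disjoint.\<close>

record ('x, 'm) cat =
  cob :: "'x set"
  chom :: "'x \<Rightarrow> 'x \<Rightarrow> 'm set"
  cid :: "'x \<Rightarrow> 'm"
  ccomp :: "'m \<Rightarrow> 'm \<Rightarrow> 'm"  \<comment> \<open>\<open>ccomp A n m\<close> is \<open>n\<close> after \<open>m\<close>\<close>

definition cat_iso :: "('x, 'm) cat \<Rightarrow> 'x \<Rightarrow> 'x \<Rightarrow> 'm \<Rightarrow> bool" where
  "cat_iso A x y m \<longleftrightarrow> m \<in> chom A x y \<and>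
     (\<exists>n \<in> chom A y x. ccomp A n m = cid A x \<and> ccomp A m n = cid A y)"

text \<open>
  In the following notions \<open>Fo\<close> and \<open>Fm\<close> are the action of a functor from \<open>A\<close> to \<open>B\<close>
  on objects and on morphisms.
\<close>

definition full_functor ::
  "('x, 'm) cat \<Rightarrow> ('y, 'n) cat \<Rightarrow> ('x \<Rightarrow> 'y) \<Rightarrow> ('m \<Rightarrow> 'n) \<Rightarrow> bool" where
  "full_functor A B Fo Fm \<longleftrightarrow>
     (\<forall>x \<in> cob A. \<forall>y \<in> cob A. \<forall>g \<in> chom B (Fo x) (Fo y). \<exists>f \<in> chom A x y. Fm f = g)"

definition faithful_functor ::
  "('x, 'm) cat \<Rightarrow> ('x \<Rightarrow> 'y) \<Rightarrow> ('m \<Rightarrow> 'n) \<Rightarrow> bool" where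
  "faithful_functor A Fo Fm \<longleftrightarrow> (\<forall>x \<in> cob A. \<forall>y \<in> cob A. inj_on Fm (chom A x y))"

definition ess_surj_functor ::
  "('x, 'm) cat \<Rightarrow> ('y, 'n) cat \<Rightarrow> ('x \<Rightarrow> 'y) \<Rightarrow> ('m \<Rightarrow> 'n) \<Rightarrow> bool" where
  "ess_surj_functor A B Fo Fm \<longleftrightarrow> (\<forall>y \<in> cob B. \<exists>x \<in> cob A. \<exists>m. cat_iso B (Fo x) y m)"

definition ess_full_functor ::
  "('x, 'm) cat \<Rightarrow> ('y, 'n) cat \<Rightarrow> ('x \<Rightarrow> 'y) \<Rightarrow> ('m \<Rightarrow> 'n) \<Rightarrow> bool" where
  "ess_full_functor A B Fo Fm \<longleftrightarrow>
     (\<forall>x \<in> cob A. \<forall>y \<in> cob A. \<forall>g \<in> chom B (Fo x) (Fo y).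
        \<exists>x' \<in> cob A. \<exists>y' \<in> cob A. \<exists>f \<in> chom A x' y'. \<exists>a b.
          cat_iso B (Fo x') (Fo x) a \<and> cat_iso B (Fo y') (Fo y) b \<and>
          ccomp B g a = ccomp B b (Fm f))"

definition equivalence_functor ::
  "('x, 'm) cat \<Rightarrow> ('y, 'n) cat \<Rightarrow> ('x \<Rightarrow> 'y) \<Rightarrow> ('m \<Rightarrow> 'n) \<Rightarrow> bool" where
  "equivalence_functor A B Fo Fm \<longleftrightarrow>
     full_functor A B Fo Fm \<and> faithful_functor A Fo Fm \<and> ess_surj_functor A B Fo Fm"

definition unit_cat :: "(unit, unit) cat" where
  "unit_cat = \<lparr>cob = UNIV, chom = (\<lambda>_ _. UNIV), cid = (\<lambda>_. ()), ccomp = (\<lambda>_ _. ())\<rparr>"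


section \<open>Bicategories\<close>

text \<open>
  Compositions are written in applicative order: \<open>g \<odot> f\<close> and \<open>\<nu> \<ast> \<mu>\<close> are the horizontal
  composites (first \<open>f\<close>, \<open>\<mu>\<close>), \<open>\<nu> \<bullet> \<mu>\<close> is the vertical composite (first \<open>\<mu>\<close>).
  The structural cells are \<open>Asc h g f : (h \<odot> g) \<odot> f \<Rightarrow> h \<odot> (g \<odot> f)\<close>,
  \<open>Lun f : id \<odot> f \<Rightarrow> f\<close> and \<open>Run f : f \<odot> id \<Rightarrow> f\<close>.
\<close>

record ('o, 'a, 'c) bicat =
  Obj :: "'o set"
  Arr :: "'a set"
  Cell :: "'c set"
  Dom :: "'a \<Rightarrow> 'o"
  Cod :: "'a \<Rightarrow> 'o"
  Src :: "'c \<Rightarrow> 'a"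
  Trg :: "'c \<Rightarrow> 'a"
  Id1 :: "'o \<Rightarrow> 'a"
  Comp1 :: "'a \<Rightarrow> 'a \<Rightarrow> 'a"  (infixr \<open>\<odot>\<index>\<close> 75)
  Id2 :: "'a \<Rightarrow> 'c"
  Vcomp :: "'c \<Rightarrow> 'c \<Rightarrow> 'c"  (infixr \<open>\<bullet>\<index>\<close> 65)
  Hcomp :: "'c \<Rightarrow> 'c \<Rightarrow> 'c"  (infixr \<open>\<ast>\<index>\<close> 70)
  Asc :: "'a \<Rightarrow> 'a \<Rightarrow> 'a \<Rightarrow> 'c"
  Lun :: "'a \<Rightarrow> 'c"
  Run :: "'a \<Rightarrow> 'c"

definition hom :: "('o, 'a, 'c) bicat \<Rightarrow> 'o \<Rightarrow> 'o \<Rightarrow> 'a set" where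
  "hom C X Y = {f \<in> Arr C. Dom C f = X \<and> Cod C f = Y}"

definition cells :: "('o, 'a, 'c) bicat \<Rightarrow> 'a \<Rightarrow> 'a \<Rightarrow> 'c set" where
  "cells C f g = {\<mu> \<in> Cell C. Src C \<mu> = f \<and> Trg C \<mu> = g}"

definition inverse_cells :: "('o, 'a, 'c) bicat \<Rightarrow> 'c \<Rightarrow> 'c \<Rightarrow> bool" where
  "inverse_cells C \<mu> \<nu> \<longleftrightarrow> \<mu> \<in> Cell C \<and> \<nu> \<in> cells C (Trg C \<mu>) (Src C \<mu>) \<and>
     \<nu> \<bullet>\<^bsub>C\<^esub> \<mu> = Id2 C (Src C \<mu>) \<and> \<mu> \<bullet>\<^bsub>C\<^esub> \<nu> = Id2 C (Trg C \<mu>)"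

definition invertible :: "('o, 'a, 'c) bicat \<Rightarrow> 'c \<Rightarrow> bool" where
  "invertible C \<mu> \<longleftrightarrow> (\<exists>\<nu>. inverse_cells C \<mu> \<nu>)"

definition inv_cell :: "('o, 'a, 'c) bicat \<Rightarrow> 'c \<Rightarrow> 'c" where
  "inv_cell C \<mu> = (THE \<nu>. inverse_cells C \<mu> \<nu>)"

definition inv_cells :: "('o, 'a, 'c) bicat \<Rightarrow> 'a \<Rightarrow> 'a \<Rightarrow> 'c set" where
  "inv_cells C f g = {\<mu> \<in> cells C f g. invertible C \<mu>}"

locale bicategory =
  fixes C :: "('o, 'a, 'c) bicat" (structure)
  assumes dom_cod [simp, intro]: "f \<in> Arr C \<Longrightarrow> Dom C f \<in> Obj C" "f \<in> Arr C \<Longrightarrow> Cod C f \<in> Obj C"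
    and src_trg [simp, intro]: "\<mu> \<in> Cell C \<Longrightarrow> Src C \<mu> \<in> Arr C" "\<mu> \<in> Cell C \<Longrightarrow> Trg C \<mu> \<in> Arr C"
    and parallel: "\<mu> \<in> Cell C \<Longrightarrow> Dom C (Trg C \<mu>) = Dom C (Src C \<mu>)"
      "\<mu> \<in> Cell C \<Longrightarrow> Cod C (Trg C \<mu>) = Cod C (Src C \<mu>)"
    and Id1_hom: "X \<in> Obj C \<Longrightarrow> Id1 C X \<in> hom C X X"
    and Comp1_hom: "f \<in> hom C X Y \<Longrightarrow> g \<in> hom C Y Z \<Longrightarrow> g \<odot> f \<in> hom C X Z"
    and Id2_cells: "f \<in> Arr C \<Longrightarrow> Id2 C f \<in> cells C f f"
    and Vcomp_cells: "\<mu> \<in> cells C f g \<Longrightarrow> \<nu> \<in> cells C g h \<Longrightarrow> \<nu> \<bullet> \<mu> \<in> cells C f h"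
    and Vcomp_assoc: "\<mu> \<in> cells C f g \<Longrightarrow> \<nu> \<in> cells C g h \<Longrightarrow> \<xi> \<in> cells C h k \<Longrightarrow>
      (\<xi> \<bullet> \<nu>) \<bullet> \<mu> = \<xi> \<bullet> (\<nu> \<bullet> \<mu>)"
    and Vcomp_Id2: "\<mu> \<in> cells C f g \<Longrightarrow> \<mu> \<bullet> Id2 C f = \<mu>"
      "\<mu> \<in> cells C f g \<Longrightarrow> Id2 C g \<bullet> \<mu> = \<mu>"
    and Hcomp_cells: "f \<in> hom C X Y \<Longrightarrow> g \<in> hom C Y Z \<Longrightarrow>
      \<mu> \<in> cells C f f' \<Longrightarrow> \<nu> \<in> cells C g g' \<Longrightarrow> \<nu> \<ast> \<mu> \<in> cells C (g \<odot> f) (g' \<odot> f')"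
    and Hcomp_Id2: "f \<in> hom C X Y \<Longrightarrow> g \<in> hom C Y Z \<Longrightarrow> Id2 C g \<ast> Id2 C f = Id2 C (g \<odot> f)"
    and interchange: "f \<in> hom C X Y \<Longrightarrow> g \<in> hom C Y Z \<Longrightarrow>
      \<mu> \<in> cells C f f' \<Longrightarrow> \<mu>' \<in> cells C f' f'' \<Longrightarrow> \<nu> \<in> cells C g g' \<Longrightarrow> \<nu>' \<in> cells C g' g'' \<Longrightarrow>
      (\<nu>' \<bullet> \<nu>) \<ast> (\<mu>' \<bullet> \<mu>) = (\<nu>' \<ast> \<mu>') \<bullet> (\<nu> \<ast> \<mu>)"
    and Asc_cells: "f \<in> hom C X Y \<Longrightarrow> g \<in> hom C Y Z \<Longrightarrow> h \<in> hom C Z V \<Longrightarrow>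
      Asc C h g f \<in> inv_cells C ((h \<odot> g) \<odot> f) (h \<odot> (g \<odot> f))"
    and Lun_cells: "f \<in> hom C X Y \<Longrightarrow> Lun C f \<in> inv_cells C (Id1 C Y \<odot> f) f"
    and Run_cells: "f \<in> hom C X Y \<Longrightarrow> Run C f \<in> inv_cells C (f \<odot> Id1 C X) f"
    and Asc_nat: "f \<in> hom C X Y \<Longrightarrow> g \<in> hom C Y Z \<Longrightarrow> h \<in> hom C Z V \<Longrightarrow>
      \<mu> \<in> cells C f f' \<Longrightarrow> \<nu> \<in> cells C g g' \<Longrightarrow> \<xi> \<in> cells C h h' \<Longrightarrow>
      Asc C h' g' f' \<bullet> ((\<xi> \<ast> \<nu>) \<ast> \<mu>) = (\<xi> \<ast> (\<nu> \<ast> \<mu>)) \<bullet> Asc C h g f"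
    and Lun_nat: "f \<in> hom C X Y \<Longrightarrow> \<mu> \<in> cells C f f' \<Longrightarrow>
      Lun C f' \<bullet> (Id2 C (Id1 C Y) \<ast> \<mu>) = \<mu> \<bullet> Lun C f"
    and Run_nat: "f \<in> hom C X Y \<Longrightarrow> \<mu> \<in> cells C f f' \<Longrightarrow>
      Run C f' \<bullet> (\<mu> \<ast> Id2 C (Id1 C X)) = \<mu> \<bullet> Run C f"
    and pentagon: "f \<in> hom C X Y \<Longrightarrow> g \<in> hom C Y Z \<Longrightarrow> h \<in> hom C Z V \<Longrightarrow> k \<in> hom C V U \<Longrightarrow>
      Asc C k h (g \<odot> f) \<bullet> Asc C (k \<odot> h) g f =
      (Id2 C k \<ast> Asc C h g f) \<bullet> (Asc C k (h \<odot> g) f \<bullet> (Asc C k h g \<ast> Id2 C f))"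
    and triangle: "f \<in> hom C X Y \<Longrightarrow> g \<in> hom C Y Z \<Longrightarrow>
      (Id2 C g \<ast> Lun C f) \<bullet> Asc C g (Id1 C Y) f = Run C g \<ast> Id2 C f"

definition hom_cat :: "('o, 'a, 'c) bicat \<Rightarrow> 'o \<Rightarrow> 'o \<Rightarrow> ('a, 'c) cat" where
  "hom_cat C X Y = \<lparr>cob = hom C X Y, chom = cells C, cid = Id2 C, ccomp = Vcomp C\<rparr>"

definition full_sub :: "('o, 'a, 'c) bicat \<Rightarrow> 'o set \<Rightarrow> ('o, 'a, 'c) bicat" where
  "full_sub C S = C\<lparr>
     Obj := Obj C \<inter> S,
     Arr := {f \<in> Arr C. Dom C f \<in> S \<and> Cod C f \<in> S},
     Cell := {\<mu> \<in> Cell C. Dom C (Src C \<mu>) \<in> S \<and> Cod C (Src C \<mu>) \<in> S}\<rparr>"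

definition equivalence :: "('o, 'a, 'c) bicat \<Rightarrow> 'a \<Rightarrow> bool" where
  "equivalence C f \<longleftrightarrow> f \<in> Arr C \<and> (\<exists>g \<in> hom C (Cod C f) (Dom C f).
     inv_cells C (g \<odot>\<^bsub>C\<^esub> f) (Id1 C (Dom C f)) \<noteq> {} \<and>
     inv_cells C (f \<odot>\<^bsub>C\<^esub> g) (Id1 C (Cod C f)) \<noteq> {})"

definition quasiequivalence :: "('o, 'a, 'c) bicat \<Rightarrow> 'a \<Rightarrow> bool" where
  "quasiequivalence C f \<longleftrightarrow> f \<in> Arr C \<and> (\<forall>Z \<in> Obj C.
     full_functor (hom_cat C Z (Dom C f)) (hom_cat C Z (Cod C f))
       (\<lambda>u. f \<odot>\<^bsub>C\<^esub> u) (\<lambda>\<mu>. Id2 C f \<ast>\<^bsub>C\<^esub> \<mu>) \<and>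
     faithful_functor (hom_cat C Z (Dom C f))
       (\<lambda>u. f \<odot>\<^bsub>C\<^esub> u) (\<lambda>\<mu>. Id2 C f \<ast>\<^bsub>C\<^esub> \<mu>) \<and>
     full_functor (hom_cat C (Cod C f) Z) (hom_cat C (Dom C f) Z)
       (\<lambda>u. u \<odot>\<^bsub>C\<^esub> f) (\<lambda>\<mu>. \<mu> \<ast>\<^bsub>C\<^esub> Id2 C f) \<and>
     faithful_functor (hom_cat C (Cod C f) Z)
       (\<lambda>u. u \<odot>\<^bsub>C\<^esub> f) (\<lambda>\<mu>. \<mu> \<ast>\<^bsub>C\<^esub> Id2 C f))"

text \<open>Strict homomorphisms of bicategories.\<close>

definition two_functor ::
  "('o, 'a, 'c) bicat \<Rightarrow> ('p, 'b, 'd) bicat \<Rightarrow>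
   ('o \<Rightarrow> 'p) \<Rightarrow> ('a \<Rightarrow> 'b) \<Rightarrow> ('c \<Rightarrow> 'd) \<Rightarrow> bool" where
  "two_functor C D F0 F1 F2 \<longleftrightarrow>
     (\<forall>X \<in> Obj C. F0 X \<in> Obj D \<and> F1 (Id1 C X) = Id1 D (F0 X)) \<and>
     (\<forall>f \<in> Arr C. F1 f \<in> hom D (F0 (Dom C f)) (F0 (Cod C f)) \<and> F2 (Id2 C f) = Id2 D (F1 f) \<and>
        F2 (Lun C f) = Lun D (F1 f) \<and> F2 (Run C f) = Run D (F1 f)) \<and>
     (\<forall>\<mu> \<in> Cell C. F2 \<mu> \<in> cells D (F1 (Src C \<mu>)) (F1 (Trg C \<mu>))) \<and>
     (\<forall>f \<in> Arr C. \<forall>g \<in> Arr C. Cod C f = Dom C g \<longrightarrow> F1 (g \<odot>\<^bsub>C\<^esub> f) = F1 g \<odot>\<^bsub>D\<^esub> F1 f) \<and>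
     (\<forall>\<mu> \<in> Cell C. \<forall>\<nu> \<in> Cell C. Trg C \<mu> = Src C \<nu> \<longrightarrow> F2 (\<nu> \<bullet>\<^bsub>C\<^esub> \<mu>) = F2 \<nu> \<bullet>\<^bsub>D\<^esub> F2 \<mu>) \<and>
     (\<forall>\<mu> \<in> Cell C. \<forall>\<nu> \<in> Cell C. Cod C (Src C \<mu>) = Dom C (Src C \<nu>) \<longrightarrow>
        F2 (\<nu> \<ast>\<^bsub>C\<^esub> \<mu>) = F2 \<nu> \<ast>\<^bsub>D\<^esub> F2 \<mu>) \<and>
     (\<forall>f \<in> Arr C. \<forall>g \<in> Arr C. \<forall>h \<in> Arr C. Cod C f = Dom C g \<longrightarrow> Cod C g = Dom C h \<longrightarrow>
        F2 (Asc C h g f) = Asc D (F1 h) (F1 g) (F1 f))"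


section \<open>Bilimits\<close>

definition biterminal :: "('o, 'a, 'c) bicat \<Rightarrow> 'o \<Rightarrow> bool" where
  "biterminal C T \<longleftrightarrow> T \<in> Obj C \<and>
     (\<forall>Z \<in> Obj C. equivalence_functor (hom_cat C Z T) unit_cat (\<lambda>_. ()) (\<lambda>_. ()))"

definition biinitial :: "('o, 'a, 'c) bicat \<Rightarrow> 'o \<Rightarrow> bool" where
  "biinitial C I \<longleftrightarrow> I \<in> Obj C \<and>
     (\<forall>Z \<in> Obj C. equivalence_functor (hom_cat C I Z) unit_cat (\<lambda>_. ()) (\<lambda>_. ()))"

text \<open>
  The category of cones with vertex \<open>Z\<close> over a cospan \<open>f, g\<close>: triples \<open>(u, \<gamma>, v)\<close> with
  \<open>\<gamma> : f \<odot> u \<Rightarrow> g \<odot> v\<close> invertible.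
\<close>

definition pb_cone_cat ::
  "('o, 'a, 'c) bicat \<Rightarrow> 'a \<Rightarrow> 'a \<Rightarrow> 'o \<Rightarrow> ('a \<times> 'c \<times> 'a, 'c \<times> 'c) cat" where
  "pb_cone_cat C f g Z = \<lparr>
     cob = {(u, \<gamma>, v). u \<in> hom C Z (Dom C f) \<and> v \<in> hom C Z (Dom C g) \<and>
              \<gamma> \<in> inv_cells C (f \<odot>\<^bsub>C\<^esub> u) (g \<odot>\<^bsub>C\<^esub> v)},
     chom = (\<lambda>(u, \<gamma>, v) (u', \<gamma>', v'). {(\<alpha>, \<beta>). \<alpha> \<in> cells C u u' \<and> \<beta> \<in> cells C v v' \<and>
              (Id2 C g \<ast>\<^bsub>C\<^esub> \<beta>) \<bullet>\<^bsub>C\<^esub> \<gamma> = \<gamma>' \<bullet>\<^bsub>C\<^esub> (Id2 C f \<ast>\<^bsub>C\<^esub> \<alpha>)}),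
     cid = (\<lambda>(u, \<gamma>, v). (Id2 C u, Id2 C v)),
     ccomp = (\<lambda>(\<alpha>', \<beta>') (\<alpha>, \<beta>). (\<alpha>' \<bullet>\<^bsub>C\<^esub> \<alpha>, \<beta>' \<bullet>\<^bsub>C\<^esub> \<beta>))\<rparr>"

definition bipullback ::
  "('o, 'a, 'c) bicat \<Rightarrow> 'a \<Rightarrow> 'a \<Rightarrow> 'o \<Rightarrow> 'a \<Rightarrow> 'c \<Rightarrow> 'a \<Rightarrow> bool" where
  "bipullback C f g P u \<gamma> v \<longleftrightarrow>
     f \<in> Arr C \<and> g \<in> Arr C \<and> Cod C f = Cod C g \<and> P \<in> Obj C \<and>
     (u, \<gamma>, v) \<in> cob (pb_cone_cat C f g P) \<and>
     (\<forall>Z \<in> Obj C. equivalence_functor (hom_cat C Z P) (pb_cone_cat C f g Z)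
        (\<lambda>w. (u \<odot>\<^bsub>C\<^esub> w,
              Asc C g v w \<bullet>\<^bsub>C\<^esub> ((\<gamma> \<ast>\<^bsub>C\<^esub> Id2 C w) \<bullet>\<^bsub>C\<^esub> inv_cell C (Asc C f u w)),
              v \<odot>\<^bsub>C\<^esub> w))
        (\<lambda>\<omega>. (Id2 C u \<ast>\<^bsub>C\<^esub> \<omega>, Id2 C v \<ast>\<^bsub>C\<^esub> \<omega>)))"

text \<open>Dually, cocones under a span \<open>f, g\<close> with \<open>\<gamma> : u \<odot> f \<Rightarrow> v \<odot> g\<close>.\<close>

definition po_cocone_cat ::
  "('o, 'a, 'c) bicat \<Rightarrow> 'a \<Rightarrow> 'a \<Rightarrow> 'o \<Rightarrow> ('a \<times> 'c \<times> 'a, 'c \<times> 'c) cat" where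
  "po_cocone_cat C f g Z = \<lparr>
     cob = {(u, \<gamma>, v). u \<in> hom C (Cod C f) Z \<and> v \<in> hom C (Cod C g) Z \<and>
              \<gamma> \<in> inv_cells C (u \<odot>\<^bsub>C\<^esub> f) (v \<odot>\<^bsub>C\<^esub> g)},
     chom = (\<lambda>(u, \<gamma>, v) (u', \<gamma>', v'). {(\<alpha>, \<beta>). \<alpha> \<in> cells C u u' \<and> \<beta> \<in> cells C v v' \<and>
              (\<beta> \<ast>\<^bsub>C\<^esub> Id2 C g) \<bullet>\<^bsub>C\<^esub> \<gamma> = \<gamma>' \<bullet>\<^bsub>C\<^esub> (\<alpha> \<ast>\<^bsub>C\<^esub> Id2 C f)}),
     cid = (\<lambda>(u, \<gamma>, v). (Id2 C u, Id2 C v)),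
     ccomp = (\<lambda>(\<alpha>', \<beta>') (\<alpha>, \<beta>). (\<alpha>' \<bullet>\<^bsub>C\<^esub> \<alpha>, \<beta>' \<bullet>\<^bsub>C\<^esub> \<beta>))\<rparr>"

definition bipushout ::
  "('o, 'a, 'c) bicat \<Rightarrow> 'a \<Rightarrow> 'a \<Rightarrow> 'o \<Rightarrow> 'a \<Rightarrow> 'c \<Rightarrow> 'a \<Rightarrow> bool" where
  "bipushout C f g P u \<gamma> v \<longleftrightarrow>
     f \<in> Arr C \<and> g \<in> Arr C \<and> Dom C f = Dom C g \<and> P \<in> Obj C \<and>
     (u, \<gamma>, v) \<in> cob (po_cocone_cat C f g P) \<and>
     (\<forall>Z \<in> Obj C. equivalence_functor (hom_cat C P Z) (po_cocone_cat C f g Z)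
        (\<lambda>w. (w \<odot>\<^bsub>C\<^esub> u,
              inv_cell C (Asc C w v g) \<bullet>\<^bsub>C\<^esub> ((Id2 C w \<ast>\<^bsub>C\<^esub> \<gamma>) \<bullet>\<^bsub>C\<^esub> Asc C w u f),
              w \<odot>\<^bsub>C\<^esub> v))
        (\<lambda>\<omega>. (\<omega> \<ast>\<^bsub>C\<^esub> Id2 C u, \<omega> \<ast>\<^bsub>C\<^esub> Id2 C v)))"


section \<open>Model bicategories\<close>

definition lifting_cat ::
  "('o, 'a, 'c) bicat \<Rightarrow> 'a \<Rightarrow> 'a \<Rightarrow> ('a \<times> 'c \<times> 'a, 'c \<times> 'c) cat" where
  "lifting_cat C i p = \<lparr>
     cob = {(a, \<gamma>, b). a \<in> hom C (Dom C i) (Dom C p) \<and> b \<in> hom C (Cod C i) (Cod C p) \<and>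
              \<gamma> \<in> inv_cells C (p \<odot>\<^bsub>C\<^esub> a) (b \<odot>\<^bsub>C\<^esub> i)},
     chom = (\<lambda>(a, \<gamma>, b) (a', \<gamma>', b'). {(\<alpha>, \<beta>). \<alpha> \<in> cells C a a' \<and> \<beta> \<in> cells C b b' \<and>
              (\<beta> \<ast>\<^bsub>C\<^esub> Id2 C i) \<bullet>\<^bsub>C\<^esub> \<gamma> = \<gamma>' \<bullet>\<^bsub>C\<^esub> (Id2 C p \<ast>\<^bsub>C\<^esub> \<alpha>)}),
     cid = (\<lambda>(a, \<gamma>, b). (Id2 C a, Id2 C b)),
     ccomp = (\<lambda>(\<alpha>', \<beta>') (\<alpha>, \<beta>). (\<alpha>' \<bullet>\<^bsub>C\<^esub> \<alpha>, \<beta>' \<bullet>\<^bsub>C\<^esub> \<beta>))\<rparr>"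

definition lifting_ob :: "('o, 'a, 'c) bicat \<Rightarrow> 'a \<Rightarrow> 'a \<Rightarrow> 'a \<Rightarrow> 'a \<times> 'c \<times> 'a" where
  "lifting_ob C i p f = (f \<odot>\<^bsub>C\<^esub> i, inv_cell C (Asc C p f i), p \<odot>\<^bsub>C\<^esub> f)"

definition lifting_mor :: "('o, 'a, 'c) bicat \<Rightarrow> 'a \<Rightarrow> 'a \<Rightarrow> 'c \<Rightarrow> 'c \<times> 'c" where
  "lifting_mor C i p \<phi> = (\<phi> \<ast>\<^bsub>C\<^esub> Id2 C i, Id2 C p \<ast>\<^bsub>C\<^esub> \<phi>)"

definition lifting_property :: "('o, 'a, 'c) bicat \<Rightarrow> 'a \<Rightarrow> 'a \<Rightarrow> bool" where
  "lifting_property C i p \<longleftrightarrow>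
     ess_surj_functor (hom_cat C (Cod C i) (Dom C p)) (lifting_cat C i p)
       (lifting_ob C i p) (lifting_mor C i p) \<and>
     ess_full_functor (hom_cat C (Cod C i) (Dom C p)) (lifting_cat C i p)
       (lifting_ob C i p) (lifting_mor C i p)"

locale model_bicategory = bicategory C
  for C :: "('o, 'a, 'c) bicat" (structure) +
  fixes Fib Cof Weq :: "'a set"
  assumes Fib_Arr: "Fib \<subseteq> Arr C" and Cof_Arr: "Cof \<subseteq> Arr C" and Weq_Arr: "Weq \<subseteq> Arr C"
    and M0_biterminal: "\<exists>T. biterminal C T"
    and M0_biinitial: "\<exists>I. biinitial C I"
    and M0_bipullback: "f \<in> hom C X Z \<Longrightarrow> g \<in> hom C Y Z \<Longrightarrow> \<exists>P u \<gamma> v. bipullback C f g P u \<gamma> v"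
    and M0_bipushout: "f \<in> hom C Z X \<Longrightarrow> g \<in> hom C Z Y \<Longrightarrow> \<exists>P u \<gamma> v. bipushout C f g P u \<gamma> v"
    and M1: "i \<in> Cof \<Longrightarrow> p \<in> Fib \<Longrightarrow> i \<in> Weq \<or> p \<in> Weq \<Longrightarrow> lifting_property C i p"
    and M2_left: "f \<in> Arr C \<Longrightarrow> \<exists>i \<in> Cof \<inter> Weq. \<exists>p \<in> Fib.
      Dom C p = Cod C i \<and> inv_cells C f (p \<odot> i) \<noteq> {}"
    and M2_right: "f \<in> Arr C \<Longrightarrow> \<exists>i \<in> Cof. \<exists>p \<in> Fib \<inter> Weq.
      Dom C p = Cod C i \<and> inv_cells C f (p \<odot> i) \<noteq> {}"
    and M3_Fib_comp: "f \<in> Fib \<Longrightarrow> g \<in> Fib \<Longrightarrow> Cod C f = Dom C g \<Longrightarrow> g \<odot> f \<in> Fib"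
    and M3_Cof_comp: "f \<in> Cof \<Longrightarrow> g \<in> Cof \<Longrightarrow> Cod C f = Dom C g \<Longrightarrow> g \<odot> f \<in> Cof"
    and M3_Fib_bipullback: "bipullback C f g P u \<gamma> v \<Longrightarrow> f \<in> Fib \<Longrightarrow> v \<in> Fib"
    and M3_Cof_bipushout: "bipushout C f g P u \<gamma> v \<Longrightarrow> f \<in> Cof \<Longrightarrow> v \<in> Cof"
    and M3_equivalence: "equivalence C f \<Longrightarrow> f \<in> Fib \<inter> Cof"
    and M3_Fib_iso: "f \<in> Fib \<Longrightarrow> inv_cells C f g \<noteq> {} \<Longrightarrow> g \<in> Fib"
    and M3_Cof_iso: "f \<in> Cof \<Longrightarrow> inv_cells C f g \<noteq> {} \<Longrightarrow> g \<in> Cof"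
    and M4_bipullback: "bipullback C f g P u \<gamma> v \<Longrightarrow> f \<in> Fib \<inter> Weq \<Longrightarrow> v \<in> Weq"
    and M4_bipushout: "bipushout C f g P u \<gamma> v \<Longrightarrow> f \<in> Cof \<inter> Weq \<Longrightarrow> v \<in> Weq"
    and M5_two_of_three: "f \<in> hom C X Y \<Longrightarrow> g \<in> hom C Y Z \<Longrightarrow> inv_cells C (g \<odot> f) h \<noteq> {} \<Longrightarrow>
      (f \<in> Weq \<and> g \<in> Weq \<longrightarrow> h \<in> Weq) \<and> (f \<in> Weq \<and> h \<in> Weq \<longrightarrow> g \<in> Weq) \<and>
      (g \<in> Weq \<and> h \<in> Weq \<longrightarrow> f \<in> Weq)"
    and M5_equivalence: "equivalence C f \<Longrightarrow> f \<in> Weq"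

definition fibrant :: "('o, 'a, 'c) bicat \<Rightarrow> 'a set \<Rightarrow> 'o \<Rightarrow> bool" where
  "fibrant C Fib X \<longleftrightarrow> X \<in> Obj C \<and> (\<exists>T t. biterminal C T \<and> t \<in> hom C X T \<and> t \<in> Fib)"

definition cofibrant :: "('o, 'a, 'c) bicat \<Rightarrow> 'a set \<Rightarrow> 'o \<Rightarrow> bool" where
  "cofibrant C Cof X \<longleftrightarrow> X \<in> Obj C \<and> (\<exists>I t. biinitial C I \<and> t \<in> hom C I X \<and> t \<in> Cof)"

definition fc_objects :: "('o, 'a, 'c) bicat \<Rightarrow> 'a set \<Rightarrow> 'a set \<Rightarrow> 'o set" where
  "fc_objects C Fib Cof = {X. fibrant C Fib X \<and> cofibrant C Cof X}"

definition fc_bicat :: "('o, 'a, 'c) bicat \<Rightarrow> 'a set \<Rightarrow> 'a set \<Rightarrow> ('o, 'a, 'c) bicat" where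
  "fc_bicat C Fib Cof = full_sub C (fc_objects C Fib Cof)"


section \<open>Left w-homotopies\<close>

record ('o, 'a, 'c) wcyl =
  cyW :: 'o
  cyZ :: 'o
  cyd0 :: 'a
  cyd1 :: 'a
  cyx :: 'a
  cys :: 'a
  cya0 :: 'c
  cya1 :: 'c

definition w_cylinder :: "('o, 'a, 'c) bicat \<Rightarrow> 'a set \<Rightarrow> 'o \<Rightarrow> ('o, 'a, 'c) wcyl \<Rightarrow> bool" where
  "w_cylinder C Weq X K \<longleftrightarrow>
     cyW K \<in> Obj C \<and> cyZ K \<in> Obj C \<and>
     cyd0 K \<in> hom C X (cyW K) \<and> cyd1 K \<in> hom C X (cyW K) \<and> cyx K \<in> hom C X (cyZ K) \<and>
     cys K \<in> hom C (cyW K) (cyZ K) \<and> cys K \<in> Weq \<and>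
     cya0 K \<in> inv_cells C (cys K \<odot>\<^bsub>C\<^esub> cyd0 K) (cyx K) \<and>
     cya1 K \<in> inv_cells C (cys K \<odot>\<^bsub>C\<^esub> cyd1 K) (cyx K)"

record ('o, 'a, 'c) whtpy =
  hcyl :: "('o, 'a, 'c) wcyl"
  hmap :: 'a
  heta :: 'c
  heps :: 'c

definition w_homotopy ::
  "('o, 'a, 'c) bicat \<Rightarrow> 'a set \<Rightarrow> 'a \<Rightarrow> 'a \<Rightarrow> ('o, 'a, 'c) whtpy \<Rightarrow> bool" where
  "w_homotopy C Weq f g H \<longleftrightarrow>
     f \<in> Arr C \<and> g \<in> hom C (Dom C f) (Cod C f) \<and>
     w_cylinder C Weq (Dom C f) (hcyl H) \<and>
     hmap H \<in> hom C (cyW (hcyl H)) (Cod C f) \<and>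
     heta H \<in> cells C f (hmap H \<odot>\<^bsub>C\<^esub> cyd0 (hcyl H)) \<and>
     heps H \<in> cells C (hmap H \<odot>\<^bsub>C\<^esub> cyd1 (hcyl H)) g"

text \<open>
  Composable sequences \<open>[H\<^sup>n, \<dots>, H\<^sup>1]\<close> from \<open>f\<close> to \<open>g\<close>, with \<open>n \<ge> 1\<close>; as in the
  bracket notation, the homotopy starting at \<open>f\<close> comes last.
\<close>

inductive w_seq ::
  "('o, 'a, 'c) bicat \<Rightarrow> 'a set \<Rightarrow> 'a \<Rightarrow> 'a \<Rightarrow> ('o, 'a, 'c) whtpy list \<Rightarrow> bool"
  for C Weq where
  single: "w_homotopy C Weq f g H \<Longrightarrow> w_seq C Weq f g [H]"
| snoc: "w_seq C Weq f g S \<Longrightarrow> w_homotopy C Weq g k H \<Longrightarrow> w_seq C Weq f k (H # S)"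


section \<open>Classes of homotopies\<close>

definition localizing ::
  "('o, 'a, 'c) bicat \<Rightarrow> 'a set \<Rightarrow> ('p, 'b, 'd) bicat \<Rightarrow>
   ('o \<Rightarrow> 'p) \<Rightarrow> ('a \<Rightarrow> 'b) \<Rightarrow> ('c \<Rightarrow> 'd) \<Rightarrow> bool" where
  "localizing C Weq D F0 F1 F2 \<longleftrightarrow>
     bicategory D \<and> two_functor C D F0 F1 F2 \<and> (\<forall>w \<in> Weq. quasiequivalence D (F1 w))"

definition hat_cyl ::
  "('o, 'a, 'c) bicat \<Rightarrow> ('p, 'b, 'd) bicat \<Rightarrow> ('a \<Rightarrow> 'b) \<Rightarrow> ('c \<Rightarrow> 'd) \<Rightarrow>
   ('o, 'a, 'c) wcyl \<Rightarrow> 'd" where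
  "hat_cyl C D F1 F2 K = (THE \<delta>. \<delta> \<in> cells D (F1 (cyd0 K)) (F1 (cyd1 K)) \<and>
     Id2 D (F1 (cys K)) \<ast>\<^bsub>D\<^esub> \<delta> = F2 (inv_cell C (cya1 K) \<bullet>\<^bsub>C\<^esub> cya0 K))"

definition hat_htpy ::
  "('o, 'a, 'c) bicat \<Rightarrow> ('p, 'b, 'd) bicat \<Rightarrow> ('a \<Rightarrow> 'b) \<Rightarrow> ('c \<Rightarrow> 'd) \<Rightarrow>
   ('o, 'a, 'c) whtpy \<Rightarrow> 'd" where
  "hat_htpy C D F1 F2 H = F2 (heps H) \<bullet>\<^bsub>D\<^esub>
     ((Id2 D (F1 (hmap H)) \<ast>\<^bsub>D\<^esub> hat_cyl C D F1 F2 (hcyl H)) \<bullet>\<^bsub>D\<^esub> F2 (heta H))"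

text \<open>The clause for the empty list is irrelevant, as \<^const>\<open>w_seq\<close> holds of non-empty lists only.\<close>

fun hat_seq ::
  "('o, 'a, 'c) bicat \<Rightarrow> ('p, 'b, 'd) bicat \<Rightarrow> ('a \<Rightarrow> 'b) \<Rightarrow> ('c \<Rightarrow> 'd) \<Rightarrow>
   ('o, 'a, 'c) whtpy list \<Rightarrow> 'd" where
  "hat_seq C D F1 F2 [] = undefined"
| "hat_seq C D F1 F2 [H] = hat_htpy C D F1 F2 H"
| "hat_seq C D F1 F2 (H # G # S) = hat_htpy C D F1 F2 H \<bullet>\<^bsub>D\<^esub> hat_seq C D F1 F2 (G # S)"

text \<open>
  The targets \<open>D\<close> range over bicategories on the types below. This is no restriction:
  any other \<open>F\<close> factors through the bicategory with the objects and arrows of \<open>C\<close> and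
  2-cells those of \<open>D\<close> that are obtained from cells of \<open>C\<close> by composition and by cancelling
  images of weak equivalences. The latter are named by finite terms, which can be
  coded by lists; see \<open>same_class_any_target\<close> below.
\<close>

definition same_class ::
  "('o, 'a, 'c) bicat \<Rightarrow> 'a set \<Rightarrow> ('o, 'a, 'c) whtpy list \<Rightarrow> ('o, 'a, 'c) whtpy list \<Rightarrow> bool" where
  "same_class C Weq S T \<longleftrightarrow> (\<exists>f g. w_seq C Weq f g S \<and> w_seq C Weq f g T) \<and>
     (\<forall>(D :: ('o, 'a, ('a + 'c + nat) list) bicat) F0 F1 F2.
        localizing C Weq D F0 F1 F2 \<longrightarrow> hat_seq C D F1 F2 S = hat_seq C D F1 F2 T)"

section \<open>The homotopy bicategory\<close>

definition hclass ::
  "('o, 'a, 'c) bicat \<Rightarrow> 'a set \<Rightarrow> ('o, 'a, 'c) whtpy list \<Rightarrow> ('o, 'a, 'c) whtpy list set" where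
  "hclass C Weq S = {T. same_class C Weq S T}"

definition whisker_left ::
  "('o, 'a, 'c) bicat \<Rightarrow> 'a \<Rightarrow> ('o, 'a, 'c) whtpy \<Rightarrow> ('o, 'a, 'c) whtpy" where
  "whisker_left C r H = \<lparr>
     hcyl = hcyl H,
     hmap = r \<odot>\<^bsub>C\<^esub> hmap H,
     heta = inv_cell C (Asc C r (hmap H) (cyd0 (hcyl H))) \<bullet>\<^bsub>C\<^esub> (Id2 C r \<ast>\<^bsub>C\<^esub> heta H),
     heps = (Id2 C r \<ast>\<^bsub>C\<^esub> heps H) \<bullet>\<^bsub>C\<^esub> Asc C r (hmap H) (cyd1 (hcyl H))\<rparr>"

definition whisker_cyl ::
  "('o, 'a, 'c) bicat \<Rightarrow> ('o, 'a, 'c) wcyl \<Rightarrow> 'a \<Rightarrow> ('o, 'a, 'c) wcyl" where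
  "whisker_cyl C K l = \<lparr>
     cyW = cyW K, cyZ = cyZ K,
     cyd0 = cyd0 K \<odot>\<^bsub>C\<^esub> l, cyd1 = cyd1 K \<odot>\<^bsub>C\<^esub> l, cyx = cyx K \<odot>\<^bsub>C\<^esub> l, cys = cys K,
     cya0 = (cya0 K \<ast>\<^bsub>C\<^esub> Id2 C l) \<bullet>\<^bsub>C\<^esub> inv_cell C (Asc C (cys K) (cyd0 K) l),
     cya1 = (cya1 K \<ast>\<^bsub>C\<^esub> Id2 C l) \<bullet>\<^bsub>C\<^esub> inv_cell C (Asc C (cys K) (cyd1 K) l)\<rparr>"

definition whisker_right ::
  "('o, 'a, 'c) bicat \<Rightarrow> ('o, 'a, 'c) whtpy \<Rightarrow> 'a \<Rightarrow> ('o, 'a, 'c) whtpy" where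
  "whisker_right C H l = \<lparr>
     hcyl = whisker_cyl C (hcyl H) l,
     hmap = hmap H,
     heta = Asc C (hmap H) (cyd0 (hcyl H)) l \<bullet>\<^bsub>C\<^esub> (heta H \<ast>\<^bsub>C\<^esub> Id2 C l),
     heps = (heps H \<ast>\<^bsub>C\<^esub> Id2 C l) \<bullet>\<^bsub>C\<^esub> inv_cell C (Asc C (hmap H) (cyd1 (hcyl H)) l)\<rparr>"

text \<open>The homotopy \<open>I\<^sup>\<mu>\<close>; its cells that would be identities in a 2-category are unitors.\<close>

definition cell_htpy :: "('o, 'a, 'c) bicat \<Rightarrow> 'c \<Rightarrow> ('o, 'a, 'c) whtpy" where
  "cell_htpy C \<mu> = (let X = Dom C (Src C \<mu>); e = Id1 C X; g = Trg C \<mu> in \<lparr>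
     hcyl = \<lparr>cyW = X, cyZ = X, cyd0 = e, cyd1 = e, cyx = e, cys = e,
             cya0 = Lun C e, cya1 = Lun C e\<rparr>,
     hmap = g,
     heta = inv_cell C (Run C g) \<bullet>\<^bsub>C\<^esub> \<mu>,
     heps = Run C g\<rparr>)"

definition ho_cell ::
  "('o, 'a, 'c) bicat \<Rightarrow> 'a set \<Rightarrow> 'c \<Rightarrow> ('o, 'a, 'c) whtpy list set" where
  "ho_cell C Weq \<mu> = hclass C Weq [cell_htpy C \<mu>]"

definition ho_src :: "('o, 'a, 'c) bicat \<Rightarrow> 'a set \<Rightarrow> ('o, 'a, 'c) whtpy list set \<Rightarrow> 'a" where
  "ho_src C Weq K = (THE f. \<exists>g. \<exists>S \<in> K. w_seq C Weq f g S)"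

definition ho_trg :: "('o, 'a, 'c) bicat \<Rightarrow> 'a set \<Rightarrow> ('o, 'a, 'c) whtpy list set \<Rightarrow> 'a" where
  "ho_trg C Weq K = (THE g. \<exists>f. \<exists>S \<in> K. w_seq C Weq f g S)"

text \<open>
  Operations on classes are defined as the union of the classes obtained from all choices of
  representatives. The horizontal composite of \<open>K : f \<Rightarrow> f'\<close> and \<open>L : g \<Rightarrow> g'\<close> is
  \<open>(L \<ast> f') \<bullet> (g \<ast> K)\<close>.
\<close>

definition ho_bicat ::
  "('o, 'a, 'c) bicat \<Rightarrow> 'a set \<Rightarrow> ('o, 'a, ('o, 'a, 'c) whtpy list set) bicat" where
  "ho_bicat C Weq = \<lparr>
     Obj = Obj C,
     Arr = Arr C,
     Cell = {hclass C Weq S | S f g. w_seq C Weq f g S},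
     Dom = Dom C,
     Cod = Cod C,
     Src = ho_src C Weq,
     Trg = ho_trg C Weq,
     Id1 = Id1 C,
     Comp1 = Comp1 C,
     Id2 = (\<lambda>f. ho_cell C Weq (Id2 C f)),
     Vcomp = (\<lambda>L K. \<Union>T \<in> L. \<Union>S \<in> K. hclass C Weq (T @ S)),
     Hcomp = (\<lambda>L K. \<Union>T \<in> L. \<Union>S \<in> K. hclass C Weq
       (map (\<lambda>H. whisker_right C H (ho_trg C Weq K)) T @
        map (whisker_left C (ho_src C Weq L)) S)),
     Asc = (\<lambda>h g f. ho_cell C Weq (Asc C h g f)),
     Lun = (\<lambda>f. ho_cell C Weq (Lun C f)),
     Run = (\<lambda>f. ho_cell C Weq (Run C f))\<rparr>"

definition Ho ::
  "('o, 'a, 'c) bicat \<Rightarrow> 'a set \<Rightarrow> 'a set \<Rightarrow> 'a set \<Rightarrow>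
   ('o, 'a, ('o, 'a, 'c) whtpy list set) bicat" where
  "Ho C Fib Cof Weq = full_sub (ho_bicat C Weq) (fc_objects C Fib Cof)"


section \<open>Smallness\<close>

text \<open>
  ``Being a set'' as opposed to a proper class is measured by a cardinal \<open>\<kappa>\<close>: the small sets
  are those of cardinality less than \<open>\<kappa>\<close>. For the sets of a Grothendieck universe, \<open>\<kappa>\<close> is
  the (strongly inaccessible) cardinality of the universe; no such closure is required here.
\<close>

definition uncountable_cardinal :: "'k rel \<Rightarrow> bool" where
  "uncountable_cardinal \<kappa> \<longleftrightarrow> Card_order \<kappa> \<and> natLeq <o \<kappa>"

definition small :: "'k rel \<Rightarrow> 'x set \<Rightarrow> bool" where
  "small \<kappa> A \<longleftrightarrow> |A| <o \<kappa>"

definition small_cat :: "'k rel \<Rightarrow> ('x, 'm) cat \<Rightarrow> bool" where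
  "small_cat \<kappa> A \<longleftrightarrow> small \<kappa> (cob A) \<and> small \<kappa> (\<Union>x \<in> cob A. \<Union>y \<in> cob A. chom A x y)"

definition locally_small :: "'k rel \<Rightarrow> ('o, 'a, 'c) bicat \<Rightarrow> bool" where
  "locally_small \<kappa> C \<longleftrightarrow> (\<forall>X \<in> Obj C. \<forall>Y \<in> Obj C. small_cat \<kappa> (hom_cat C X Y))"

section \<open>Independence of the types of the targets\<close>

text \<open>
  \<open>same_class\<close> lets \<open>D\<close> range over bicategories on fixed types. We show that it then implies
  agreement of the associated 2-cells for \<open>D\<close> on arbitrary types.
  Given a localizing \<open>F\<close> into \<open>D\<close>, the bicategory \<open>E\<close> below has the objects and arrows of \<open>C\<close>
  and, as 2-cells \<open>f \<Rightarrow> g\<close>, the codes of those 2-cells \<open>F f \<Rightarrow> F g\<close> of \<open>D\<close> that are denoted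
  by a term.
\<close>

lemma (in bicategory) cells_homD:
  assumes "\<mu> \<in> cells C f g" shows "f \<in> hom C X Y \<longleftrightarrow> g \<in> hom C X Y" "f \<in> Arr C" "g \<in> Arr C"
    "Dom C g = Dom C f" "Cod C g = Cod C f"
  using assms parallel[of \<mu>] src_trg[of \<mu>] by (auto simp: cells_def hom_def)

lemma (in bicategory) inverse_cells_unique:
  assumes "inverse_cells C \<mu> \<nu>" "inverse_cells C \<mu> \<nu>'" shows "\<nu> = \<nu>'"
proof -
  let ?f = "Src C \<mu>" let ?g = "Trg C \<mu>"
  have m: "\<mu> \<in> cells C ?f ?g" and n: "\<nu> \<in> cells C ?g ?f" and n': "\<nu>' \<in> cells C ?g ?f"
    and e: "\<nu> \<bullet> \<mu> = Id2 C ?f" "\<mu> \<bullet> \<nu>' = Id2 C ?g"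
    using assms by (auto simp: inverse_cells_def cells_def)
  have "\<nu> = \<nu> \<bullet> (\<mu> \<bullet> \<nu>')" using Vcomp_Id2(1)[OF n] e by simp
  also have "\<dots> = (\<nu> \<bullet> \<mu>) \<bullet> \<nu>'" using Vcomp_assoc[OF n' m n] by simp
  also have "\<dots> = \<nu>'" using Vcomp_Id2(2)[OF n'] e by simp
  finally show ?thesis .
qed

lemma (in bicategory) inverse_inv_cell:
  "invertible C \<mu> \<Longrightarrow> inverse_cells C \<mu> (inv_cell C \<mu>)"
  unfolding invertible_def inv_cell_def by (metis inverse_cells_unique theI)

lemma (in bicategory) inv_cell_cells:
  "\<mu> \<in> inv_cells C f g \<Longrightarrow> inv_cell C \<mu> \<in> cells C g f"
  using inverse_inv_cell[of \<mu>] by (auto simp: inv_cells_def inverse_cells_def cells_def)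

datatype ('a, 'c) cell_term =
    TB 'c | TV "('a, 'c) cell_term" "('a, 'c) cell_term" | TH "('a, 'c) cell_term" "('a, 'c) cell_term"
  | TP 'a 'a 'a "('a, 'c) cell_term" | TQ 'a 'a 'a "('a, 'c) cell_term"

fun encode_term :: "('a, 'c) cell_term \<Rightarrow> ('a + 'c + nat) list" where
  "encode_term (TB \<mu>) = [Inr (Inl \<mu>)]"
| "encode_term (TV s t) = Inr (Inr 0) # encode_term s @ encode_term t"
| "encode_term (TH s t) = Inr (Inr 1) # encode_term s @ encode_term t"
| "encode_term (TP w u v t) = Inr (Inr 2) # Inl w # Inl u # Inl v # encode_term t"
| "encode_term (TQ w u v t) = Inr (Inr 3) # Inl w # Inl u # Inl v # encode_term t"

lemma encode_term_prefix: "encode_term s @ xs = encode_term t @ ys \<Longrightarrow> s = t \<and> xs = ys"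
proof (induction s arbitrary: t xs ys)
  case (TB x) then show ?case by (cases t) simp_all
next
  case (TV s1 s2)
  from TV.prems obtain t1 t2 where t: "t = TV t1 t2" by (cases t) simp_all
  with TV.prems have "encode_term s1 @ (encode_term s2 @ xs) = encode_term t1 @ (encode_term t2 @ ys)" by simp
  from TV.IH(1)[OF this] TV.IH(2) show ?case unfolding t by blast
next
  case (TH s1 s2)
  from TH.prems obtain t1 t2 where t: "t = TH t1 t2" by (cases t) simp_all
  with TH.prems have "encode_term s1 @ (encode_term s2 @ xs) = encode_term t1 @ (encode_term t2 @ ys)" by simp
  from TH.IH(1)[OF this] TH.IH(2) show ?case unfolding t by blast
next
  case (TP w u v s) then show ?case by (cases t) simp_all
next
  case (TQ w u v s) then show ?case by (cases t) simp_all
qed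

lemma inj_encode_term: "inj encode_term"
  by (rule injI) (use encode_term_prefix[of _ "[]" _ "[]"] in simp)

text \<open>
  \<open>TB\<close> denotes images of cells of \<open>C\<close>, \<open>TV\<close> and \<open>TH\<close> vertical and horizontal composites, and
  \<open>TP w u v\<close>, \<open>TQ w u v\<close> the unique 2-cell \<open>F u \<Rightarrow> F v\<close> with a given composite with
  \<open>F w\<close>, for \<open>w\<close> a weak equivalence.
\<close>

locale localization = C: bicategory C + D: bicategory D
  for C :: "('o, 'a, 'c) bicat" and D :: "('p, 'b, 'd) bicat" +
  fixes Weq :: "'a set" and F0 F1 F2
  assumes F: "two_functor C D F0 F1 F2"
    and W: "w \<in> Weq \<Longrightarrow> quasiequivalence D (F1 w)"
    and Weq: "Weq \<subseteq> Arr C"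
begin

lemma F_Arr: "f \<in> hom C X Y \<Longrightarrow> F1 f \<in> hom D (F0 X) (F0 Y)"
  using F by (auto simp: two_functor_def hom_def)

lemma F_cells: "\<mu> \<in> cells C f g \<Longrightarrow> F2 \<mu> \<in> cells D (F1 f) (F1 g)"
  using F by (auto simp: two_functor_def cells_def)

lemma F_comp: "f \<in> hom C X Y \<Longrightarrow> g \<in> hom C Y Z \<Longrightarrow> F1 (g \<odot>\<^bsub>C\<^esub> f) = F1 g \<odot>\<^bsub>D\<^esub> F1 f"
  using F by (auto simp: two_functor_def hom_def)

lemma F_Id1: "X \<in> Obj C \<Longrightarrow> F1 (Id1 C X) = Id1 D (F0 X)"
  using F by (auto simp: two_functor_def)

lemma F_Obj: "X \<in> Obj C \<Longrightarrow> F0 X \<in> Obj D"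
  using F by (auto simp: two_functor_def)

lemma F_unary: "f \<in> Arr C \<Longrightarrow> F2 (Id2 C f) = Id2 D (F1 f)"
  "f \<in> Arr C \<Longrightarrow> F2 (Lun C f) = Lun D (F1 f)" "f \<in> Arr C \<Longrightarrow> F2 (Run C f) = Run D (F1 f)"
  using F by (auto simp: two_functor_def)

lemma F_Asc: "f \<in> hom C X Y \<Longrightarrow> g \<in> hom C Y Z \<Longrightarrow> h \<in> hom C Z V \<Longrightarrow>
  F2 (Asc C h g f) = Asc D (F1 h) (F1 g) (F1 f)"
  using F by (auto simp: two_functor_def hom_def)

lemma F_Vcomp: "\<mu> \<in> cells C f g \<Longrightarrow> \<nu> \<in> cells C g h \<Longrightarrow> F2 (\<nu> \<bullet>\<^bsub>C\<^esub> \<mu>) = F2 \<nu> \<bullet>\<^bsub>D\<^esub> F2 \<mu>"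
  using F by (auto simp: two_functor_def cells_def)

lemma F_Hcomp: "\<mu> \<in> cells C f f' \<Longrightarrow> \<nu> \<in> cells C g g' \<Longrightarrow> f \<in> hom C X Y \<Longrightarrow> g \<in> hom C Y Z \<Longrightarrow>
  F2 (\<nu> \<ast>\<^bsub>C\<^esub> \<mu>) = F2 \<nu> \<ast>\<^bsub>D\<^esub> F2 \<mu>"
  using F by (auto simp: two_functor_def cells_def hom_def)

lemma W_hom: "w \<in> Weq \<Longrightarrow> w \<in> hom C (Dom C w) (Cod C w)"
  using Weq by (auto simp: hom_def)

lemma FW:
  assumes "w \<in> Weq" "Z \<in> Obj D"
  shows "u \<in> hom D Z (F0 (Dom C w)) \<Longrightarrow> v \<in> hom D Z (F0 (Dom C w)) \<Longrightarrow>
      bij_betw (\<lambda>\<mu>. Id2 D (F1 w) \<ast>\<^bsub>D\<^esub> \<mu>) (cells D u v) (cells D (F1 w \<odot>\<^bsub>D\<^esub> u) (F1 w \<odot>\<^bsub>D\<^esub> v))"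
    "u \<in> hom D (F0 (Cod C w)) Z \<Longrightarrow> v \<in> hom D (F0 (Cod C w)) Z \<Longrightarrow>
      bij_betw (\<lambda>\<mu>. \<mu> \<ast>\<^bsub>D\<^esub> Id2 D (F1 w)) (cells D u v) (cells D (u \<odot>\<^bsub>D\<^esub> F1 w) (v \<odot>\<^bsub>D\<^esub> F1 w))"
proof -
  have w: "F1 w \<in> hom D (F0 (Dom C w)) (F0 (Cod C w))" by (rule F_Arr[OF W_hom[OF assms(1)]])
  hence wd: "Dom D (F1 w) = F0 (Dom C w)" "Cod D (F1 w) = F0 (Cod C w)" "F1 w \<in> Arr D"
    by (auto simp: hom_def)
  note i = D.Id2_cells[OF wd(3)]
  note q = W[OF assms(1), unfolded quasiequivalence_def, THEN conjunct2, rule_format, OF assms(2)]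
  show "bij_betw (\<lambda>\<mu>. Id2 D (F1 w) \<ast>\<^bsub>D\<^esub> \<mu>) (cells D u v) (cells D (F1 w \<odot>\<^bsub>D\<^esub> u) (F1 w \<odot>\<^bsub>D\<^esub> v))"
    if u: "u \<in> hom D Z (F0 (Dom C w))" and v: "v \<in> hom D Z (F0 (Dom C w))"
    unfolding bij_betw_def
  proof
    show "inj_on (\<lambda>\<mu>. Id2 D (F1 w) \<ast>\<^bsub>D\<^esub> \<mu>) (cells D u v)"
      using q u v by (simp add: faithful_functor_def hom_cat_def wd)
    have "\<forall>e \<in> cells D (F1 w \<odot>\<^bsub>D\<^esub> u) (F1 w \<odot>\<^bsub>D\<^esub> v). \<exists>c \<in> cells D u v. Id2 D (F1 w) \<ast>\<^bsub>D\<^esub> c = e"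
      using q u v by (simp add: full_functor_def hom_cat_def wd)
    then show "(\<lambda>\<mu>. Id2 D (F1 w) \<ast>\<^bsub>D\<^esub> \<mu>) ` cells D u v = cells D (F1 w \<odot>\<^bsub>D\<^esub> u) (F1 w \<odot>\<^bsub>D\<^esub> v)"
      using D.Hcomp_cells[OF u w _ i, of _ v] by (auto simp: image_def)
  qed
  show "bij_betw (\<lambda>\<mu>. \<mu> \<ast>\<^bsub>D\<^esub> Id2 D (F1 w)) (cells D u v) (cells D (u \<odot>\<^bsub>D\<^esub> F1 w) (v \<odot>\<^bsub>D\<^esub> F1 w))"
    if u: "u \<in> hom D (F0 (Cod C w)) Z" and v: "v \<in> hom D (F0 (Cod C w)) Z"
    unfolding bij_betw_def
  proof
    show "inj_on (\<lambda>\<mu>. \<mu> \<ast>\<^bsub>D\<^esub> Id2 D (F1 w)) (cells D u v)"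
      using q u v by (simp add: faithful_functor_def hom_cat_def wd)
    have "\<forall>e \<in> cells D (u \<odot>\<^bsub>D\<^esub> F1 w) (v \<odot>\<^bsub>D\<^esub> F1 w). \<exists>c \<in> cells D u v. c \<ast>\<^bsub>D\<^esub> Id2 D (F1 w) = e"
      using q u v by (simp add: full_functor_def hom_cat_def wd)
    then show "(\<lambda>\<mu>. \<mu> \<ast>\<^bsub>D\<^esub> Id2 D (F1 w)) ` cells D u v = cells D (u \<odot>\<^bsub>D\<^esub> F1 w) (v \<odot>\<^bsub>D\<^esub> F1 w)"
      using D.Hcomp_cells[OF w u i, of _ v] by (auto simp: image_def)
  qed
qed

inductive ev :: "('a, 'c) cell_term \<Rightarrow> 'a \<Rightarrow> 'a \<Rightarrow> 'd \<Rightarrow> bool" where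
  TB: "\<mu> \<in> cells C f g \<Longrightarrow> ev (TB \<mu>) f g (F2 \<mu>)"
| TV: "ev s f g c \<Longrightarrow> ev t g h d \<Longrightarrow> ev (TV t s) f h (d \<bullet>\<^bsub>D\<^esub> c)"
| TH: "ev s f f' c \<Longrightarrow> ev t g g' d \<Longrightarrow> f \<in> hom C X Y \<Longrightarrow> g \<in> hom C Y Z \<Longrightarrow>
    ev (TH t s) (g \<odot>\<^bsub>C\<^esub> f) (g' \<odot>\<^bsub>C\<^esub> f') (d \<ast>\<^bsub>D\<^esub> c)"
| TP: "w \<in> Weq \<Longrightarrow> u \<in> hom C Z (Dom C w) \<Longrightarrow> v \<in> hom C Z (Dom C w) \<Longrightarrow>
    c \<in> cells D (F1 u) (F1 v) \<Longrightarrow> ev t (w \<odot>\<^bsub>C\<^esub> u) (w \<odot>\<^bsub>C\<^esub> v) (Id2 D (F1 w) \<ast>\<^bsub>D\<^esub> c) \<Longrightarrow>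
    ev (TP w u v t) u v c"
| TQ: "w \<in> Weq \<Longrightarrow> u \<in> hom C (Cod C w) Z \<Longrightarrow> v \<in> hom C (Cod C w) Z \<Longrightarrow>
    c \<in> cells D (F1 u) (F1 v) \<Longrightarrow> ev t (u \<odot>\<^bsub>C\<^esub> w) (v \<odot>\<^bsub>C\<^esub> w) (c \<ast>\<^bsub>D\<^esub> Id2 D (F1 w)) \<Longrightarrow>
    ev (TQ w u v t) u v c"

definition par where "par f g \<longleftrightarrow> f \<in> Arr C \<and> g \<in> hom C (Dom C f) (Cod C f)"

lemma ev_typed: "ev t f g c \<Longrightarrow> par f g \<and> c \<in> cells D (F1 f) (F1 g)"
proof (induction rule: ev.induct)
  case (TB \<mu> f g)
  then show ?case using C.cells_homD[OF TB] F_cells[OF TB] by (auto simp: par_def hom_def)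
next
  case (TV s f g c t h d)
  then show ?case using D.Vcomp_cells[of c "F1 f" "F1 g" d "F1 h"] by (auto simp: par_def hom_def)
next
  case (TH s f f' c t g g' d X Y Z)
  have f': "f' \<in> hom C X Y" and g': "g' \<in> hom C Y Z" using TH by (auto simp: par_def hom_def)
  have "g \<odot>\<^bsub>C\<^esub> f \<in> hom C X Z" "g' \<odot>\<^bsub>C\<^esub> f' \<in> hom C X Z"
    using C.Comp1_hom TH f' g' by blast+
  then show ?case using D.Hcomp_cells[OF F_Arr[OF TH.hyps(3)] F_Arr[OF TH.hyps(4)], of c "F1 f'" d "F1 g'"]
      TH F_comp[OF TH.hyps(3,4)] F_comp[OF f' g'] by (auto simp: par_def hom_def)
qed (auto simp: par_def hom_def)

lemma ev_functional: "ev t f g c \<Longrightarrow> ev t f' g' c' \<Longrightarrow> f = f' \<and> g = g' \<and> c = c'"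
proof (induction arbitrary: f' g' c' rule: ev.induct)
  case (TB \<mu> f g)
  from TB.prems show ?case using TB.hyps by cases (auto simp: cells_def)
next
  case (TV s f g c t h d)
  from TV.prems show ?case by cases (use TV.IH in blast)
next
  case (TH s f f' c t g g' d X Y Z)
  from TH.prems show ?case by cases (use TH.IH in blast)
next
  case (TP w u Z v c t)
  from TP.prems show ?case
  proof cases
    case TP': (TP Z')
    have Z: "F0 Z \<in> Obj D" using TP.hyps(2) F_Obj by (auto simp: hom_def)
    have "Id2 D (F1 w) \<ast>\<^bsub>D\<^esub> c = Id2 D (F1 w) \<ast>\<^bsub>D\<^esub> c'" using TP.IH TP' by blast
    with FW(1)[OF TP.hyps(1) Z F_Arr[OF TP.hyps(2)] F_Arr[OF TP.hyps(3)]] have "c = c'"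
      using TP.hyps(4) TP' by (auto simp: bij_betw_def inj_on_def)
    then show ?thesis using TP' by simp
  qed
next
  case (TQ w u Z v c t)
  from TQ.prems show ?case
  proof cases
    case TQ': (TQ Z')
    have Z: "F0 Z \<in> Obj D" using TQ.hyps(2) F_Obj by (auto simp: hom_def)
    have "c \<ast>\<^bsub>D\<^esub> Id2 D (F1 w) = c' \<ast>\<^bsub>D\<^esub> Id2 D (F1 w)" using TQ.IH TQ' by blast
    with FW(2)[OF TQ.hyps(1) Z F_Arr[OF TQ.hyps(2)] F_Arr[OF TQ.hyps(3)]] have "c = c'"
      using TQ.hyps(4) TQ' by (auto simp: bij_betw_def inj_on_def)
    then show ?thesis using TQ' by simp
  qed
qed

definition gen where "gen f g c \<longleftrightarrow> (\<exists>t. ev t f g c)"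

definition cell_code :: "'a \<Rightarrow> 'a \<Rightarrow> 'd \<Rightarrow> ('a + 'c + nat) list" where
  "cell_code f g c = encode_term (SOME t. ev t f g c)"

lemma cell_code_inj:
  assumes "gen f g c" "gen f' g' c'" "cell_code f g c = cell_code f' g' c'"
  shows "f = f' \<and> g = g' \<and> c = c'"
proof -
  have "ev (SOME t. ev t f g c) f g c" "ev (SOME t. ev t f' g' c') f' g' c'"
    using assms(1,2)[unfolded gen_def, THEN someI_ex] by simp_all
  moreover have "(SOME t. ev t f g c) = (SOME t. ev t f' g' c')"
    using assms(3) inj_encode_term unfolding cell_code_def by (auto dest: injD)
  ultimately show ?thesis using ev_functional by metis
qed

definition dsrc where "dsrc x = (THE f. \<exists>g c. gen f g c \<and> x = cell_code f g c)"
definition dtrg where "dtrg x = (THE g. \<exists>f c. gen f g c \<and> x = cell_code f g c)"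
definition dval where "dval x = (THE c. \<exists>f g. gen f g c \<and> x = cell_code f g c)"

lemma dec [simp]:
  assumes "gen f g c"
  shows "dsrc (cell_code f g c) = f" "dtrg (cell_code f g c) = g" "dval (cell_code f g c) = c"
  unfolding dsrc_def dtrg_def dval_def by (rule the_equality, use assms cell_code_inj in blast, use assms cell_code_inj in blast)+

definition E :: "('o, 'a, ('a + 'c + nat) list) bicat" where
  "E = \<lparr>Obj = Obj C, Arr = Arr C, Cell = {cell_code f g c | f g c. gen f g c},
     Dom = Dom C, Cod = Cod C, Src = dsrc, Trg = dtrg, Id1 = Id1 C, Comp1 = Comp1 C,
     Id2 = (\<lambda>f. cell_code f f (Id2 D (F1 f))),
     Vcomp = (\<lambda>y x. cell_code (dsrc x) (dtrg y) (dval y \<bullet>\<^bsub>D\<^esub> dval x)),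
     Hcomp = (\<lambda>y x. cell_code (dsrc y \<odot>\<^bsub>C\<^esub> dsrc x) (dtrg y \<odot>\<^bsub>C\<^esub> dtrg x) (dval y \<ast>\<^bsub>D\<^esub> dval x)),
     Asc = (\<lambda>h g f. cell_code ((h \<odot>\<^bsub>C\<^esub> g) \<odot>\<^bsub>C\<^esub> f) (h \<odot>\<^bsub>C\<^esub> g \<odot>\<^bsub>C\<^esub> f) (F2 (Asc C h g f))),
     Lun = (\<lambda>f. cell_code (Id1 C (Cod C f) \<odot>\<^bsub>C\<^esub> f) f (F2 (Lun C f))),
     Run = (\<lambda>f. cell_code (f \<odot>\<^bsub>C\<^esub> Id1 C (Dom C f)) f (F2 (Run C f)))\<rparr>"

lemma hom_E [simp]: "hom E = hom C" by (auto simp: hom_def E_def fun_eq_iff)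

lemma E_simps [simp]: "Obj E = Obj C" "Arr E = Arr C" "Dom E = Dom C" "Cod E = Cod C"
  "Id1 E = Id1 C" "Comp1 E = Comp1 C" by (simp_all add: E_def)

lemma cells_E: "cells E f g = cell_code f g ` {c. gen f g c}"
  unfolding cells_def E_def by auto

lemma gen_cells: "gen f g c \<Longrightarrow> c \<in> cells D (F1 f) (F1 g)"
  and gen_par: "gen f g c \<Longrightarrow> par f g"
  using ev_typed by (auto simp: gen_def)

lemma gen_hom: "gen f g c \<Longrightarrow> f \<in> hom C X Y \<Longrightarrow> g \<in> hom C X Y"
  using gen_par[of f g c] by (auto simp: par_def hom_def)

lemma gen_B: "\<mu> \<in> cells C f g \<Longrightarrow> gen f g (F2 \<mu>)" using TB by (auto simp: gen_def)
lemma gen_V: "gen f g c \<Longrightarrow> gen g h d \<Longrightarrow> gen f h (d \<bullet>\<^bsub>D\<^esub> c)" unfolding gen_def using TV by blast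
lemma gen_H: "gen f f' c \<Longrightarrow> gen g g' d \<Longrightarrow> f \<in> hom C X Y \<Longrightarrow> g \<in> hom C Y Z \<Longrightarrow>
  gen (g \<odot>\<^bsub>C\<^esub> f) (g' \<odot>\<^bsub>C\<^esub> f') (d \<ast>\<^bsub>D\<^esub> c)" unfolding gen_def using TH by blast
lemma gen_I: "f \<in> hom C X Y \<Longrightarrow> gen f f (Id2 D (F1 f))"
  using gen_B[OF C.Id2_cells, of f] F_unary(1)[of f] by (auto simp: hom_def)

lemma E_V: "gen f g c \<Longrightarrow> gen g h d \<Longrightarrow> cell_code g h d \<bullet>\<^bsub>E\<^esub> cell_code f g c = cell_code f h (d \<bullet>\<^bsub>D\<^esub> c)"
  by (simp add: E_def)
lemma E_H: "gen f f' c \<Longrightarrow> gen g g' d \<Longrightarrow>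
  cell_code g g' d \<ast>\<^bsub>E\<^esub> cell_code f f' c = cell_code (g \<odot>\<^bsub>C\<^esub> f) (g' \<odot>\<^bsub>C\<^esub> f') (d \<ast>\<^bsub>D\<^esub> c)"
  by (simp add: E_def)
lemma E_I: "Id2 E f = cell_code f f (Id2 D (F1 f))" by (simp add: E_def)

lemma E_inv:
  assumes "\<mu> \<in> inv_cells C f g"
  shows "cell_code f g (F2 \<mu>) \<in> inv_cells E f g"
proof -
  have m: "\<mu> \<in> cells C f g" using assms by (auto simp: inv_cells_def)
  obtain \<nu> where "inverse_cells C \<mu> \<nu>" using assms by (auto simp: inv_cells_def invertible_def)
  hence n: "\<nu> \<in> cells C g f" and e: "\<nu> \<bullet>\<^bsub>C\<^esub> \<mu> = Id2 C f" "\<mu> \<bullet>\<^bsub>C\<^esub> \<nu> = Id2 C g"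
    using m by (auto simp: inverse_cells_def cells_def)
  note g = gen_B[OF m] gen_B[OF n]
  have a: "f \<in> Arr C" "g \<in> Arr C" using C.cells_homD[OF m] by auto
  have c: "cell_code f g (F2 \<mu>) \<in> cells E f g" "cell_code g f (F2 \<nu>) \<in> cells E g f" using g by (auto simp: cells_E)
  have "inverse_cells E (cell_code f g (F2 \<mu>)) (cell_code g f (F2 \<nu>))"
    using c a e F_Vcomp[OF m n] F_Vcomp[OF n m]
    by (auto simp: inverse_cells_def E_V[OF g] E_V[OF g(2,1)] E_I F_unary cells_def[of E] E_def[THEN arg_cong[of _ _ Src]]
        E_def[THEN arg_cong[of _ _ Trg]] g)
  then show ?thesis using c by (auto simp: inv_cells_def invertible_def)
qed

lemma E_Asc: "Asc E h g f = cell_code ((h \<odot>\<^bsub>C\<^esub> g) \<odot>\<^bsub>C\<^esub> f) (h \<odot>\<^bsub>C\<^esub> g \<odot>\<^bsub>C\<^esub> f) (F2 (Asc C h g f))"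
  by (simp add: E_def)
lemma E_Lun: "f \<in> hom C X Y \<Longrightarrow> Lun E f = cell_code (Id1 C Y \<odot>\<^bsub>C\<^esub> f) f (F2 (Lun C f))"
  by (simp add: E_def hom_def)
lemma E_Run: "f \<in> hom C X Y \<Longrightarrow> Run E f = cell_code (f \<odot>\<^bsub>C\<^esub> Id1 C X) f (F2 (Run C f))"
  by (simp add: E_def hom_def)

lemma gen_Asc: "f \<in> hom C X Y \<Longrightarrow> g \<in> hom C Y Z \<Longrightarrow> h \<in> hom C Z V \<Longrightarrow>
  gen ((h \<odot>\<^bsub>C\<^esub> g) \<odot>\<^bsub>C\<^esub> f) (h \<odot>\<^bsub>C\<^esub> g \<odot>\<^bsub>C\<^esub> f) (F2 (Asc C h g f))"
  using C.Asc_cells gen_B by (auto simp: inv_cells_def)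
lemma gen_Lun: "f \<in> hom C X Y \<Longrightarrow> gen (Id1 C Y \<odot>\<^bsub>C\<^esub> f) f (F2 (Lun C f))"
  using C.Lun_cells gen_B by (auto simp: inv_cells_def)
lemma gen_Run: "f \<in> hom C X Y \<Longrightarrow> gen (f \<odot>\<^bsub>C\<^esub> Id1 C X) f (F2 (Run C f))"
  using C.Run_cells gen_B by (auto simp: inv_cells_def)

lemma hom_Arr: "f \<in> hom C X Y \<Longrightarrow> f \<in> Arr C" by (simp add: hom_def)
lemma hom_Obj: "f \<in> hom C X Y \<Longrightarrow> X \<in> Obj C \<and> Y \<in> Obj C" by (auto simp: hom_def)

lemma E_cells_E: "x \<in> Cell E \<Longrightarrow> \<exists>f g c. gen f g c \<and> x = cell_code f g c" by (auto simp: E_def)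

lemma bicategory_E: "bicategory E"
proof (unfold_locales, unfold hom_E E_simps)
  show "f \<in> Arr C \<Longrightarrow> Dom C f \<in> Obj C" "f \<in> Arr C \<Longrightarrow> Cod C f \<in> Obj C" for f by auto
  fix x
  assume "x \<in> Cell E"
  then obtain f g c where g: "gen f g c" "x = cell_code f g c" using E_cells_E by blast
  hence "Src E x = f" "Trg E x = g" by (auto simp: E_def)
  then show "Src E x \<in> Arr C" "Trg E x \<in> Arr C" "Dom C (Trg E x) = Dom C (Src E x)"
    "Cod C (Trg E x) = Cod C (Src E x)" using gen_par[OF g(1)] by (auto simp: par_def hom_def)
next
  show "X \<in> Obj C \<Longrightarrow> Id1 C X \<in> hom C X X" for X by (rule C.Id1_hom)
  show "f \<in> hom C X Y \<Longrightarrow> g \<in> hom C Y Z \<Longrightarrow> g \<odot>\<^bsub>C\<^esub> f \<in> hom C X Z" for f g X Y Z by (rule C.Comp1_hom)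
  show "f \<in> Arr C \<Longrightarrow> Id2 E f \<in> cells E f f" for f
    using gen_I[of f] by (auto simp: E_I cells_E hom_def)
next
  fix x y f g h assume "x \<in> cells E f g" "y \<in> cells E g h"
  then show "y \<bullet>\<^bsub>E\<^esub> x \<in> cells E f h" by (auto simp: cells_E E_V intro: gen_V)
next
  fix x y z f g h k assume "x \<in> cells E f g" "y \<in> cells E g h" "z \<in> cells E h k"
  then show "(z \<bullet>\<^bsub>E\<^esub> y) \<bullet>\<^bsub>E\<^esub> x = z \<bullet>\<^bsub>E\<^esub> (y \<bullet>\<^bsub>E\<^esub> x)"
    using D.Vcomp_assoc[OF gen_cells gen_cells gen_cells]
    by (auto simp: cells_E E_V gen_V)
next
  fix x f g assume "x \<in> cells E f g"
  then obtain c where c: "gen f g c" "x = cell_code f g c" by (auto simp: cells_E)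
  have a: "f \<in> hom C (Dom C f) (Cod C f)" "g \<in> hom C (Dom C f) (Cod C f)"
    using gen_par[OF c(1)] by (auto simp: par_def hom_def)
  show "x \<bullet>\<^bsub>E\<^esub> Id2 E f = x" "Id2 E g \<bullet>\<^bsub>E\<^esub> x = x"
    using c a gen_I D.Vcomp_Id2[OF gen_cells[OF c(1)]] by (simp_all add: E_I E_V)
next
  fix f g X Y Z x y f' g'
  assume "f \<in> hom C X Y" "g \<in> hom C Y Z" "x \<in> cells E f f'" "y \<in> cells E g g'"
  then show "y \<ast>\<^bsub>E\<^esub> x \<in> cells E (g \<odot>\<^bsub>C\<^esub> f) (g' \<odot>\<^bsub>C\<^esub> f')"
    by (auto simp: cells_E E_H intro: gen_H)
next
  fix f g X Y Z
  assume a: "f \<in> hom C X Y" "g \<in> hom C Y Z"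
  then show "Id2 E g \<ast>\<^bsub>E\<^esub> Id2 E f = Id2 E (g \<odot>\<^bsub>C\<^esub> f)"
    using D.Hcomp_Id2[OF F_Arr F_Arr, OF a] F_comp[OF a] by (simp add: E_I E_H gen_I)
next
  fix f g X Y Z x f' x' f'' y g' y' g''
  assume a: "f \<in> hom C X Y" "g \<in> hom C Y Z"
    and "x \<in> cells E f f'" "x' \<in> cells E f' f''" "y \<in> cells E g g'" "y' \<in> cells E g' g''"
  then obtain c c' d d' where c: "gen f f' c" "gen f' f'' c'" "gen g g' d" "gen g' g'' d'"
    "x = cell_code f f' c" "x' = cell_code f' f'' c'" "y = cell_code g g' d" "y' = cell_code g' g'' d'"
    by (auto simp: cells_E)
  show "(y' \<bullet>\<^bsub>E\<^esub> y) \<ast>\<^bsub>E\<^esub> (x' \<bullet>\<^bsub>E\<^esub> x) = (y' \<ast>\<^bsub>E\<^esub> x') \<bullet>\<^bsub>E\<^esub> (y \<ast>\<^bsub>E\<^esub> x)"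
    using D.interchange[OF F_Arr[OF a(1)] F_Arr[OF a(2)] c(1-4)[THEN gen_cells]]
    by (simp add: c E_V E_H gen_V gen_V[OF c(1,2)] gen_V[OF c(3,4)] gen_H[OF c(1,3) a]
        E_H[OF gen_V[OF c(1,2)] gen_V[OF c(3,4)]]
        E_V[OF gen_H[OF c(1,3) a] gen_H[OF c(2,4) gen_hom[OF c(1) a(1)] gen_hom[OF c(3) a(2)]]])
next
  fix f X Y g Z h V
  assume a: "f \<in> hom C X Y" "g \<in> hom C Y Z" "h \<in> hom C Z V"
  show "Asc E h g f \<in> inv_cells E ((h \<odot>\<^bsub>C\<^esub> g) \<odot>\<^bsub>C\<^esub> f) (h \<odot>\<^bsub>C\<^esub> g \<odot>\<^bsub>C\<^esub> f)"
    using E_inv[OF C.Asc_cells[OF a]] by (simp add: E_Asc)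
next
  fix f X Y assume a: "f \<in> hom C X Y"
  show "Lun E f \<in> inv_cells E (Id1 C Y \<odot>\<^bsub>C\<^esub> f) f" "Run E f \<in> inv_cells E (f \<odot>\<^bsub>C\<^esub> Id1 C X) f"
    using E_inv[OF C.Lun_cells[OF a]] E_inv[OF C.Run_cells[OF a]] a by (simp_all add: E_Lun E_Run)
next
  fix f X Y g Z h V x f' y g' z h'
  assume a: "f \<in> hom C X Y" "g \<in> hom C Y Z" "h \<in> hom C Z V"
    and "x \<in> cells E f f'" "y \<in> cells E g g'" "z \<in> cells E h h'"
  then obtain c d e where c: "gen f f' c" "gen g g' d" "gen h h' e"
    and x: "x = cell_code f f' c" "y = cell_code g g' d" "z = cell_code h h' e" by (auto simp: cells_E)
  note a' = gen_hom[OF c(1) a(1)] gen_hom[OF c(2) a(2)] gen_hom[OF c(3) a(3)]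
  note h1 = gen_H[OF c(2,3) a(2,3)]
  note h2 = gen_H[OF c(1,2) a(1,2)]
  note h3 = gen_H[OF c(1) h1 a(1) C.Comp1_hom[OF a(2,3)]]
  note h4 = gen_H[OF h2 c(3) C.Comp1_hom[OF a(1,2)] a(3)]
  show "Asc E h' g' f' \<bullet>\<^bsub>E\<^esub> ((z \<ast>\<^bsub>E\<^esub> y) \<ast>\<^bsub>E\<^esub> x) = (z \<ast>\<^bsub>E\<^esub> y \<ast>\<^bsub>E\<^esub> x) \<bullet>\<^bsub>E\<^esub> Asc E h g f"
    unfolding x E_Asc E_H[OF c(2,3)] E_H[OF c(1,2)] E_H[OF c(1) h1] E_H[OF h2 c(3)]
      E_V[OF h3 gen_Asc[OF a']] E_V[OF gen_Asc[OF a] h4]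
    using D.Asc_nat[OF a[THEN F_Arr] c[THEN gen_cells]] by (simp add: F_Asc[OF a] F_Asc[OF a'])
next
  fix f X Y x f' assume a: "f \<in> hom C X Y" and "x \<in> cells E f f'"
  then obtain c where c: "gen f f' c" and x: "x = cell_code f f' c" by (auto simp: cells_E)
  note a' = gen_hom[OF c a]
  have XY: "X \<in> Obj C" "Y \<in> Obj C" using hom_Obj[OF a] by auto
  note iX = C.Id1_hom[OF XY(1)] and iY = C.Id1_hom[OF XY(2)]
  show "Lun E f' \<bullet>\<^bsub>E\<^esub> (Id2 E (Id1 C Y) \<ast>\<^bsub>E\<^esub> x) = x \<bullet>\<^bsub>E\<^esub> Lun E f"
    unfolding x E_I E_Lun[OF a] E_Lun[OF a'] E_H[OF c gen_I[OF iY]]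
      E_V[OF gen_H[OF c gen_I[OF iY] a iY] gen_Lun[OF a']] E_V[OF gen_Lun[OF a] c]
    using D.Lun_nat[OF F_Arr[OF a] gen_cells[OF c]]
    by (simp add: F_unary hom_Arr[OF a] hom_Arr[OF a'] F_Id1 XY)
  show "Run E f' \<bullet>\<^bsub>E\<^esub> (x \<ast>\<^bsub>E\<^esub> Id2 E (Id1 C X)) = x \<bullet>\<^bsub>E\<^esub> Run E f"
    unfolding x E_I E_Run[OF a] E_Run[OF a'] E_H[OF gen_I[OF iX] c]
      E_V[OF gen_H[OF gen_I[OF iX] c iX a] gen_Run[OF a']] E_V[OF gen_Run[OF a] c]
    using D.Run_nat[OF F_Arr[OF a] gen_cells[OF c]]
    by (simp add: F_unary hom_Arr[OF a] hom_Arr[OF a'] F_Id1 XY)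
next
  fix f X Y g Z h V k U
  assume a: "f \<in> hom C X Y" "g \<in> hom C Y Z" "h \<in> hom C Z V" "k \<in> hom C V U"
  note gf = C.Comp1_hom[OF a(1,2)] and hg = C.Comp1_hom[OF a(2,3)] and kh = C.Comp1_hom[OF a(3,4)]
  note A1 = gen_Asc[OF a(1,2) kh] and A2 = gen_Asc[OF gf a(3,4)]
  note B1 = gen_H[OF gen_I[OF a(1)] gen_Asc[OF a(2-4)] a(1) C.Comp1_hom[OF a(2) kh]]
  note B2 = gen_Asc[OF a(1) hg a(4)]
  note B3 = gen_H[OF gen_Asc[OF a(1-3)] gen_I[OF a(4)] C.Comp1_hom[OF a(1) hg] a(4)]
  show "Asc E k h (g \<odot>\<^bsub>C\<^esub> f) \<bullet>\<^bsub>E\<^esub> Asc E (k \<odot>\<^bsub>C\<^esub> h) g f =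
       (Id2 E k \<ast>\<^bsub>E\<^esub> Asc E h g f) \<bullet>\<^bsub>E\<^esub> Asc E k (h \<odot>\<^bsub>C\<^esub> g) f \<bullet>\<^bsub>E\<^esub> (Asc E k h g \<ast>\<^bsub>E\<^esub> Id2 E f)"
    unfolding E_I E_Asc E_V[OF A1 A2] E_H[OF gen_I[OF a(1)] gen_Asc[OF a(2-4)]]
      E_H[OF gen_Asc[OF a(1-3)] gen_I[OF a(4)]] E_V[OF B1 B2] E_V[OF gen_V[OF B1 B2] B3]
    using D.pentagon[OF a[THEN F_Arr]]
    by (simp add: F_Asc[OF a(1,2) kh] F_Asc[OF gf a(3,4)] F_Asc[OF a(2-4)] F_Asc[OF a(1) hg a(4)]
       F_Asc[OF a(1-3)] F_comp[OF a(1,2)] F_comp[OF a(2,3)] F_comp[OF a(3,4)])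
next
  fix f X Y g Z assume a: "f \<in> hom C X Y" "g \<in> hom C Y Z"
  have Y: "Y \<in> Obj C" using hom_Obj[OF a(1)] by auto
  note i = C.Id1_hom[OF Y]
  note A1 = gen_Asc[OF a(1) i a(2)]
  note A2 = gen_H[OF gen_Lun[OF a(1)] gen_I[OF a(2)] C.Comp1_hom[OF a(1) i] a(2)]
  show "(Id2 E g \<ast>\<^bsub>E\<^esub> Lun E f) \<bullet>\<^bsub>E\<^esub> Asc E g (Id1 C Y) f = Run E g \<ast>\<^bsub>E\<^esub> Id2 E f"
    unfolding E_I E_Asc E_Lun[OF a(1)] E_Run[OF a(2)] E_H[OF gen_Lun[OF a(1)] gen_I[OF a(2)]]
      E_H[OF gen_I[OF a(1)] gen_Run[OF a(2)]] E_V[OF A1 A2]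
    using D.triangle[OF a[THEN F_Arr]]
    by (simp add: F_Asc[OF a(1) i a(2)] F_unary hom_Arr[OF a(1)] hom_Arr[OF a(2)] F_Id1 Y)
qed

definition G2 where "G2 \<mu> = cell_code (Src C \<mu>) (Trg C \<mu>) (F2 \<mu>)"

lemma G2: "\<mu> \<in> cells C f g \<Longrightarrow> G2 \<mu> = cell_code f g (F2 \<mu>)" by (auto simp: G2_def cells_def)

lemma two_functor_E: "two_functor C E (\<lambda>X. X) (\<lambda>f. f) G2"
proof -
  have c: "\<mu> \<in> cells C (Src C \<mu>) (Trg C \<mu>)" if "\<mu> \<in> Cell C" for \<mu> using that by (auto simp: cells_def)
  have 1: "G2 (Id2 C f) = Id2 E f" "G2 (Lun C f) = Lun E f" "G2 (Run C f) = Run E f"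
    if f: "f \<in> Arr C" for f
  proof -
    have h: "f \<in> hom C (Dom C f) (Cod C f)" using f by (simp add: hom_def)
    show "G2 (Id2 C f) = Id2 E f" using G2[OF C.Id2_cells[OF f]] F_unary f by (simp add: E_I)
    show "G2 (Lun C f) = Lun E f" "G2 (Run C f) = Run E f"
      using C.Lun_cells[OF h] C.Run_cells[OF h]
      by (auto simp: inv_cells_def E_Lun[OF h] E_Run[OF h] dest: G2)
  qed
  have 2: "G2 (\<nu> \<bullet>\<^bsub>C\<^esub> \<mu>) = G2 \<nu> \<bullet>\<^bsub>E\<^esub> G2 \<mu>" if "\<mu> \<in> cells C f g" "\<nu> \<in> cells C g h" for \<mu> \<nu> f g h
    using that by (simp add: G2[OF that(1)] G2[OF that(2)] G2[OF C.Vcomp_cells[OF that]] E_V gen_B F_Vcomp[OF that])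
  have 3: "G2 (\<nu> \<ast>\<^bsub>C\<^esub> \<mu>) = G2 \<nu> \<ast>\<^bsub>E\<^esub> G2 \<mu>"
    if "\<mu> \<in> cells C f f'" "\<nu> \<in> cells C g g'" "f \<in> hom C X Y" "g \<in> hom C Y Z" for \<mu> \<nu> f g f' g' X Y Z
    using that by (simp add: G2[OF that(1)] G2[OF that(2)] G2[OF C.Hcomp_cells[OF that(3,4,1,2)]] E_H gen_B F_Hcomp[OF that])
  have 4: "G2 (Asc C h g f) = Asc E h g f"
    if "f \<in> hom C X Y" "g \<in> hom C Y Z" "h \<in> hom C Z V" for f g h X Y Z V
    using C.Asc_cells[OF that] by (auto simp: inv_cells_def E_Asc dest: G2)
  show ?thesis
    unfolding two_functor_def hom_E E_simps
  proof (intro conjI ballI impI)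
    fix \<mu> assume "\<mu> \<in> Cell C"
    from c[OF this] show "G2 \<mu> \<in> cells E (Src C \<mu>) (Trg C \<mu>)"
      using gen_B by (simp add: G2 cells_E)
  next
    fix \<mu> \<nu> assume m: "\<mu> \<in> Cell C" "\<nu> \<in> Cell C" "Trg C \<mu> = Src C \<nu>"
    show "G2 (\<nu> \<bullet>\<^bsub>C\<^esub> \<mu>) = G2 \<nu> \<bullet>\<^bsub>E\<^esub> G2 \<mu>"
      using 2[of \<mu> "Src C \<mu>" "Trg C \<mu>" \<nu>] m by (auto simp: cells_def)
  next
    fix \<mu> \<nu> assume m: "\<mu> \<in> Cell C" "\<nu> \<in> Cell C" "Cod C (Src C \<mu>) = Dom C (Src C \<nu>)"
    show "G2 (\<nu> \<ast>\<^bsub>C\<^esub> \<mu>) = G2 \<nu> \<ast>\<^bsub>E\<^esub> G2 \<mu>"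
      using 3[OF c[OF m(1)] c[OF m(2)]] m by (auto simp: hom_def)
  qed (use 1 4 in \<open>auto simp: hom_def\<close>)
qed

lemma gen_P:
  assumes "w \<in> Weq" "u \<in> hom C Z (Dom C w)" "v \<in> hom C Z (Dom C w)"
    "c \<in> cells D (F1 u) (F1 v)" "gen (w \<odot>\<^bsub>C\<^esub> u) (w \<odot>\<^bsub>C\<^esub> v) (Id2 D (F1 w) \<ast>\<^bsub>D\<^esub> c)"
  shows "gen u v c"
  using assms TP unfolding gen_def by blast

lemma gen_Q:
  assumes "w \<in> Weq" "u \<in> hom C (Cod C w) Z" "v \<in> hom C (Cod C w) Z"
    "c \<in> cells D (F1 u) (F1 v)" "gen (u \<odot>\<^bsub>C\<^esub> w) (v \<odot>\<^bsub>C\<^esub> w) (c \<ast>\<^bsub>D\<^esub> Id2 D (F1 w))"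
  shows "gen u v c"
  using assms TQ unfolding gen_def by blast

lemma lift_P:
  assumes w: "w \<in> Weq" and u: "u \<in> hom C Z (Dom C w)" and v: "v \<in> hom C Z (Dom C w)"
    and e: "gen (w \<odot>\<^bsub>C\<^esub> u) (w \<odot>\<^bsub>C\<^esub> v) e"
  shows "\<exists>!c. c \<in> cells D (F1 u) (F1 v) \<and> Id2 D (F1 w) \<ast>\<^bsub>D\<^esub> c = e"
    and "\<And>c. c \<in> cells D (F1 u) (F1 v) \<Longrightarrow> Id2 D (F1 w) \<ast>\<^bsub>D\<^esub> c = e \<Longrightarrow> gen u v c"
proof -
  have Z: "F0 Z \<in> Obj D" using u F_Obj by (auto simp: hom_def)
  have "e \<in> cells D (F1 w \<odot>\<^bsub>D\<^esub> F1 u) (F1 w \<odot>\<^bsub>D\<^esub> F1 v)"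
    using gen_cells[OF e] F_comp[OF u W_hom[OF w]] F_comp[OF v W_hom[OF w]] by simp
  with FW(1)[OF w Z F_Arr[OF u] F_Arr[OF v]]
  show "\<exists>!c. c \<in> cells D (F1 u) (F1 v) \<and> Id2 D (F1 w) \<ast>\<^bsub>D\<^esub> c = e"
    unfolding bij_betw_def inj_on_def image_def by (blast elim: equalityE)
  show "\<And>c. c \<in> cells D (F1 u) (F1 v) \<Longrightarrow> Id2 D (F1 w) \<ast>\<^bsub>D\<^esub> c = e \<Longrightarrow> gen u v c"
    using gen_P[OF w u v] e by blast
qed

lemma lift_Q:
  assumes w: "w \<in> Weq" and u: "u \<in> hom C (Cod C w) Z" and v: "v \<in> hom C (Cod C w) Z"
    and e: "gen (u \<odot>\<^bsub>C\<^esub> w) (v \<odot>\<^bsub>C\<^esub> w) e"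
  shows "\<exists>!c. c \<in> cells D (F1 u) (F1 v) \<and> c \<ast>\<^bsub>D\<^esub> Id2 D (F1 w) = e"
    and "\<And>c. c \<in> cells D (F1 u) (F1 v) \<Longrightarrow> c \<ast>\<^bsub>D\<^esub> Id2 D (F1 w) = e \<Longrightarrow> gen u v c"
proof -
  have Z: "F0 Z \<in> Obj D" using u F_Obj by (auto simp: hom_def)
  have "e \<in> cells D (F1 u \<odot>\<^bsub>D\<^esub> F1 w) (F1 v \<odot>\<^bsub>D\<^esub> F1 w)"
    using gen_cells[OF e] F_comp[OF W_hom[OF w] u] F_comp[OF W_hom[OF w] v] by simp
  with FW(2)[OF w Z F_Arr[OF u] F_Arr[OF v]]
  show "\<exists>!c. c \<in> cells D (F1 u) (F1 v) \<and> c \<ast>\<^bsub>D\<^esub> Id2 D (F1 w) = e"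
    unfolding bij_betw_def inj_on_def image_def by (blast elim: equalityE)
  show "\<And>c. c \<in> cells D (F1 u) (F1 v) \<Longrightarrow> c \<ast>\<^bsub>D\<^esub> Id2 D (F1 w) = e \<Longrightarrow> gen u v c"
    using gen_Q[OF w u v] e by blast
qed

lemma quasi_E:
  assumes w: "w \<in> Weq" shows "quasiequivalence E w"
proof -
  note wh = W_hom[OF w]
  have P1: "full_functor (hom_cat E Z (Dom C w)) (hom_cat E Z (Cod C w)) ((\<odot>\<^bsub>C\<^esub>) w) ((\<ast>\<^bsub>E\<^esub>) (Id2 E w))" for Z
    unfolding full_functor_def hom_cat_def cat.simps hom_E
  proof (intro ballI)
    fix u v y assume u: "u \<in> hom C Z (Dom C w)" and v: "v \<in> hom C Z (Dom C w)"
      and "y \<in> cells E (w \<odot>\<^bsub>C\<^esub> u) (w \<odot>\<^bsub>C\<^esub> v)"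
    then obtain e where e: "gen (w \<odot>\<^bsub>C\<^esub> u) (w \<odot>\<^bsub>C\<^esub> v) e" "y = cell_code (w \<odot>\<^bsub>C\<^esub> u) (w \<odot>\<^bsub>C\<^esub> v) e"
      by (auto simp: cells_E)
    from lift_P[OF w u v e(1)] obtain c where "gen u v c" "Id2 D (F1 w) \<ast>\<^bsub>D\<^esub> c = e" by blast
    then show "\<exists>x\<in>cells E u v. Id2 E w \<ast>\<^bsub>E\<^esub> x = y"
      using e E_H[OF _ gen_I[OF wh]] by (auto simp: cells_E E_I)
  qed
  have P2: "faithful_functor (hom_cat E Z (Dom C w)) ((\<odot>\<^bsub>C\<^esub>) w) ((\<ast>\<^bsub>E\<^esub>) (Id2 E w))" for Z
    unfolding faithful_functor_def hom_cat_def cat.simps hom_E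
  proof (intro ballI)
    fix u v assume u: "u \<in> hom C Z (Dom C w)" and v: "v \<in> hom C Z (Dom C w)"
    show "inj_on ((\<ast>\<^bsub>E\<^esub>) (Id2 E w)) (cells E u v)"
    proof (rule inj_onI)
      fix x x' assume "x \<in> cells E u v" "x' \<in> cells E u v" and eq: "Id2 E w \<ast>\<^bsub>E\<^esub> x = Id2 E w \<ast>\<^bsub>E\<^esub> x'"
      then obtain c c' where c: "gen u v c" "x = cell_code u v c" "gen u v c'" "x' = cell_code u v c'"
        by (auto simp: cells_E)
      note h = gen_H[OF c(1) gen_I[OF wh] u wh] gen_H[OF c(3) gen_I[OF wh] u wh]
      have "Id2 D (F1 w) \<ast>\<^bsub>D\<^esub> c = Id2 D (F1 w) \<ast>\<^bsub>D\<^esub> c'"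
        using eq cell_code_inj[OF h] by (simp add: c E_I E_H gen_I[OF wh])
      hence "c = c'" using lift_P(1)[OF w u v h(1)] gen_cells c by metis
      thus "x = x'" using c by simp
    qed
  qed
  have Q1: "full_functor (hom_cat E (Cod C w) Z) (hom_cat E (Dom C w) Z) (\<lambda>u. u \<odot>\<^bsub>C\<^esub> w) (\<lambda>x. x \<ast>\<^bsub>E\<^esub> Id2 E w)" for Z
    unfolding full_functor_def hom_cat_def cat.simps hom_E
  proof (intro ballI)
    fix u v y assume u: "u \<in> hom C (Cod C w) Z" and v: "v \<in> hom C (Cod C w) Z"
      and "y \<in> cells E (u \<odot>\<^bsub>C\<^esub> w) (v \<odot>\<^bsub>C\<^esub> w)"
    then obtain e where e: "gen (u \<odot>\<^bsub>C\<^esub> w) (v \<odot>\<^bsub>C\<^esub> w) e" "y = cell_code (u \<odot>\<^bsub>C\<^esub> w) (v \<odot>\<^bsub>C\<^esub> w) e"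
      by (auto simp: cells_E)
    from lift_Q[OF w u v e(1)] obtain c where "gen u v c" "c \<ast>\<^bsub>D\<^esub> Id2 D (F1 w) = e" by blast
    then show "\<exists>x\<in>cells E u v. x \<ast>\<^bsub>E\<^esub> Id2 E w = y"
      using e E_H[OF gen_I[OF wh]] by (auto simp: cells_E E_I)
  qed
  have Q2: "faithful_functor (hom_cat E (Cod C w) Z) (\<lambda>u. u \<odot>\<^bsub>C\<^esub> w) (\<lambda>x. x \<ast>\<^bsub>E\<^esub> Id2 E w)" for Z
    unfolding faithful_functor_def hom_cat_def cat.simps hom_E
  proof (intro ballI)
    fix u v assume u: "u \<in> hom C (Cod C w) Z" and v: "v \<in> hom C (Cod C w) Z"
    show "inj_on (\<lambda>x. x \<ast>\<^bsub>E\<^esub> Id2 E w) (cells E u v)"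
    proof (rule inj_onI)
      fix x x' assume "x \<in> cells E u v" "x' \<in> cells E u v" and eq: "x \<ast>\<^bsub>E\<^esub> Id2 E w = x' \<ast>\<^bsub>E\<^esub> Id2 E w"
      then obtain c c' where c: "gen u v c" "x = cell_code u v c" "gen u v c'" "x' = cell_code u v c'"
        by (auto simp: cells_E)
      note h = gen_H[OF gen_I[OF wh] c(1) wh u] gen_H[OF gen_I[OF wh] c(3) wh u]
      have "c \<ast>\<^bsub>D\<^esub> Id2 D (F1 w) = c' \<ast>\<^bsub>D\<^esub> Id2 D (F1 w)"
        using eq cell_code_inj[OF h] by (simp add: c E_I E_H gen_I[OF wh])
      hence "c = c'" using lift_Q(1)[OF w u v h(1)] gen_cells c by metis
      thus "x = x'" using c by simp
    qed
  qed
  show ?thesis unfolding quasiequivalence_def E_simps using P1 P2 Q1 Q2 wh by (auto simp: hom_def)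
qed

lemma localizing_E: "localizing C Weq E (\<lambda>X. X) (\<lambda>f. f) G2"
  unfolding localizing_def using bicategory_E two_functor_E quasi_E by blast

lemma hat_cyl_E:
  assumes K: "w_cylinder C Weq X K"
  shows "gen (cyd0 K) (cyd1 K) (hat_cyl C D F1 F2 K) \<and>
    hat_cyl C E (\<lambda>f. f) G2 K = cell_code (cyd0 K) (cyd1 K) (hat_cyl C D F1 F2 K)"
proof -
  let ?a = "inv_cell C (cya1 K) \<bullet>\<^bsub>C\<^esub> cya0 K"
  let ?s = "cys K" let ?u = "cyd0 K" let ?v = "cyd1 K"
  have s: "?s \<in> Weq" and u: "?u \<in> hom C X (Dom C ?s)" and v: "?v \<in> hom C X (Dom C ?s)"
    and a0: "cya0 K \<in> cells C (?s \<odot>\<^bsub>C\<^esub> ?u) (cyx K)" and a1: "cya1 K \<in> inv_cells C (?s \<odot>\<^bsub>C\<^esub> ?v) (cyx K)"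
    using K by (auto simp: w_cylinder_def hom_def inv_cells_def)
  have a: "?a \<in> cells C (?s \<odot>\<^bsub>C\<^esub> ?u) (?s \<odot>\<^bsub>C\<^esub> ?v)"
    by (rule C.Vcomp_cells[OF a0 C.inv_cell_cells[OF a1]])
  let ?c = "hat_cyl C D F1 F2 K"
  have c: "?c \<in> cells D (F1 ?u) (F1 ?v) \<and> Id2 D (F1 ?s) \<ast>\<^bsub>D\<^esub> ?c = F2 ?a"
    unfolding hat_cyl_def by (rule theI'[OF lift_P(1)[OF s u v gen_B[OF a]]])
  have g: "gen ?u ?v ?c" using lift_P(2)[OF s u v gen_B[OF a]] c by blast
  have wh: "?s \<in> hom C (Dom C ?s) (Cod C ?s)" using W_hom[OF s] .
  have "hat_cyl C E (\<lambda>f. f) G2 K = cell_code ?u ?v ?c"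
    unfolding hat_cyl_def[of C E]
  proof (rule the_equality)
    show "cell_code ?u ?v ?c \<in> cells E ?u ?v \<and> Id2 E ?s \<ast>\<^bsub>E\<^esub> cell_code ?u ?v ?c = G2 ?a"
      using g c by (simp add: cells_E E_I E_H gen_I[OF wh] G2[OF a])
    fix x assume x: "x \<in> cells E ?u ?v \<and> Id2 E ?s \<ast>\<^bsub>E\<^esub> x = G2 ?a"
    then obtain d where d: "gen ?u ?v d" "x = cell_code ?u ?v d" by (auto simp: cells_E)
    have "Id2 D (F1 ?s) \<ast>\<^bsub>D\<^esub> d = F2 ?a"
      using x cell_code_inj[OF gen_H[OF d(1) gen_I[OF wh] u wh] gen_B[OF a]]
      by (simp add: d E_I E_H gen_I[OF wh] G2[OF a])
    hence "d = ?c" using lift_P(1)[OF s u v gen_B[OF a]] c gen_cells[OF d(1)] by blast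
    thus "x = cell_code ?u ?v ?c" using d by simp
  qed
  thus ?thesis using g by blast
qed

lemma hat_htpy_E:
  assumes H: "w_homotopy C Weq f g H"
  shows "gen f g (hat_htpy C D F1 F2 H) \<and> hat_htpy C E (\<lambda>f. f) G2 H = cell_code f g (hat_htpy C D F1 F2 H)"
proof -
  have K: "w_cylinder C Weq (Dom C f) (hcyl H)" and h: "hmap H \<in> hom C (cyW (hcyl H)) (Cod C f)"
    and e: "heta H \<in> cells C f (hmap H \<odot>\<^bsub>C\<^esub> cyd0 (hcyl H))"
    and p: "heps H \<in> cells C (hmap H \<odot>\<^bsub>C\<^esub> cyd1 (hcyl H)) g"
    using H by (auto simp: w_homotopy_def)
  have d: "cyd0 (hcyl H) \<in> hom C (Dom C f) (cyW (hcyl H))" using K by (auto simp: w_cylinder_def)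
  note k = hat_cyl_E[OF K]
  note m = gen_H[OF k[THEN conjunct1] gen_I[OF h] d h]
  note n = gen_V[OF gen_B[OF e] m]
  note q = gen_V[OF n gen_B[OF p]]
  show ?thesis unfolding hat_htpy_def k[THEN conjunct2] G2[OF e] G2[OF p] E_I
      E_H[OF k[THEN conjunct1] gen_I[OF h]] E_V[OF gen_B[OF e] m] E_V[OF n gen_B[OF p]]
    using q by simp
qed

lemma hat_seq_E:
  assumes "w_seq C Weq f g S"
  shows "gen f g (hat_seq C D F1 F2 S) \<and> hat_seq C E (\<lambda>f. f) G2 S = cell_code f g (hat_seq C D F1 F2 S)"
  using assms
proof induction
  case (single f g H)
  then show ?case using hat_htpy_E by simp
next
  case (snoc f g S k H)
  note h = hat_htpy_E[OF snoc(2)]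
  obtain G S' where S: "S = G # S'" using snoc(1) by cases auto
  show ?case using snoc(3) h E_V[OF _ h[THEN conjunct1]] gen_V[OF _ h[THEN conjunct1]]
    by (simp add: S)
qed

end

lemma same_class_any_target:
  fixes C :: "('o, 'a, 'c) bicat" and D :: "('p, 'b, 'd) bicat"
  assumes "bicategory C" "Weq \<subseteq> Arr C" "same_class C Weq S T" "localizing C Weq D F0 F1 F2"
  shows "hat_seq C D F1 F2 S = hat_seq C D F1 F2 T"
proof -
  interpret C: bicategory C by fact
  interpret D: bicategory D using assms(4) by (simp add: localizing_def)
  interpret localization C D Weq F0 F1 F2
    using assms by unfold_locales (auto simp: localizing_def)
  obtain f g where S: "w_seq C Weq f g S" and T: "w_seq C Weq f g T"
    using assms(3) by (auto simp: same_class_def)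
  have "hat_seq C E (\<lambda>f. f) G2 S = hat_seq C E (\<lambda>f. f) G2 T"
    using assms(3) localizing_E by (auto simp: same_class_def)
  then show ?thesis using hat_seq_E[OF S] hat_seq_E[OF T] cell_code_inj by metis
qed

end

theory Submission
  imports Defs
begin

text \<open>
  A fibrant-cofibrant object \<open>X\<close> has a fibrant-cofibrant cylinder \<open>K\<close>: factor the codiagonal
  \<open>X + X \<rightarrow> X\<close> as a cofibration followed by a trivial fibration \<open>p : P \<rightarrow> X\<close>. Let \<open>H\<close> be any
  homotopy between arrows \<open>X \<rightarrow> Y\<close>, on a cylinder with weak equivalence \<open>s : W \<rightarrow> Z\<close>, where \<open>Y\<close>
  is fibrant. Factor \<open>s \<cong> q \<odot> t\<close> with \<open>t : W \<rightarrow> W'\<close> a trivial cofibration and \<open>q\<close> a trivial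
  fibration. The map of \<open>H\<close> extends along \<open>t\<close>, since \<open>Y\<close> is fibrant, and the structure of the
  cylinder on \<open>W'\<close> lifts to an arrow \<open>P \<rightarrow> W'\<close>. This yields a homotopy on \<open>K\<close> in the same
  class as \<open>H\<close>. Hence the 2-cells of the homotopy bicategory between arrows \<open>X \<rightarrow> Y\<close> are named by
  finite lists of triples of one arrow in \<open>hom P Y\<close> and two 2-cells between arrows \<open>X \<rightarrow> Y\<close>.
\<close>

section \<open>Calculus of invertible 2-cells\<close>

context bicategory
begin

lemma hom_Arr: "f \<in> hom C X Y \<Longrightarrow> f \<in> Arr C"
  by (simp add: hom_def)

lemma hom_Obj: "f \<in> hom C X Y \<Longrightarrow> X \<in> Obj C" "f \<in> hom C X Y \<Longrightarrow> Y \<in> Obj C"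
  by (auto simp: hom_def)

lemma cells_hom: "\<mu> \<in> cells C f g \<Longrightarrow> f \<in> hom C X Y \<Longrightarrow> g \<in> hom C X Y"
  using cells_homD(1) by blast

lemma inv_cells_cells: "\<mu> \<in> inv_cells C f g \<Longrightarrow> \<mu> \<in> cells C f g"
  by (simp add: inv_cells_def)

lemma inv_cellsI:
  assumes "\<mu> \<in> cells C f g" "\<nu> \<in> cells C g f" "\<nu> \<bullet> \<mu> = Id2 C f" "\<mu> \<bullet> \<nu> = Id2 C g"
  shows "\<mu> \<in> inv_cells C f g" and "inv_cell C \<mu> = \<nu>"
proof -
  have *: "inverse_cells C \<mu> \<nu>" using assms by (auto simp: inverse_cells_def cells_def)
  then show "\<mu> \<in> inv_cells C f g" using assms by (auto simp: inv_cells_def invertible_def)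
  show "inv_cell C \<mu> = \<nu>"
    using * inverse_cells_unique inverse_inv_cell unfolding invertible_def by blast
qed

lemma inv_cell_left: "\<mu> \<in> inv_cells C f g \<Longrightarrow> inv_cell C \<mu> \<bullet> \<mu> = Id2 C f"
  and inv_cell_right: "\<mu> \<in> inv_cells C f g \<Longrightarrow> \<mu> \<bullet> inv_cell C \<mu> = Id2 C g"
  using inverse_inv_cell[of \<mu>] by (auto simp: inv_cells_def inverse_cells_def cells_def)

lemma inv_cell_inv_cells: "\<mu> \<in> inv_cells C f g \<Longrightarrow> inv_cell C \<mu> \<in> inv_cells C g f"
  by (rule inv_cellsI(1)[OF inv_cell_cells inv_cells_cells inv_cell_right inv_cell_left])

lemma Vcomp_cancel_right:
  assumes "\<mu> \<in> cells C f g" "\<nu> \<in> cells C g h" "\<xi> \<in> cells C h g" "\<xi> \<bullet> \<nu> = Id2 C g"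
  shows "\<xi> \<bullet> (\<nu> \<bullet> \<mu>) = \<mu>"
  using Vcomp_assoc[OF assms(1-3)] Vcomp_Id2(2)[OF assms(1)] assms(4) by simp

lemma Vcomp_inv_cells:
  assumes "\<mu> \<in> inv_cells C f g" "\<nu> \<in> inv_cells C g h"
  shows "\<nu> \<bullet> \<mu> \<in> inv_cells C f h"
proof (rule inv_cellsI(1))
  note m = inv_cells_cells[OF assms(1)] inv_cell_cells[OF assms(1)]
  note n = inv_cells_cells[OF assms(2)] inv_cell_cells[OF assms(2)]
  note [simp] = inv_cell_left[OF assms(1)] inv_cell_left[OF assms(2)]
    inv_cell_right[OF assms(1)] inv_cell_right[OF assms(2)]
  show "\<nu> \<bullet> \<mu> \<in> cells C f h" "inv_cell C \<mu> \<bullet> inv_cell C \<nu> \<in> cells C h f"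
    using Vcomp_cells m n by blast+
  show "(inv_cell C \<mu> \<bullet> inv_cell C \<nu>) \<bullet> (\<nu> \<bullet> \<mu>) = Id2 C f"
    using Vcomp_assoc[OF Vcomp_cells[OF m(1) n(1)] n(2) m(2)] Vcomp_cancel_right[OF m(1) n]
    by simp
  show "(\<nu> \<bullet> \<mu>) \<bullet> inv_cell C \<mu> \<bullet> inv_cell C \<nu> = Id2 C h"
    using Vcomp_assoc[OF Vcomp_cells[OF n(2) m(2)] m(1) n(1)] Vcomp_cancel_right[OF n(2) m(2) m(1)]
    by simp
qed

text \<open>Lets an equation of 2-cells be proved after composing with invertible 2-cells, such as
  associators, on the source side.\<close>

lemma Vcomp_epi:
  assumes "a \<in> inv_cells C u v" "\<mu> \<in> cells C v w" "\<nu> \<in> cells C v w" "\<mu> \<bullet> a = \<nu> \<bullet> a"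
  shows "\<mu> = \<nu>"
proof -
  have "\<xi> = (\<xi> \<bullet> a) \<bullet> inv_cell C a" if "\<xi> \<in> cells C v w" for \<xi>
    using Vcomp_assoc[OF inv_cell_cells inv_cells_cells, OF assms(1,1) that] Vcomp_Id2(1)[OF that]
      inv_cell_right[OF assms(1)] by simp
  then show ?thesis using assms(2-4) by metis
qed

section \<open>Whiskering of 2-cells by arrows\<close>

lemma whisker_l:
  assumes "f \<in> hom C X Y" "g \<in> hom C Y Z" "\<mu> \<in> cells C f f'"
  shows "Id2 C g \<ast> \<mu> \<in> cells C (g \<odot> f) (g \<odot> f')"
  using Hcomp_cells[OF assms Id2_cells] assms by (simp add: hom_def)

lemma whisker_r:
  assumes "f \<in> hom C X Y" "g \<in> hom C Y Z" "\<nu> \<in> cells C g g'"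
  shows "\<nu> \<ast> Id2 C f \<in> cells C (g \<odot> f) (g' \<odot> f)"
  using Hcomp_cells[OF assms(1,2) Id2_cells assms(3)] assms by (simp add: hom_def)

lemma whisker_l_Vcomp:
  assumes "f \<in> hom C X Y" "g \<in> hom C Y Z" "\<mu> \<in> cells C f f'" "\<nu> \<in> cells C f' f''"
  shows "Id2 C g \<ast> (\<nu> \<bullet> \<mu>) = (Id2 C g \<ast> \<nu>) \<bullet> (Id2 C g \<ast> \<mu>)"
proof -
  note i = Id2_cells[OF hom_Arr[OF assms(2)]]
  show ?thesis using interchange[OF assms i i] Vcomp_Id2(1)[OF i] by simp
qed

lemma whisker_r_Vcomp:
  assumes "f \<in> hom C X Y" "g \<in> hom C Y Z" "\<mu> \<in> cells C g g'" "\<nu> \<in> cells C g' g''"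
  shows "(\<nu> \<bullet> \<mu>) \<ast> Id2 C f = (\<nu> \<ast> Id2 C f) \<bullet> (\<mu> \<ast> Id2 C f)"
proof -
  note i = Id2_cells[OF hom_Arr[OF assms(1)]]
  show ?thesis using interchange[OF assms(1,2) i i assms(3,4)] Vcomp_Id2(1)[OF i] by simp
qed

text \<open>By interchange both composites equal the horizontal composite of \<nu> and
  \<mu>.\<close>

lemma whisker_exchange:
  assumes "f \<in> hom C X Y" "g \<in> hom C Y Z" "\<mu> \<in> cells C f f'" "\<nu> \<in> cells C g g'"
  shows "(\<nu> \<ast> Id2 C f') \<bullet> (Id2 C g \<ast> \<mu>) = (Id2 C g' \<ast> \<mu>) \<bullet> (\<nu> \<ast> Id2 C f)"
proof -
  note i = Id2_cells[OF hom_Arr]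
  show ?thesis
    using interchange[OF assms(1,2,3) i[OF cells_hom[OF assms(3,1)]] i[OF assms(2)] assms(4)]
      interchange[OF assms(1,2) i[OF assms(1)] assms(3,4) i[OF cells_hom[OF assms(4,2)]]]
      Vcomp_Id2[OF assms(3)] Vcomp_Id2[OF assms(4)] by simp
qed

lemma whisker_l_inv:
  assumes f: "f \<in> hom C X Y" and g: "g \<in> hom C Y Z" and m: "\<mu> \<in> inv_cells C f f'"
  shows "Id2 C g \<ast> \<mu> \<in> inv_cells C (g \<odot> f) (g \<odot> f')"
proof (rule inv_cellsI(1))
  note c = inv_cells_cells[OF m] inv_cell_cells[OF m]
  note f' = cells_hom[OF c(1) f]
  show "Id2 C g \<ast> \<mu> \<in> cells C (g \<odot> f) (g \<odot> f')"
    "Id2 C g \<ast> inv_cell C \<mu> \<in> cells C (g \<odot> f') (g \<odot> f)"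
    using whisker_l g f f' c by blast+
  show "(Id2 C g \<ast> inv_cell C \<mu>) \<bullet> (Id2 C g \<ast> \<mu>) = Id2 C (g \<odot> f)"
    "(Id2 C g \<ast> \<mu>) \<bullet> (Id2 C g \<ast> inv_cell C \<mu>) = Id2 C (g \<odot> f')"
    using whisker_l_Vcomp[OF f g c] whisker_l_Vcomp[OF f' g c(2,1)] inv_cell_left[OF m]
      inv_cell_right[OF m] Hcomp_Id2[OF f g] Hcomp_Id2[OF f' g] by simp_all
qed

lemma whisker_r_inv:
  assumes f: "f \<in> hom C X Y" and g: "g \<in> hom C Y Z" and m: "\<mu> \<in> inv_cells C g g'"
  shows "\<mu> \<ast> Id2 C f \<in> inv_cells C (g \<odot> f) (g' \<odot> f)"
proof (rule inv_cellsI(1))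
  note c = inv_cells_cells[OF m] inv_cell_cells[OF m]
  note g' = cells_hom[OF c(1) g]
  show "\<mu> \<ast> Id2 C f \<in> cells C (g \<odot> f) (g' \<odot> f)"
    "inv_cell C \<mu> \<ast> Id2 C f \<in> cells C (g' \<odot> f) (g \<odot> f)"
    using whisker_r g f g' c by blast+
  show "(inv_cell C \<mu> \<ast> Id2 C f) \<bullet> (\<mu> \<ast> Id2 C f) = Id2 C (g \<odot> f)"
    "(\<mu> \<ast> Id2 C f) \<bullet> (inv_cell C \<mu> \<ast> Id2 C f) = Id2 C (g' \<odot> f)"
    using whisker_r_Vcomp[OF f g c] whisker_r_Vcomp[OF f g' c(2,1)] inv_cell_left[OF m]
      inv_cell_right[OF m] Hcomp_Id2[OF f g] Hcomp_Id2[OF f g'] by simp_all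
qed

section \<open>Naturality of the associator in each variable, and restriction of a lift\<close>

lemma Asc_nat_l:
  assumes "f \<in> hom C X Y" "g \<in> hom C Y Z" "h \<in> hom C Z V" "\<mu> \<in> cells C f f'"
  shows "Asc C h g f' \<bullet> (Id2 C (h \<odot> g) \<ast> \<mu>) = (Id2 C h \<ast> (Id2 C g \<ast> \<mu>)) \<bullet> Asc C h g f"
  using Asc_nat[OF assms(1-4) Id2_cells[OF hom_Arr[OF assms(2)]] Id2_cells[OF hom_Arr[OF assms(3)]]]
    Hcomp_Id2[OF assms(2,3)] by simp

lemma Asc_nat_m:
  assumes "f \<in> hom C X Y" "g \<in> hom C Y Z" "h \<in> hom C Z V" "\<mu> \<in> cells C g g'"
  shows "Asc C h g' f \<bullet> ((Id2 C h \<ast> \<mu>) \<ast> Id2 C f) = (Id2 C h \<ast> (\<mu> \<ast> Id2 C f)) \<bullet> Asc C h g f"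
  using Asc_nat[OF assms(1-3) Id2_cells[OF hom_Arr[OF assms(1)]] assms(4) Id2_cells[OF hom_Arr[OF assms(3)]]]
  by simp

lemma Asc_nat_r:
  assumes "f \<in> hom C X Y" "g \<in> hom C Y Z" "h \<in> hom C Z V" "\<mu> \<in> cells C h h'"
  shows "Asc C h' g f \<bullet> ((\<mu> \<ast> Id2 C g) \<ast> Id2 C f) = (\<mu> \<ast> Id2 C (g \<odot> f)) \<bullet> Asc C h g f"
  using Asc_nat[OF assms(1-3) Id2_cells[OF hom_Arr[OF assms(1)]] Id2_cells[OF hom_Arr[OF assms(2)]] assms(4)]
    Hcomp_Id2[OF assms(1,2)] by simp

lemma Asc_inv:
  "f \<in> hom C X Y \<Longrightarrow> g \<in> hom C Y Z \<Longrightarrow> h \<in> hom C Z V \<Longrightarrow>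
    inv_cell C (Asc C h g f) \<in> inv_cells C (h \<odot> (g \<odot> f)) ((h \<odot> g) \<odot> f)"
  by (rule inv_cell_inv_cells[OF Asc_cells])

lemma Vcomp_inv_cancel:
  assumes "a \<in> inv_cells C u v" "\<mu> \<in> cells C u w"
  shows "(\<mu> \<bullet> inv_cell C a) \<bullet> a = \<mu>"
  using Vcomp_assoc[OF inv_cells_cells inv_cell_cells, OF assms(1,1,2)] Vcomp_Id2(1)[OF assms(2)]
    inv_cell_left[OF assms(1)] by simp

text \<open>A filler \<open>k\<close> of a lifting square is known only relative to
  \<open>i\<close>. If the square's cell \<gamma>, restricted along \<open>u\<close>, is prescribed
  by \<rho>, \<tau> and \<open>M\<close>, then the restriction of \<open>k\<close> along
  \<open>i \<odot> u\<close> is compatible with \<rho>, \<open>M\<close> and \<psi>. Applied to both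
  inclusions of \<open>X\<close> into \<open>X + X\<close>, it yields the two end conditions of a
  morphism of cylinders.\<close>

lemma lift_restrict:
  assumes u: "u \<in> hom C X S" and i: "i \<in> hom C S P" and q: "q \<in> hom C W Z" and b: "b \<in> hom C P Z"
    and k: "k \<in> hom C P W" and a: "a \<in> hom C S W"
    and \<tau>: "\<tau> \<in> cells C (a \<odot> u) e" and \<phi>: "\<phi> \<in> cells C (k \<odot> i) a"
    and \<psi>: "\<psi> \<in> cells C (q \<odot> k) b" and \<rho>: "\<rho> \<in> cells C (q \<odot> e) x"
    and \<gamma>: "\<gamma> \<in> cells C (q \<odot> a) (b \<odot> i)" and M: "M \<in> cells C (b \<odot> (i \<odot> u)) x"
    and sq: "(\<psi> \<ast> Id2 C i) \<bullet> inv_cell C (Asc C q k i) = \<gamma> \<bullet> (Id2 C q \<ast> \<phi>)"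
    and \<gamma>_u: "(M \<bullet> Asc C b i u) \<bullet> (\<gamma> \<ast> Id2 C u) = \<rho> \<bullet> (Id2 C q \<ast> \<tau>) \<bullet> Asc C q a u"
  shows "\<rho> \<bullet> (Id2 C q \<ast> (\<tau> \<bullet> (\<phi> \<ast> Id2 C u) \<bullet> inv_cell C (Asc C k i u))) =
    M \<bullet> (\<psi> \<ast> Id2 C (i \<odot> u)) \<bullet> inv_cell C (Asc C q k (i \<odot> u))"
proof -
  note H = u i q b k a Comp1_hom[OF u i] Comp1_hom[OF i k] Comp1_hom[OF u a] Comp1_hom[OF a q]
    Comp1_hom[OF k q] Comp1_hom[OF i b]
  have e: "e \<in> hom C X W" using cells_hom[OF \<tau>] H by blast
  let ?\<phi>' = "\<tau> \<bullet> (\<phi> \<ast> Id2 C u) \<bullet> inv_cell C (Asc C k i u)"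
  let ?A = "Asc C q k (i \<odot> u)" and ?B = "Asc C (q \<odot> k) i u"
  note As = Asc_cells[THEN inv_cells_cells]
  note A = Asc_cells[OF \<open>i \<odot> u \<in> _\<close> k q] note B = Asc_cells[OF u i \<open>q \<odot> k \<in> _\<close>]
  note A' = inv_cells_cells[OF A] note B' = inv_cells_cells[OF B]
  note \<phi>u = whisker_r[OF u \<open>k \<odot> i \<in> _\<close> \<phi>]
  note \<phi>u\<tau> = Vcomp_cells[OF \<phi>u \<tau>]
  note ki = Asc_cells[OF u i k] note ki' = inv_cells_cells[OF ki] inv_cell_cells[OF ki]
  have \<phi>': "?\<phi>' \<in> cells C (k \<odot> (i \<odot> u)) e"
    by (rule Vcomp_cells[OF Vcomp_cells[OF ki'(2) \<phi>u] \<tau>])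
  have kiu: "k \<odot> (i \<odot> u) \<in> hom C X W" and ki_u: "(k \<odot> i) \<odot> u \<in> hom C X W"
    using Comp1_hom[OF Comp1_hom[OF u i] k] Comp1_hom[OF u Comp1_hom[OF i k]] by auto
  note q\<phi>' = whisker_l[OF kiu q \<phi>']
  note Lc = Vcomp_cells[OF q\<phi>' \<rho>]
  note \<psi>iu = whisker_r[OF \<open>i \<odot> u \<in> _\<close> \<open>q \<odot> k \<in> _\<close> \<psi>]
  note Rc = Vcomp_cells[OF \<psi>iu M]
  note R1 = Vcomp_cells[OF inv_cell_cells[OF A] \<psi>iu]
  note R2 = Vcomp_cells[OF R1 M]
  note qki = Asc_cells[OF i k q]
  note qki' = inv_cells_cells[OF qki]
  note qki_u = whisker_r[OF u Comp1_hom[OF i \<open>q \<odot> k \<in> _\<close>] qki']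
  note q_ki_u = As[OF u \<open>k \<odot> i \<in> _\<close> q]
  note q\<phi> = whisker_l[OF \<open>k \<odot> i \<in> _\<close> q \<phi>]
  note \<psi>i = whisker_r[OF i \<open>q \<odot> k \<in> _\<close> \<psi>]
  have qkiH: "q \<odot> (k \<odot> i) \<in> hom C S Z" "(q \<odot> k) \<odot> i \<in> hom C S Z"
    using Comp1_hom[OF Comp1_hom[OF i k] q] Comp1_hom[OF i Comp1_hom[OF k q]] by auto
  let ?s = "Asc C q k i \<ast> Id2 C u"
  let ?G = "(\<gamma> \<ast> Id2 C u) \<bullet> (((Id2 C q \<ast> \<phi>) \<ast> Id2 C u) \<bullet> ?s)"
  note \<gamma>u = whisker_r[OF u \<open>q \<odot> a \<in> _\<close> \<gamma>]
  note q\<phi>_u = whisker_r[OF u qkiH(1) q\<phi>]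
  \<comment> \<open>Solving \<open>sq\<close> for the whiskering of \<psi> removes the inverse
    associator before whiskering once more with \<open>u\<close>.\<close>
  have "\<psi> \<ast> Id2 C i = \<gamma> \<bullet> (Id2 C q \<ast> \<phi>) \<bullet> Asc C q k i"
    using Vcomp_inv_cancel[OF qki \<psi>i] Vcomp_assoc[OF qki' q\<phi> \<gamma>] unfolding sq by simp
  then have G: "(\<psi> \<ast> Id2 C i) \<ast> Id2 C u = ?G"
    using whisker_r_Vcomp[OF u qkiH(2) Vcomp_cells[OF qki' q\<phi>] \<gamma>]
      whisker_r_Vcomp[OF u qkiH(2) qki' q\<phi>] by simp
  note Mb = Vcomp_cells[OF As[OF u i b] M]
  note q\<tau> = whisker_l[OF \<open>a \<odot> u \<in> _\<close> q \<tau>]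
  note q\<phi>us = Vcomp_cells[OF qki_u q\<phi>_u]
  note qau = As[OF u a q]
  note q_\<phi>u = whisker_l[OF ki_u q \<phi>u]
  \<comment> \<open>Right-hand side with the associators \<open>?A\<close> and \<open>?B\<close>
    composed on: naturality of the associator in \<psi>, then the square, then
    \<open>\<gamma>_u\<close>, then naturality in \<phi>.\<close>
  have "((M \<bullet> (\<psi> \<ast> Id2 C (i \<odot> u)) \<bullet> inv_cell C ?A) \<bullet> ?A) \<bullet> ?B = (M \<bullet> (\<psi> \<ast> Id2 C (i \<odot> u))) \<bullet> ?B"
    using Vcomp_inv_cancel[OF A Rc] Vcomp_assoc[OF inv_cell_cells[OF A] \<psi>iu M] by simp
  also have "\<dots> = M \<bullet> (Asc C b i u \<bullet> ((\<psi> \<ast> Id2 C i) \<ast> Id2 C u))"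
    using Vcomp_assoc[OF B' \<psi>iu M] Asc_nat_r[OF u i \<open>q \<odot> k \<in> _\<close> \<psi>] by simp
  also have "\<dots> = (M \<bullet> Asc C b i u) \<bullet> ?G"
    using Vcomp_assoc[OF whisker_r[OF u qkiH(2) \<psi>i] As[OF u i b] M] G by simp
  also have "\<dots> = (\<rho> \<bullet> (Id2 C q \<ast> \<tau>) \<bullet> Asc C q a u) \<bullet> (((Id2 C q \<ast> \<phi>) \<ast> Id2 C u) \<bullet> ?s)"
    using Vcomp_assoc[OF q\<phi>us \<gamma>u Mb] \<gamma>_u by simp
  also have "\<dots> = \<rho> \<bullet> (Id2 C q \<ast> \<tau>) \<bullet> (Asc C q a u \<bullet> ((Id2 C q \<ast> \<phi>) \<ast> Id2 C u)) \<bullet> ?s"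
    using Vcomp_assoc[OF q\<phi>us Vcomp_cells[OF qau q\<tau>] \<rho>] Vcomp_assoc[OF q\<phi>us qau q\<tau>]
      Vcomp_assoc[OF qki_u q\<phi>_u qau] by simp
  also have "Asc C q a u \<bullet> ((Id2 C q \<ast> \<phi>) \<ast> Id2 C u) = (Id2 C q \<ast> (\<phi> \<ast> Id2 C u)) \<bullet> Asc C q (k \<odot> i) u"
    using Asc_nat_m[OF u \<open>k \<odot> i \<in> _\<close> q \<phi>] .
  also have "\<rho> \<bullet> (Id2 C q \<ast> \<tau>) \<bullet> ((Id2 C q \<ast> (\<phi> \<ast> Id2 C u)) \<bullet> Asc C q (k \<odot> i) u) \<bullet> ?s =
      \<rho> \<bullet> (Id2 C q \<ast> (\<tau> \<bullet> (\<phi> \<ast> Id2 C u))) \<bullet> (Asc C q (k \<odot> i) u \<bullet> ?s)"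
    using Vcomp_assoc[OF qki_u q_ki_u q_\<phi>u] Vcomp_assoc[OF Vcomp_cells[OF qki_u q_ki_u] q_\<phi>u q\<tau>]
      whisker_l_Vcomp[OF ki_u q \<phi>u \<tau>] by simp
  finally have R: "((M \<bullet> (\<psi> \<ast> Id2 C (i \<odot> u)) \<bullet> inv_cell C ?A) \<bullet> ?A) \<bullet> ?B =
    \<rho> \<bullet> (Id2 C q \<ast> (\<tau> \<bullet> (\<phi> \<ast> Id2 C u))) \<bullet> (Asc C q (k \<odot> i) u \<bullet> ?s)" .
  note q_kiu = whisker_l[OF ki_u q ki'(1)]
  note t = Vcomp_cells[OF qki_u q_ki_u]
  \<comment> \<open>Left-hand side with the same associators composed on: the pentagon for
    \<open>u\<close>, \<open>i\<close>, \<open>k\<close>, \<open>q\<close> produces the associator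
    that cancels the inverse one inside \<open>?\<phi>'\<close>.\<close>
  have "((\<rho> \<bullet> (Id2 C q \<ast> ?\<phi>')) \<bullet> ?A) \<bullet> ?B = \<rho> \<bullet> (Id2 C q \<ast> ?\<phi>') \<bullet> (?A \<bullet> ?B)"
    using Vcomp_assoc[OF B' A' Lc] Vcomp_assoc[OF Vcomp_cells[OF B' A'] q\<phi>' \<rho>] by simp
  also have "?A \<bullet> ?B = (Id2 C q \<ast> Asc C k i u) \<bullet> (Asc C q (k \<odot> i) u \<bullet> ?s)"
    by (rule pentagon[OF u i k q])
  also have "(Id2 C q \<ast> ?\<phi>') \<bullet> \<dots> = (Id2 C q \<ast> (?\<phi>' \<bullet> Asc C k i u)) \<bullet> (Asc C q (k \<odot> i) u \<bullet> ?s)"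
    using Vcomp_assoc[OF t q_kiu q\<phi>'] whisker_l_Vcomp[OF ki_u q ki'(1) \<phi>'] by simp
  also have "?\<phi>' \<bullet> Asc C k i u = \<tau> \<bullet> (\<phi> \<ast> Id2 C u)"
    using Vcomp_inv_cancel[OF ki \<phi>u\<tau>] Vcomp_assoc[OF ki'(2) \<phi>u \<tau>] by simp
  finally have L: "((\<rho> \<bullet> (Id2 C q \<ast> ?\<phi>')) \<bullet> ?A) \<bullet> ?B =
     ((M \<bullet> (\<psi> \<ast> Id2 C (i \<odot> u)) \<bullet> inv_cell C ?A) \<bullet> ?A) \<bullet> ?B" unfolding R .
  show ?thesis
    by (rule Vcomp_epi[OF A Lc R2 Vcomp_epi[OF B Vcomp_cells[OF A' Lc] Vcomp_cells[OF A' R2] L]])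
qed

end

section \<open>Naturality squares in a localization\<close>

context localization
begin

text \<open>A commutative square in \<open>D\<close> with two opposite sides \<mu> and \<mu>' that
  need not come from \<open>C\<close>, joined by images of cells of \<open>C\<close>. It expresses
  that 2-cells existing only in the localization, such as those of cylinders, are compatible with
  comparison cells of \<open>C\<close>.\<close>

definition Fsq :: "'a \<Rightarrow> 'a \<Rightarrow> 'd \<Rightarrow> 'a \<Rightarrow> 'a \<Rightarrow> 'd \<Rightarrow> 'c \<Rightarrow> 'c \<Rightarrow> bool" where
  "Fsq u v \<mu> u' v' \<mu>' a b \<longleftrightarrow> \<mu> \<in> cells D (F1 u) (F1 v) \<and> \<mu>' \<in> cells D (F1 u') (F1 v') \<and>
     a \<in> cells C u u' \<and> b \<in> cells C v v' \<and> F2 b \<bullet>\<^bsub>D\<^esub> \<mu> = \<mu>' \<bullet>\<^bsub>D\<^esub> F2 a"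

lemma Fsq_trans:
  assumes "Fsq u v \<mu> u' v' \<mu>' a b" "Fsq u' v' \<mu>' u'' v'' \<mu>'' a' b'"
  shows "Fsq u v \<mu> u'' v'' \<mu>'' (a' \<bullet>\<^bsub>C\<^esub> a) (b' \<bullet>\<^bsub>C\<^esub> b)"
proof -
  from assms have m: "\<mu> \<in> cells D (F1 u) (F1 v)" "\<mu>' \<in> cells D (F1 u') (F1 v')" "\<mu>'' \<in> cells D (F1 u'') (F1 v'')"
    and a: "a \<in> cells C u u'" "a' \<in> cells C u' u''" and b: "b \<in> cells C v v'" "b' \<in> cells C v' v''"
    and e: "F2 b \<bullet>\<^bsub>D\<^esub> \<mu> = \<mu>' \<bullet>\<^bsub>D\<^esub> F2 a" "F2 b' \<bullet>\<^bsub>D\<^esub> \<mu>' = \<mu>'' \<bullet>\<^bsub>D\<^esub> F2 a'"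
    by (auto simp: Fsq_def)
  note Fa = a[THEN F_cells] and Fb = b[THEN F_cells]
  have "F2 (b' \<bullet>\<^bsub>C\<^esub> b) \<bullet>\<^bsub>D\<^esub> \<mu> = F2 b' \<bullet>\<^bsub>D\<^esub> \<mu>' \<bullet>\<^bsub>D\<^esub> F2 a"
    using D.Vcomp_assoc[OF m(1) Fb] e(1) F_Vcomp[OF b] by simp
  also have "\<dots> = (\<mu>'' \<bullet>\<^bsub>D\<^esub> F2 a') \<bullet>\<^bsub>D\<^esub> F2 a"
    using D.Vcomp_assoc[OF Fa(1) m(2) Fb(2)] e(2) by simp
  also have "\<dots> = \<mu>'' \<bullet>\<^bsub>D\<^esub> F2 (a' \<bullet>\<^bsub>C\<^esub> a)"
    using D.Vcomp_assoc[OF Fa m(3)] F_Vcomp[OF a] by simp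
  finally show ?thesis
    using m C.Vcomp_cells[OF a] C.Vcomp_cells[OF b] by (simp add: Fsq_def)
qed

lemma F_inv:
  assumes "a \<in> inv_cells C u v"
  shows "F2 (inv_cell C a) \<bullet>\<^bsub>D\<^esub> F2 a = Id2 D (F1 u)" "F2 a \<bullet>\<^bsub>D\<^esub> F2 (inv_cell C a) = Id2 D (F1 v)"
proof -
  note c = C.inv_cells_cells[OF assms] C.inv_cell_cells[OF assms]
  show "F2 (inv_cell C a) \<bullet>\<^bsub>D\<^esub> F2 a = Id2 D (F1 u)" "F2 a \<bullet>\<^bsub>D\<^esub> F2 (inv_cell C a) = Id2 D (F1 v)"
    using F_Vcomp[OF c] F_Vcomp[OF c(2,1)] C.inv_cell_left[OF assms] C.inv_cell_right[OF assms]
      F_unary(1) C.cells_homD(2,3)[OF c(1)] by simp_all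
qed

lemma Fsq_inv:
  assumes "Fsq u v \<mu> u' v' \<mu>' a b" and a: "a \<in> inv_cells C u u'" and b: "b \<in> inv_cells C v v'"
  shows "Fsq u' v' \<mu>' u v \<mu> (inv_cell C a) (inv_cell C b)"
proof -
  from assms(1) have m: "\<mu> \<in> cells D (F1 u) (F1 v)" "\<mu>' \<in> cells D (F1 u') (F1 v')"
    and e: "F2 b \<bullet>\<^bsub>D\<^esub> \<mu> = \<mu>' \<bullet>\<^bsub>D\<^esub> F2 a" by (auto simp: Fsq_def)
  note ca = C.inv_cells_cells[OF a] C.inv_cell_cells[OF a]
  note cb = C.inv_cells_cells[OF b] C.inv_cell_cells[OF b]
  note Fa = ca[THEN F_cells] and Fb = cb[THEN F_cells]
  have "F2 (inv_cell C b) \<bullet>\<^bsub>D\<^esub> \<mu>' = F2 (inv_cell C b) \<bullet>\<^bsub>D\<^esub> \<mu>' \<bullet>\<^bsub>D\<^esub> F2 a \<bullet>\<^bsub>D\<^esub> F2 (inv_cell C a)"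
    using F_inv[OF a] D.Vcomp_Id2(1)[OF m(2)] by simp
  also have "\<dots> = F2 (inv_cell C b) \<bullet>\<^bsub>D\<^esub> (F2 b \<bullet>\<^bsub>D\<^esub> \<mu>) \<bullet>\<^bsub>D\<^esub> F2 (inv_cell C a)"
    using D.Vcomp_assoc[OF Fa(2,1) m(2)] e by simp
  also have "\<dots> = (F2 (inv_cell C b) \<bullet>\<^bsub>D\<^esub> F2 b \<bullet>\<^bsub>D\<^esub> \<mu>) \<bullet>\<^bsub>D\<^esub> F2 (inv_cell C a)"
    using D.Vcomp_assoc[OF Fa(2) D.Vcomp_cells[OF m(1) Fb(1)] Fb(2)] by simp
  also have "F2 (inv_cell C b) \<bullet>\<^bsub>D\<^esub> F2 b \<bullet>\<^bsub>D\<^esub> \<mu> = \<mu>"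
    using D.Vcomp_cancel_right[OF m(1) Fb] F_inv[OF b] by simp
  finally show ?thesis using m ca cb by (simp add: Fsq_def)
qed

text \<open>From a pasted square and its second half the first half is recovered, because the
  connecting cells of the second half are invertible and that half can be reversed.\<close>

lemma Fsq_cancel:
  assumes 1: "Fsq u v \<mu> w z \<xi> (c \<bullet>\<^bsub>C\<^esub> a) (d \<bullet>\<^bsub>C\<^esub> b)" and 2: "Fsq u' v' \<mu>' w z \<xi> c d"
    and a: "a \<in> cells C u u'" and b: "b \<in> cells C v v'"
    and c: "c \<in> inv_cells C u' w" and d: "d \<in> inv_cells C v' z"
  shows "Fsq u v \<mu> u' v' \<mu>' a b"
  using Fsq_trans[OF 1 Fsq_inv[OF 2 c d]]
    C.Vcomp_cancel_right[OF a C.inv_cells_cells[OF c] C.inv_cell_cells[OF c] C.inv_cell_left[OF c]]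
    C.Vcomp_cancel_right[OF b C.inv_cells_cells[OF d] C.inv_cell_cells[OF d] C.inv_cell_left[OF d]]
  by simp

lemma Fsq_whisker:
  assumes u: "u \<in> hom C X Y" and v: "v \<in> hom C X Y" and g: "g \<in> hom C Y Z"
    and s: "Fsq u v \<mu> u' v' \<mu>' a b"
  shows "Fsq (g \<odot>\<^bsub>C\<^esub> u) (g \<odot>\<^bsub>C\<^esub> v) (Id2 D (F1 g) \<ast>\<^bsub>D\<^esub> \<mu>) (g \<odot>\<^bsub>C\<^esub> u') (g \<odot>\<^bsub>C\<^esub> v') (Id2 D (F1 g) \<ast>\<^bsub>D\<^esub> \<mu>')
    (Id2 C g \<ast>\<^bsub>C\<^esub> a) (Id2 C g \<ast>\<^bsub>C\<^esub> b)"
proof -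
  from s have m: "\<mu> \<in> cells D (F1 u) (F1 v)" "\<mu>' \<in> cells D (F1 u') (F1 v')"
    and a: "a \<in> cells C u u'" and b: "b \<in> cells C v v'"
    and e: "F2 b \<bullet>\<^bsub>D\<^esub> \<mu> = \<mu>' \<bullet>\<^bsub>D\<^esub> F2 a" by (auto simp: Fsq_def)
  note u' = C.cells_hom[OF a u] and v' = C.cells_hom[OF b v]
  note gI = C.Id2_cells[OF C.hom_Arr[OF g]]
  have Fw: "F2 (Id2 C g \<ast>\<^bsub>C\<^esub> c) = Id2 D (F1 g) \<ast>\<^bsub>D\<^esub> F2 c" if "c \<in> cells C w w'" "w \<in> hom C X Y" for c w w'
    using F_Hcomp[OF that(1) gI that(2) g] F_unary(1)[OF C.hom_Arr[OF g]] by simp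
  show ?thesis unfolding Fsq_def Fw[OF a u] Fw[OF b v]
    using D.whisker_l_Vcomp[OF F_Arr[OF u] F_Arr[OF g] m(1) F_cells[OF b]]
      D.whisker_l_Vcomp[OF F_Arr[OF u] F_Arr[OF g] F_cells[OF a] m(2)]
      D.whisker_l[OF F_Arr[OF u] F_Arr[OF g] m(1)] D.whisker_l[OF F_Arr[OF u'] F_Arr[OF g] m(2)]
      C.whisker_l[OF u g a] C.whisker_l[OF v g b] F_comp[OF u g] F_comp[OF v g] F_comp[OF u' g] F_comp[OF v' g] e
    by simp
qed

lemma Fsq_Asc:
  assumes u: "u \<in> hom C X Y" and v: "v \<in> hom C X Y" and g: "g \<in> hom C Y Z" and h: "h \<in> hom C Z V"
    and m: "\<mu> \<in> cells D (F1 u) (F1 v)"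
  shows "Fsq ((h \<odot>\<^bsub>C\<^esub> g) \<odot>\<^bsub>C\<^esub> u) ((h \<odot>\<^bsub>C\<^esub> g) \<odot>\<^bsub>C\<^esub> v) (Id2 D (F1 (h \<odot>\<^bsub>C\<^esub> g)) \<ast>\<^bsub>D\<^esub> \<mu>)
    (h \<odot>\<^bsub>C\<^esub> (g \<odot>\<^bsub>C\<^esub> u)) (h \<odot>\<^bsub>C\<^esub> (g \<odot>\<^bsub>C\<^esub> v)) (Id2 D (F1 h) \<ast>\<^bsub>D\<^esub> (Id2 D (F1 g) \<ast>\<^bsub>D\<^esub> \<mu>))
    (Asc C h g u) (Asc C h g v)"
proof -
  note Fu = F_Arr[OF u] and Fv = F_Arr[OF v] and Fg = F_Arr[OF g] and Fh = F_Arr[OF h]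
  show ?thesis unfolding Fsq_def F_Asc[OF u g h] F_Asc[OF v g h]
    using D.Asc_nat_l[OF Fu Fg Fh m] D.whisker_l[OF Fu Fg m]
      D.whisker_l[OF D.Comp1_hom[OF Fu Fg] Fh D.whisker_l[OF Fu Fg m]]
      D.whisker_l[OF Fu D.Comp1_hom[OF Fg Fh] m]
      C.Asc_cells[OF u g h, THEN C.inv_cells_cells] C.Asc_cells[OF v g h, THEN C.inv_cells_cells]
      F_comp[OF g h] F_comp[OF u g] F_comp[OF v g]
      F_comp[OF u C.Comp1_hom[OF g h]] F_comp[OF v C.Comp1_hom[OF g h]]
      F_comp[OF C.Comp1_hom[OF u g] h] F_comp[OF C.Comp1_hom[OF v g] h] by simp
qed

lemma Fsq_Asc_inv:
  assumes "u \<in> hom C X Y" "v \<in> hom C X Y" "g \<in> hom C Y Z" "h \<in> hom C Z V" "\<mu> \<in> cells D (F1 u) (F1 v)"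
  shows "Fsq (h \<odot>\<^bsub>C\<^esub> (g \<odot>\<^bsub>C\<^esub> u)) (h \<odot>\<^bsub>C\<^esub> (g \<odot>\<^bsub>C\<^esub> v)) (Id2 D (F1 h) \<ast>\<^bsub>D\<^esub> (Id2 D (F1 g) \<ast>\<^bsub>D\<^esub> \<mu>))
    ((h \<odot>\<^bsub>C\<^esub> g) \<odot>\<^bsub>C\<^esub> u) ((h \<odot>\<^bsub>C\<^esub> g) \<odot>\<^bsub>C\<^esub> v) (Id2 D (F1 (h \<odot>\<^bsub>C\<^esub> g)) \<ast>\<^bsub>D\<^esub> \<mu>)
    (inv_cell C (Asc C h g u)) (inv_cell C (Asc C h g v))"
  by (rule Fsq_inv[OF Fsq_Asc[OF assms] C.Asc_cells[OF assms(1,3,4)] C.Asc_cells[OF assms(2,3,4)]])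

lemma Fsq_exchange:
  assumes u: "u \<in> hom C X Y" and v: "v \<in> hom C X Y" and g: "g \<in> hom C Y Z" and n: "\<nu> \<in> cells C g g'"
    and m: "\<mu> \<in> cells D (F1 u) (F1 v)"
  shows "Fsq (g \<odot>\<^bsub>C\<^esub> u) (g \<odot>\<^bsub>C\<^esub> v) (Id2 D (F1 g) \<ast>\<^bsub>D\<^esub> \<mu>) (g' \<odot>\<^bsub>C\<^esub> u) (g' \<odot>\<^bsub>C\<^esub> v) (Id2 D (F1 g') \<ast>\<^bsub>D\<^esub> \<mu>)
    (\<nu> \<ast>\<^bsub>C\<^esub> Id2 C u) (\<nu> \<ast>\<^bsub>C\<^esub> Id2 C v)"
proof -
  note g' = C.cells_hom[OF n g]
  note Fu = F_Arr[OF u] and Fv = F_Arr[OF v] and Fg = F_Arr[OF g] and Fg' = F_Arr[OF g']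
  have Fw: "F2 (\<nu> \<ast>\<^bsub>C\<^esub> Id2 C w) = F2 \<nu> \<ast>\<^bsub>D\<^esub> Id2 D (F1 w)" if "w \<in> hom C X Y" for w
    using F_Hcomp[OF C.Id2_cells n that g] F_unary(1)[of w] C.hom_Arr[OF that] by simp
  show ?thesis unfolding Fsq_def Fw[OF u] Fw[OF v]
    using D.whisker_exchange[OF Fu Fg m F_cells[OF n]] D.whisker_l[OF Fu Fg m] D.whisker_l[OF Fu Fg' m]
      C.whisker_r[OF u g n] C.whisker_r[OF v g n] F_comp[OF u g] F_comp[OF v g] F_comp[OF u g'] F_comp[OF v g']
    by simp
qed

text \<open>As \<open>F1 q\<close> is a quasiequivalence, whiskering with it is injective on
  2-cells; so a square may be tested after whiskering with \<open>q\<close>.\<close>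

lemma Fsq_faithful:
  assumes q: "q \<in> Weq" "q \<in> hom C Y Z" and u: "u \<in> hom C X Y" and v: "v \<in> hom C X Y"
    and m: "\<mu> \<in> cells D (F1 u) (F1 v)" "\<mu>' \<in> cells D (F1 u') (F1 v')"
    and a: "a \<in> cells C u u'" and b: "b \<in> cells C v v'"
    and s: "Fsq (q \<odot>\<^bsub>C\<^esub> u) (q \<odot>\<^bsub>C\<^esub> v) (Id2 D (F1 q) \<ast>\<^bsub>D\<^esub> \<mu>) (q \<odot>\<^bsub>C\<^esub> u') (q \<odot>\<^bsub>C\<^esub> v') (Id2 D (F1 q) \<ast>\<^bsub>D\<^esub> \<mu>')
      (Id2 C q \<ast>\<^bsub>C\<^esub> a) (Id2 C q \<ast>\<^bsub>C\<^esub> b)"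
  shows "Fsq u v \<mu> u' v' \<mu>' a b"
proof -
  note v' = C.cells_hom[OF b v] and gI = C.Id2_cells[OF C.hom_Arr[OF q(2)]]
  note Fq = F_Arr[OF q(2)] and Fu = F_Arr[OF u]
  have Fw: "F2 (Id2 C q \<ast>\<^bsub>C\<^esub> c) = Id2 D (F1 q) \<ast>\<^bsub>D\<^esub> F2 c" if "c \<in> cells C w w'" "w \<in> hom C X Y" for c w w'
    using F_Hcomp[OF that(1) gI that(2) q(2)] F_unary(1)[OF C.hom_Arr[OF q(2)]] by simp
  have X: "F0 X \<in> Obj D" using F_Obj C.hom_Obj[OF u] by blast
  have Y: "Dom C q = Y" using q(2) by (simp add: hom_def)
  have inj: "inj_on (\<lambda>\<mu>. Id2 D (F1 q) \<ast>\<^bsub>D\<^esub> \<mu>) (cells D (F1 u) (F1 v'))"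
    using FW(1)[OF q(1) X, unfolded Y, OF Fu F_Arr[OF v']] by (simp add: bij_betw_def)
  have "F2 b \<bullet>\<^bsub>D\<^esub> \<mu> = \<mu>' \<bullet>\<^bsub>D\<^esub> F2 a"
  proof (rule inj_onD[OF inj])
    show "F2 b \<bullet>\<^bsub>D\<^esub> \<mu> \<in> cells D (F1 u) (F1 v')" "\<mu>' \<bullet>\<^bsub>D\<^esub> F2 a \<in> cells D (F1 u) (F1 v')"
      using D.Vcomp_cells m F_cells a b by blast+
    show "Id2 D (F1 q) \<ast>\<^bsub>D\<^esub> (F2 b \<bullet>\<^bsub>D\<^esub> \<mu>) = Id2 D (F1 q) \<ast>\<^bsub>D\<^esub> (\<mu>' \<bullet>\<^bsub>D\<^esub> F2 a)"
      using s D.whisker_l_Vcomp[OF Fu Fq m(1) F_cells[OF b]]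
        D.whisker_l_Vcomp[OF Fu Fq F_cells[OF a] m(2)] by (simp add: Fsq_def Fw[OF a u] Fw[OF b v])
  qed
  then show ?thesis using m a b by (simp add: Fsq_def)
qed

text \<open>Replaces the definite description by a square against the identity of the image of
  \<open>cyx K\<close>: composing the defining equation with the image of \<open>cya1 K\<close>
  cancels the inverse in it.\<close>

lemma hat_cyl_props:
  assumes K: "w_cylinder C Weq X K"
  shows "hat_cyl C D F1 F2 K \<in> cells D (F1 (cyd0 K)) (F1 (cyd1 K))"
    and "Fsq (cys K \<odot>\<^bsub>C\<^esub> cyd0 K) (cys K \<odot>\<^bsub>C\<^esub> cyd1 K) (Id2 D (F1 (cys K)) \<ast>\<^bsub>D\<^esub> hat_cyl C D F1 F2 K)
      (cyx K) (cyx K) (Id2 D (F1 (cyx K))) (cya0 K) (cya1 K)"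
proof -
  let ?a = "inv_cell C (cya1 K) \<bullet>\<^bsub>C\<^esub> cya0 K" let ?s = "cys K"
  have s: "?s \<in> Weq" "?s \<in> hom C (cyW K) (cyZ K)"
    and u: "cyd0 K \<in> hom C X (cyW K)" and v: "cyd1 K \<in> hom C X (cyW K)"
    and a0: "cya0 K \<in> cells C (?s \<odot>\<^bsub>C\<^esub> cyd0 K) (cyx K)" and a1: "cya1 K \<in> inv_cells C (?s \<odot>\<^bsub>C\<^esub> cyd1 K) (cyx K)"
    using K by (auto simp: w_cylinder_def inv_cells_def)
  have ds: "Dom C ?s = cyW K" using s(2) by (simp add: hom_def)
  note a1' = C.inv_cells_cells[OF a1] C.inv_cell_cells[OF a1]
  have a: "?a \<in> cells C (?s \<odot>\<^bsub>C\<^esub> cyd0 K) (?s \<odot>\<^bsub>C\<^esub> cyd1 K)"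
    by (rule C.Vcomp_cells[OF a0 a1'(2)])
  let ?c = "hat_cyl C D F1 F2 K"
  have c: "?c \<in> cells D (F1 (cyd0 K)) (F1 (cyd1 K)) \<and> Id2 D (F1 ?s) \<ast>\<^bsub>D\<^esub> ?c = F2 ?a"
    unfolding hat_cyl_def
    by (rule theI'[OF lift_P(1)[OF s(1), unfolded ds, OF u v gen_B[OF a]]])
  then show "?c \<in> cells D (F1 (cyd0 K)) (F1 (cyd1 K))" by blast
  have sa: "cyx K \<in> Arr C" using C.cells_homD[OF a0] by simp
  have "F2 (cya1 K) \<bullet>\<^bsub>D\<^esub> F2 ?a = F2 (cya1 K \<bullet>\<^bsub>C\<^esub> ?a)" using F_Vcomp[OF a a1'(1)] by simp
  also have "cya1 K \<bullet>\<^bsub>C\<^esub> ?a = cya0 K"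
    by (rule C.Vcomp_cancel_right[OF a0 a1'(2,1) C.inv_cell_right[OF a1]])
  also have "F2 (cya0 K) = Id2 D (F1 (cyx K)) \<bullet>\<^bsub>D\<^esub> F2 (cya0 K)"
    using D.Vcomp_Id2(2)[OF F_cells[OF a0]] by simp
  finally have e: "F2 (cya1 K) \<bullet>\<^bsub>D\<^esub> F2 ?a = \<dots>" .
  have "Id2 D (F1 (cyx K)) \<in> cells D (F1 (cyx K)) (F1 (cyx K))"
    using F_cells[OF C.Id2_cells[OF sa]] F_unary(1)[OF sa] by simp
  then show "Fsq (?s \<odot>\<^bsub>C\<^esub> cyd0 K) (?s \<odot>\<^bsub>C\<^esub> cyd1 K) (Id2 D (F1 ?s) \<ast>\<^bsub>D\<^esub> ?c)
      (cyx K) (cyx K) (Id2 D (F1 (cyx K))) (cya0 K) (cya1 K)"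
    using c e F_cells[OF a] a0 a1' by (simp add: Fsq_def)
qed

lemma Fsq_Id2:
  assumes "\<nu> \<in> cells C x y"
  shows "Fsq x x (Id2 D (F1 x)) y y (Id2 D (F1 y)) \<nu> \<nu>"
proof -
  have I: "Id2 D (F1 z) \<in> cells D (F1 z) (F1 z)" if "z \<in> Arr C" for z
    using F_cells[OF C.Id2_cells[OF that]] F_unary(1)[OF that] by simp
  show ?thesis using I C.cells_homD(2,3)[OF assms] assms D.Vcomp_Id2[OF F_cells[OF assms]]
    by (simp add: Fsq_def)
qed

text \<open>The 2-cell of a cylinder is natural for morphisms of cylinders. Here \<open>k\<close>
  maps \<open>K'\<close> to the cylinder with ends \<open>t \<odot> cyd0 K\<close>,
  \<open>t \<odot> cyd1 K\<close> and projection \<open>q\<close>, over \<open>n\<close>; the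
  equations \<open>e0\<close> and \<open>e1\<close> say that it respects the cells to the common
  target. As \<open>q\<close> is a weak equivalence, the square is checked after whiskering with
  \<open>q\<close>.\<close>

lemma hat_cyl_morphism:
  assumes K: "w_cylinder C Weq X K" and K': "w_cylinder C Weq X K'"
    and t: "t \<in> hom C (cyW K) W" and k: "k \<in> hom C (cyW K') W"
    and q: "q \<in> hom C W (cyZ K)" "q \<in> Weq" and n: "n \<in> hom C (cyZ K') (cyZ K)"
    and \<nu>: "\<nu> \<in> cells C (n \<odot>\<^bsub>C\<^esub> cyx K') (cyx K)"
    and \<sigma>: "\<sigma> \<in> inv_cells C (cys K) (q \<odot>\<^bsub>C\<^esub> t)" and \<psi>: "\<psi> \<in> cells C (q \<odot>\<^bsub>C\<^esub> k) (n \<odot>\<^bsub>C\<^esub> cys K')"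
    and \<phi>0: "\<phi>0 \<in> cells C (k \<odot>\<^bsub>C\<^esub> cyd0 K') (t \<odot>\<^bsub>C\<^esub> cyd0 K)"
    and \<phi>1: "\<phi>1 \<in> cells C (k \<odot>\<^bsub>C\<^esub> cyd1 K') (t \<odot>\<^bsub>C\<^esub> cyd1 K)"
    and e0: "(cya0 K \<bullet>\<^bsub>C\<^esub> (inv_cell C \<sigma> \<ast>\<^bsub>C\<^esub> Id2 C (cyd0 K)) \<bullet>\<^bsub>C\<^esub> inv_cell C (Asc C q t (cyd0 K)))
        \<bullet>\<^bsub>C\<^esub> (Id2 C q \<ast>\<^bsub>C\<^esub> \<phi>0) =
      (\<nu> \<bullet>\<^bsub>C\<^esub> (Id2 C n \<ast>\<^bsub>C\<^esub> cya0 K') \<bullet>\<^bsub>C\<^esub> Asc C n (cys K') (cyd0 K')) \<bullet>\<^bsub>C\<^esub>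
        (\<psi> \<ast>\<^bsub>C\<^esub> Id2 C (cyd0 K')) \<bullet>\<^bsub>C\<^esub> inv_cell C (Asc C q k (cyd0 K'))"
    and e1: "(cya1 K \<bullet>\<^bsub>C\<^esub> (inv_cell C \<sigma> \<ast>\<^bsub>C\<^esub> Id2 C (cyd1 K)) \<bullet>\<^bsub>C\<^esub> inv_cell C (Asc C q t (cyd1 K)))
        \<bullet>\<^bsub>C\<^esub> (Id2 C q \<ast>\<^bsub>C\<^esub> \<phi>1) =
      (\<nu> \<bullet>\<^bsub>C\<^esub> (Id2 C n \<ast>\<^bsub>C\<^esub> cya1 K') \<bullet>\<^bsub>C\<^esub> Asc C n (cys K') (cyd1 K')) \<bullet>\<^bsub>C\<^esub>
        (\<psi> \<ast>\<^bsub>C\<^esub> Id2 C (cyd1 K')) \<bullet>\<^bsub>C\<^esub> inv_cell C (Asc C q k (cyd1 K'))"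
  shows "Fsq (k \<odot>\<^bsub>C\<^esub> cyd0 K') (k \<odot>\<^bsub>C\<^esub> cyd1 K') (Id2 D (F1 k) \<ast>\<^bsub>D\<^esub> hat_cyl C D F1 F2 K')
    (t \<odot>\<^bsub>C\<^esub> cyd0 K) (t \<odot>\<^bsub>C\<^esub> cyd1 K) (Id2 D (F1 t) \<ast>\<^bsub>D\<^esub> hat_cyl C D F1 F2 K) \<phi>0 \<phi>1"
proof -
  let ?\<delta> = "hat_cyl C D F1 F2 K" and ?\<delta>' = "hat_cyl C D F1 F2 K'"
  have s: "cys K \<in> hom C (cyW K) (cyZ K)" and d0: "cyd0 K \<in> hom C X (cyW K)" and d1: "cyd1 K \<in> hom C X (cyW K)"
    and a: "cya0 K \<in> inv_cells C (cys K \<odot>\<^bsub>C\<^esub> cyd0 K) (cyx K)" "cya1 K \<in> inv_cells C (cys K \<odot>\<^bsub>C\<^esub> cyd1 K) (cyx K)"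
    using K by (auto simp: w_cylinder_def)
  have s': "cys K' \<in> hom C (cyW K') (cyZ K')" and d0': "cyd0 K' \<in> hom C X (cyW K')" and d1': "cyd1 K' \<in> hom C X (cyW K')"
    using K' by (auto simp: w_cylinder_def)
  note \<delta> = hat_cyl_props(1)[OF K] and \<delta>' = hat_cyl_props(1)[OF K']
  note kd0 = C.Comp1_hom[OF d0' k] and kd1 = C.Comp1_hom[OF d1' k]
  note td0 = C.Comp1_hom[OF d0 t] and td1 = C.Comp1_hom[OF d1 t]
  note \<sigma>' = C.inv_cell_inv_cells[OF \<sigma>]
  note qt = C.Comp1_hom[OF t q(1)] and qk = C.Comp1_hom[OF k q(1)]
  note L1 = Fsq_Asc_inv[OF d0' d1' k q(1) \<delta>']
  note L2 = Fsq_exchange[OF d0' d1' qk \<psi> \<delta>']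
  note L3 = Fsq_Asc[OF d0' d1' s' n \<delta>']
  note L4 = Fsq_whisker[OF C.Comp1_hom[OF d0' s'] C.Comp1_hom[OF d1' s'] n hat_cyl_props(2)[OF K']]
  have x': "cyx K' \<in> hom C X (cyZ K')" using K' by (simp add: w_cylinder_def)
  have I: "Id2 D (F1 n) \<ast>\<^bsub>D\<^esub> Id2 D (F1 (cyx K')) = Id2 D (F1 (n \<odot>\<^bsub>C\<^esub> cyx K'))"
    using D.Hcomp_Id2[OF F_Arr[OF x'] F_Arr[OF n]] F_comp[OF x' n] by simp
  \<comment> \<open>From the whiskered ends of \<open>K'\<close> to \<open>cyx K\<close>:
    reassociate, apply \<psi>, reassociate, use the cylinder \<open>K'\<close>, then \<nu>.\<close>
  note L = Fsq_trans[OF Fsq_trans[OF L1 L2] Fsq_trans[OF L3 Fsq_trans[OF L4[unfolded I] Fsq_Id2[OF \<nu>]]]]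
  note R1 = Fsq_Asc_inv[OF d0 d1 t q(1) \<delta>]
  note R2 = Fsq_exchange[OF d0 d1 qt C.inv_cells_cells[OF \<sigma>'] \<delta>]
  \<comment> \<open>From the whiskered ends of \<open>K\<close> to the same target, through \<sigma>
    and the cylinder \<open>K\<close>. All connecting cells are invertible, so this square can be
    cancelled from \<open>L\<close>.\<close>
  note R = Fsq_trans[OF Fsq_trans[OF R1 R2] hat_cyl_props(2)[OF K]]
  have R_inv: "cya0 K \<bullet>\<^bsub>C\<^esub> (inv_cell C \<sigma> \<ast>\<^bsub>C\<^esub> Id2 C (cyd0 K)) \<bullet>\<^bsub>C\<^esub> inv_cell C (Asc C q t (cyd0 K))
      \<in> inv_cells C (q \<odot>\<^bsub>C\<^esub> (t \<odot>\<^bsub>C\<^esub> cyd0 K)) (cyx K)"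
    "cya1 K \<bullet>\<^bsub>C\<^esub> (inv_cell C \<sigma> \<ast>\<^bsub>C\<^esub> Id2 C (cyd1 K)) \<bullet>\<^bsub>C\<^esub> inv_cell C (Asc C q t (cyd1 K))
      \<in> inv_cells C (q \<odot>\<^bsub>C\<^esub> (t \<odot>\<^bsub>C\<^esub> cyd1 K)) (cyx K)"
    using C.Vcomp_inv_cells[OF C.Vcomp_inv_cells[OF C.Asc_inv[OF d0 t q(1)] C.whisker_r_inv[OF d0 qt \<sigma>']] a(1)]
      C.Vcomp_inv_cells[OF C.Vcomp_inv_cells[OF C.Asc_inv[OF d1 t q(1)] C.whisker_r_inv[OF d1 qt \<sigma>']] a(2)]
    by simp_all
  \<comment> \<open>Pasting brackets the connecting cells of \<open>L\<close> differently from
    \<open>e0\<close> and \<open>e1\<close>.\<close>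
  have assoc: "(\<nu> \<bullet>\<^bsub>C\<^esub> (Id2 C n \<ast>\<^bsub>C\<^esub> \<alpha>)) \<bullet>\<^bsub>C\<^esub> Asc C n (cys K') d = \<nu> \<bullet>\<^bsub>C\<^esub> (Id2 C n \<ast>\<^bsub>C\<^esub> \<alpha>) \<bullet>\<^bsub>C\<^esub> Asc C n (cys K') d"
    if "d \<in> hom C X (cyW K')" "\<alpha> \<in> inv_cells C (cys K' \<odot>\<^bsub>C\<^esub> d) (cyx K')" for d \<alpha>
    by (rule C.Vcomp_assoc[OF C.inv_cells_cells[OF C.Asc_cells[OF that(1) s' n]]
          C.whisker_l[OF C.Comp1_hom[OF that(1) s'] n C.inv_cells_cells[OF that(2)]] \<nu>])
  have a': "cya0 K' \<in> inv_cells C (cys K' \<odot>\<^bsub>C\<^esub> cyd0 K') (cyx K')" "cya1 K' \<in> inv_cells C (cys K' \<odot>\<^bsub>C\<^esub> cyd1 K') (cyx K')"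
    using K' by (auto simp: w_cylinder_def)
  show ?thesis
  proof (rule Fsq_faithful[OF q(2,1) kd0 kd1 _ _ \<phi>0 \<phi>1])
    show "Id2 D (F1 k) \<ast>\<^bsub>D\<^esub> ?\<delta>' \<in> cells D (F1 (k \<odot>\<^bsub>C\<^esub> cyd0 K')) (F1 (k \<odot>\<^bsub>C\<^esub> cyd1 K'))"
      using D.whisker_l[OF F_Arr[OF d0'] F_Arr[OF k] \<delta>'] F_comp[OF d0' k] F_comp[OF d1' k] by simp
    show "Id2 D (F1 t) \<ast>\<^bsub>D\<^esub> ?\<delta> \<in> cells D (F1 (t \<odot>\<^bsub>C\<^esub> cyd0 K)) (F1 (t \<odot>\<^bsub>C\<^esub> cyd1 K))"
      using D.whisker_l[OF F_Arr[OF d0] F_Arr[OF t] \<delta>] F_comp[OF d0 t] F_comp[OF d1 t] by simp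
    show "Fsq (q \<odot>\<^bsub>C\<^esub> k \<odot>\<^bsub>C\<^esub> cyd0 K') (q \<odot>\<^bsub>C\<^esub> k \<odot>\<^bsub>C\<^esub> cyd1 K') (Id2 D (F1 q) \<ast>\<^bsub>D\<^esub> Id2 D (F1 k) \<ast>\<^bsub>D\<^esub> ?\<delta>')
      (q \<odot>\<^bsub>C\<^esub> t \<odot>\<^bsub>C\<^esub> cyd0 K) (q \<odot>\<^bsub>C\<^esub> t \<odot>\<^bsub>C\<^esub> cyd1 K) (Id2 D (F1 q) \<ast>\<^bsub>D\<^esub> Id2 D (F1 t) \<ast>\<^bsub>D\<^esub> ?\<delta>)
      (Id2 C q \<ast>\<^bsub>C\<^esub> \<phi>0) (Id2 C q \<ast>\<^bsub>C\<^esub> \<phi>1)"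
      by (rule Fsq_cancel[OF _ R C.whisker_l[OF kd0 q(1) \<phi>0] C.whisker_l[OF kd1 q(1) \<phi>1] R_inv])
        (use L in \<open>simp add: e0 e1 assoc d0' d1' a'\<close>)
  qed
qed

text \<open>The square moves \<open>\<theta>1\<close> past the middle cell, where it becomes
  \<open>\<theta>0\<close> and cancels against the inverse placed in the new
  \<open>heta\<close>.\<close>

lemma hat_htpy_transfer:
  assumes H: "w_homotopy C Weq f g H" and K': "w_cylinder C Weq (Dom C f) K'"
    and h': "h' \<in> hom C (cyW K') (Cod C f)"
    and sq: "Fsq (h' \<odot>\<^bsub>C\<^esub> cyd0 K') (h' \<odot>\<^bsub>C\<^esub> cyd1 K') (Id2 D (F1 h') \<ast>\<^bsub>D\<^esub> hat_cyl C D F1 F2 K')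
      (hmap H \<odot>\<^bsub>C\<^esub> cyd0 (hcyl H)) (hmap H \<odot>\<^bsub>C\<^esub> cyd1 (hcyl H))
      (Id2 D (F1 (hmap H)) \<ast>\<^bsub>D\<^esub> hat_cyl C D F1 F2 (hcyl H)) \<theta>0 \<theta>1"
    and \<theta>0: "\<theta>0 \<in> inv_cells C (h' \<odot>\<^bsub>C\<^esub> cyd0 K') (hmap H \<odot>\<^bsub>C\<^esub> cyd0 (hcyl H))"
  shows "hat_htpy C D F1 F2 \<lparr>hcyl = K', hmap = h', heta = inv_cell C \<theta>0 \<bullet>\<^bsub>C\<^esub> heta H,
      heps = heps H \<bullet>\<^bsub>C\<^esub> \<theta>1\<rparr> = hat_htpy C D F1 F2 H"
proof -
  let ?m = "Id2 D (F1 h') \<ast>\<^bsub>D\<^esub> hat_cyl C D F1 F2 K'"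
  let ?n = "Id2 D (F1 (hmap H)) \<ast>\<^bsub>D\<^esub> hat_cyl C D F1 F2 (hcyl H)"
  have e: "heta H \<in> cells C f (hmap H \<odot>\<^bsub>C\<^esub> cyd0 (hcyl H))"
    and p: "heps H \<in> cells C (hmap H \<odot>\<^bsub>C\<^esub> cyd1 (hcyl H)) g"
    using H by (auto simp: w_homotopy_def)
  have m: "?m \<in> cells D (F1 (h' \<odot>\<^bsub>C\<^esub> cyd0 K')) (F1 (h' \<odot>\<^bsub>C\<^esub> cyd1 K'))"
    and n: "?n \<in> cells D (F1 (hmap H \<odot>\<^bsub>C\<^esub> cyd0 (hcyl H))) (F1 (hmap H \<odot>\<^bsub>C\<^esub> cyd1 (hcyl H)))"
    and \<theta>1: "\<theta>1 \<in> cells C (h' \<odot>\<^bsub>C\<^esub> cyd1 K') (hmap H \<odot>\<^bsub>C\<^esub> cyd1 (hcyl H))"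
    and eq: "F2 \<theta>1 \<bullet>\<^bsub>D\<^esub> ?m = ?n \<bullet>\<^bsub>D\<^esub> F2 \<theta>0" using sq by (auto simp: Fsq_def)
  note \<theta>0' = C.inv_cells_cells[OF \<theta>0] C.inv_cell_cells[OF \<theta>0]
  note Fc = F_cells
  let ?e = "F2 (inv_cell C \<theta>0) \<bullet>\<^bsub>D\<^esub> F2 (heta H)"
  note ec = D.Vcomp_cells[OF Fc[OF e] Fc[OF \<theta>0'(2)]]
  have "F2 (heps H \<bullet>\<^bsub>C\<^esub> \<theta>1) \<bullet>\<^bsub>D\<^esub> ?m \<bullet>\<^bsub>D\<^esub> F2 (inv_cell C \<theta>0 \<bullet>\<^bsub>C\<^esub> heta H) =
    (F2 (heps H) \<bullet>\<^bsub>D\<^esub> F2 \<theta>1) \<bullet>\<^bsub>D\<^esub> ?m \<bullet>\<^bsub>D\<^esub> ?e"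
    using F_Vcomp[OF \<theta>1 p] F_Vcomp[OF e \<theta>0'(2)] by simp
  also have "\<dots> = F2 (heps H) \<bullet>\<^bsub>D\<^esub> (F2 \<theta>1 \<bullet>\<^bsub>D\<^esub> ?m) \<bullet>\<^bsub>D\<^esub> ?e"
    using D.Vcomp_assoc[OF D.Vcomp_cells[OF ec m] Fc[OF \<theta>1] Fc[OF p]] D.Vcomp_assoc[OF ec m Fc[OF \<theta>1]] by simp
  also have "\<dots> = F2 (heps H) \<bullet>\<^bsub>D\<^esub> ?n \<bullet>\<^bsub>D\<^esub> (F2 \<theta>0 \<bullet>\<^bsub>D\<^esub> ?e)"
    using D.Vcomp_assoc[OF ec Fc[OF \<theta>0'(1)] n] eq by simp
  also have "F2 \<theta>0 \<bullet>\<^bsub>D\<^esub> ?e = F2 (heta H)"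
    by (rule D.Vcomp_cancel_right[OF Fc[OF e] Fc[OF \<theta>0'(2)] Fc[OF \<theta>0'(1)] F_inv(2)[OF \<theta>0]])
  finally show ?thesis by (simp add: hat_htpy_def)
qed

end

section \<open>Lifting cylinders\<close>

context bicategory
begin

section \<open>Hom-categories out of a biinitial and into a biterminal object\<close>

lemma biinitialD:
  assumes "biinitial C I" "Z \<in> Obj C"
  shows "hom C I Z \<noteq> {}"
    and "x \<in> hom C I Z \<Longrightarrow> y \<in> hom C I Z \<Longrightarrow> \<exists>\<mu>. \<mu> \<in> cells C x y"
    and "x \<in> hom C I Z \<Longrightarrow> y \<in> hom C I Z \<Longrightarrow> \<mu> \<in> cells C x y \<Longrightarrow> \<nu> \<in> cells C x y \<Longrightarrow> \<mu> = \<nu>"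
  using assms
  by (auto simp: biinitial_def equivalence_functor_def full_functor_def faithful_functor_def
      ess_surj_functor_def hom_cat_def unit_cat_def inj_on_def)

lemma biterminalD:
  assumes "biterminal C T" "Z \<in> Obj C"
  shows "hom C Z T \<noteq> {}"
    and "x \<in> hom C Z T \<Longrightarrow> y \<in> hom C Z T \<Longrightarrow> \<exists>\<mu>. \<mu> \<in> cells C x y"
    and "x \<in> hom C Z T \<Longrightarrow> y \<in> hom C Z T \<Longrightarrow> \<mu> \<in> cells C x y \<Longrightarrow> \<nu> \<in> cells C x y \<Longrightarrow> \<mu> = \<nu>"
  using assms
  by (auto simp: biterminal_def equivalence_functor_def full_functor_def faithful_functor_def
      ess_surj_functor_def hom_cat_def unit_cat_def inj_on_def)

text \<open>Phrased for an abstract set of arrows so as to serve biinitial and biterminal objects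
  alike. The inverse laws hold because parallel 2-cells coincide.\<close>

lemma indiscrete_inv_cells:
  assumes "\<And>x y. x \<in> H \<Longrightarrow> y \<in> H \<Longrightarrow> \<exists>\<mu>. \<mu> \<in> cells C x y"
    and "\<And>x y \<mu> \<nu>. x \<in> H \<Longrightarrow> y \<in> H \<Longrightarrow> \<mu> \<in> cells C x y \<Longrightarrow> \<nu> \<in> cells C x y \<Longrightarrow> \<mu> = \<nu>"
    and "x \<in> H" "y \<in> H"
  shows "\<exists>\<mu>. \<mu> \<in> inv_cells C x y"
proof -
  obtain \<mu> \<nu> where m: "\<mu> \<in> cells C x y" and n: "\<nu> \<in> cells C y x" using assms by meson
  note a = cells_homD(2,3)[OF m]
  have "\<nu> \<bullet> \<mu> = Id2 C x" "\<mu> \<bullet> \<nu> = Id2 C y"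
    using assms(2)[OF assms(3,3) Vcomp_cells[OF m n] Id2_cells[OF a(1)]]
      assms(2)[OF assms(4,4) Vcomp_cells[OF n m] Id2_cells[OF a(2)]] by auto
  then show ?thesis using inv_cellsI(1)[OF m n] by blast
qed

lemma biinitial_inv_cells:
  assumes I: "biinitial C I" and x: "x \<in> hom C I Z" and y: "y \<in> hom C I Z"
  shows "\<exists>\<mu>. \<mu> \<in> inv_cells C x y"
  by (rule indiscrete_inv_cells[OF biinitialD(2,3)[OF I hom_Obj(2)[OF x]] x y])

lemma biterminal_inv_cells:
  assumes T: "biterminal C T" and x: "x \<in> hom C Z T" and y: "y \<in> hom C Z T"
  shows "\<exists>\<mu>. \<mu> \<in> inv_cells C x y"
  by (rule indiscrete_inv_cells[OF biterminalD(2,3)[OF T hom_Obj(1)[OF x]] x y])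

text \<open>The bicategorical coproduct \<open>X + X\<close> with inclusions \<open>u\<close> and
  \<open>v\<close>, in the form consumed by lifting arguments: extension of pairs of arrows and of
  pairs of invertible 2-cells.\<close>

definition bicopower :: "'o \<Rightarrow> 'o \<Rightarrow> 'a \<Rightarrow> 'a \<Rightarrow> bool" where
  "bicopower X S u v \<longleftrightarrow> u \<in> hom C X S \<and> v \<in> hom C X S \<and>
    (\<forall>W. \<forall>d \<in> hom C X W. \<forall>d' \<in> hom C X W. \<exists>a \<in> hom C S W.
       inv_cells C (a \<odot> u) d \<noteq> {} \<and> inv_cells C (a \<odot> v) d' \<noteq> {}) \<and>
    (\<forall>W. \<forall>a \<in> hom C S W. \<forall>b \<in> hom C S W.
       \<forall>\<mu> \<in> inv_cells C (a \<odot> u) (b \<odot> u). \<forall>\<nu> \<in> inv_cells C (a \<odot> v) (b \<odot> v).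
       \<exists>\<omega> \<in> inv_cells C a b. \<omega> \<ast> Id2 C u = \<mu> \<and> \<omega> \<ast> Id2 C v = \<nu>)"

text \<open>Over a biinitial object the cell of a cocone can always be supplied and the condition on
  morphisms of cocones always holds, so cocones amount to pairs of arrows out of
  \<open>X\<close>.\<close>

lemma bipushout_bicopower:
  assumes I: "biinitial C I" and t: "t \<in> hom C I X" and P: "bipushout C t t S u \<gamma> v"
  shows "bicopower X S u v"
proof -
  have ct: "Cod C t = X" using t by (simp add: hom_def)
  have u: "u \<in> hom C X S" and v: "v \<in> hom C X S"
    using P by (auto simp: bipushout_def po_cocone_cat_def ct)
  \<comment> \<open>\<open>cc\<close> and \<open>cm\<close> are the actions on objects and morphisms
    of the comparison functor of the bipushout.\<close>
  define cc where "cc w = (w \<odot> u, inv_cell C (Asc C w v t) \<bullet> (Id2 C w \<ast> \<gamma>) \<bullet> Asc C w u t, w \<odot> v)" for w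
  define cm where "cm \<omega> = (\<omega> \<ast> Id2 C u, \<omega> \<ast> Id2 C v)" for \<omega>
  have eq: "equivalence_functor (hom_cat C S Z) (po_cocone_cat C t t Z) cc cm" if "Z \<in> Obj C" for Z
    using P that unfolding bipushout_def cc_def cm_def by blast
  have ex: "\<exists>a \<in> hom C S W. inv_cells C (a \<odot> u) d \<noteq> {} \<and> inv_cells C (a \<odot> v) d' \<noteq> {}"
    if d: "d \<in> hom C X W" "d' \<in> hom C X W" for W d d'
  proof -
    obtain \<kappa> where k: "\<kappa> \<in> inv_cells C (d \<odot> t) (d' \<odot> t)"
      using biinitial_inv_cells[OF I Comp1_hom[OF t d(1)] Comp1_hom[OF t d(2)]] by blast
    have "(d, \<kappa>, d') \<in> cob (po_cocone_cat C t t W)" using d k by (simp add: po_cocone_cat_def ct)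
    then obtain a m where a: "a \<in> hom C S W" and m: "cat_iso (po_cocone_cat C t t W) (cc a) (d, \<kappa>, d') m"
      using eq[OF hom_Obj(2)[OF d(1)]] unfolding equivalence_functor_def ess_surj_functor_def
      by (auto simp: hom_cat_def)
    then obtain \<alpha> \<beta> \<alpha>' \<beta>' where "\<alpha> \<in> cells C (a \<odot> u) d" "\<beta> \<in> cells C (a \<odot> v) d'"
      "\<alpha>' \<in> cells C d (a \<odot> u)" "\<beta>' \<in> cells C d' (a \<odot> v)"
      "\<alpha>' \<bullet> \<alpha> = Id2 C (a \<odot> u)" "\<beta>' \<bullet> \<beta> = Id2 C (a \<odot> v)" "\<alpha> \<bullet> \<alpha>' = Id2 C d" "\<beta> \<bullet> \<beta>' = Id2 C d'"
      by (auto simp: cat_iso_def po_cocone_cat_def cc_def)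
    then have "\<alpha> \<in> inv_cells C (a \<odot> u) d" "\<beta> \<in> inv_cells C (a \<odot> v) d'"
      by (blast intro: inv_cellsI(1))+
    then show ?thesis using a by blast
  qed
  have ex2: "\<exists>\<omega> \<in> cells C a b. \<omega> \<ast> Id2 C u = \<mu> \<and> \<omega> \<ast> Id2 C v = \<nu>"
    if a: "a \<in> hom C S W" and b: "b \<in> hom C S W"
      and m: "\<mu> \<in> cells C (a \<odot> u) (b \<odot> u)" and n: "\<nu> \<in> cells C (a \<odot> v) (b \<odot> v)" for W a b \<mu> \<nu>
  proof -
    have c: "fst (snd (cc x)) \<in> cells C ((x \<odot> u) \<odot> t) ((x \<odot> v) \<odot> t)" if "x \<in> hom C S W" for x
    proof -
      have "\<gamma> \<in> cells C (u \<odot> t) (v \<odot> t)" using P by (auto simp: bipushout_def po_cocone_cat_def inv_cells_def)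
      from Vcomp_cells[OF Vcomp_cells[OF inv_cells_cells[OF Asc_cells[OF t u that]]
            whisker_l[OF Comp1_hom[OF t u] that this]] inv_cell_cells[OF Asc_cells[OF t v that]]]
      show ?thesis by (simp add: cc_def)
    qed
    note h = Comp1_hom[OF t Comp1_hom[OF u a]] Comp1_hom[OF t Comp1_hom[OF v b]]
    \<comment> \<open>Both sides are parallel 2-cells between arrows out of the biinitial object,
      hence equal.\<close>
    have "(\<nu> \<ast> Id2 C t) \<bullet> fst (snd (cc a)) = fst (snd (cc b)) \<bullet> (\<mu> \<ast> Id2 C t)"
      by (rule biinitialD(3)[OF I hom_Obj(2)[OF a] h Vcomp_cells[OF c[OF a] whisker_r[OF t Comp1_hom[OF v a] n]]
            Vcomp_cells[OF whisker_r[OF t Comp1_hom[OF u a] m] c[OF b]]])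
    then have "(\<mu>, \<nu>) \<in> chom (po_cocone_cat C t t W) (cc a) (cc b)"
      using m n by (simp add: po_cocone_cat_def cc_def)
    moreover have "\<forall>g \<in> chom (po_cocone_cat C t t W) (cc a) (cc b). \<exists>\<omega> \<in> cells C a b. cm \<omega> = g"
      using eq[OF hom_Obj(2)[OF a]] a b
      unfolding equivalence_functor_def full_functor_def by (simp add: hom_cat_def)
    ultimately show ?thesis by (auto simp: cm_def)
  qed
  have un: "\<omega> = \<omega>'" if a: "a \<in> hom C S W" and b: "b \<in> hom C S W" and o: "\<omega> \<in> cells C a b" "\<omega>' \<in> cells C a b"
      "\<omega> \<ast> Id2 C u = \<omega>' \<ast> Id2 C u" "\<omega> \<ast> Id2 C v = \<omega>' \<ast> Id2 C v" for W a b \<omega> \<omega>'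
    using eq[OF hom_Obj(2)[OF a]] a b o
    unfolding equivalence_functor_def faithful_functor_def inj_on_def by (auto simp: hom_cat_def cm_def)
  \<comment> \<open>The pair of inverses is extended as well; faithfulness makes the two extensions
    mutually inverse.\<close>
  have inv: "\<exists>\<omega> \<in> inv_cells C a b. \<omega> \<ast> Id2 C u = \<mu> \<and> \<omega> \<ast> Id2 C v = \<nu>"
    if a: "a \<in> hom C S W" and b: "b \<in> hom C S W"
      and m: "\<mu> \<in> inv_cells C (a \<odot> u) (b \<odot> u)" and n: "\<nu> \<in> inv_cells C (a \<odot> v) (b \<odot> v)" for W a b \<mu> \<nu>
  proof -
    obtain \<omega> where o: "\<omega> \<in> cells C a b" "\<omega> \<ast> Id2 C u = \<mu>" "\<omega> \<ast> Id2 C v = \<nu>"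
      using ex2[OF a b inv_cells_cells[OF m] inv_cells_cells[OF n]] by blast
    obtain \<omega>' where o': "\<omega>' \<in> cells C b a" "\<omega>' \<ast> Id2 C u = inv_cell C \<mu>" "\<omega>' \<ast> Id2 C v = inv_cell C \<nu>"
      using ex2[OF b a inv_cell_cells[OF m] inv_cell_cells[OF n]] by blast
    have "\<omega>' \<bullet> \<omega> = Id2 C a"
      by (rule un[OF a a Vcomp_cells[OF o(1) o'(1)] Id2_cells[OF hom_Arr[OF a]]])
        (simp_all add: u v o o' inv_cell_left[OF m] inv_cell_left[OF n]
          Hcomp_Id2[OF u a] Hcomp_Id2[OF v a] whisker_r_Vcomp[OF u a o(1) o'(1)] whisker_r_Vcomp[OF v a o(1) o'(1)])
    moreover have "\<omega> \<bullet> \<omega>' = Id2 C b"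
      by (rule un[OF b b Vcomp_cells[OF o'(1) o(1)] Id2_cells[OF hom_Arr[OF b]]])
        (simp_all add: o o' inv_cell_right[OF m] inv_cell_right[OF n]
          Hcomp_Id2[OF u b] Hcomp_Id2[OF v b] whisker_r_Vcomp[OF u b o'(1) o(1)] whisker_r_Vcomp[OF v b o'(1) o(1)])
    ultimately show ?thesis using inv_cellsI(1)[OF o(1) o'(1)] o by blast
  qed
  show ?thesis unfolding bicopower_def using u v ex inv by blast
qed

text \<open>The filler comes from essential surjectivity: an isomorphism in the category of squares
  is a pair of invertible 2-cells satisfying the displayed equation.\<close>

lemma lifting_propertyD:
  assumes L: "lifting_property C i p" and i: "i \<in> hom C A X" and p: "p \<in> hom C Y B"
    and a: "a \<in> hom C A Y" and b: "b \<in> hom C X B" and g: "\<gamma> \<in> inv_cells C (p \<odot> a) (b \<odot> i)"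
  obtains k \<phi> \<psi> where "k \<in> hom C X Y" "\<phi> \<in> inv_cells C (k \<odot> i) a" "\<psi> \<in> inv_cells C (p \<odot> k) b"
    "(\<psi> \<ast> Id2 C i) \<bullet> inv_cell C (Asc C p k i) = \<gamma> \<bullet> (Id2 C p \<ast> \<phi>)"
proof -
  have e: "Dom C i = A" "Cod C i = X" "Dom C p = Y" "Cod C p = B" using i p by (auto simp: hom_def)
  have "(a, \<gamma>, b) \<in> cob (lifting_cat C i p)" using a b g by (simp add: lifting_cat_def e)
  then obtain k m where k: "k \<in> hom C X Y" and m: "cat_iso (lifting_cat C i p) (lifting_ob C i p k) (a, \<gamma>, b) m"
    using L unfolding lifting_property_def ess_surj_functor_def by (auto simp: hom_cat_def e)
  then obtain \<phi> \<psi> \<phi>' \<psi>' where c: "\<phi> \<in> cells C (k \<odot> i) a" "\<psi> \<in> cells C (p \<odot> k) b"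
      "\<phi>' \<in> cells C a (k \<odot> i)" "\<psi>' \<in> cells C b (p \<odot> k)"
      "\<phi>' \<bullet> \<phi> = Id2 C (k \<odot> i)" "\<psi>' \<bullet> \<psi> = Id2 C (p \<odot> k)" "\<phi> \<bullet> \<phi>' = Id2 C a" "\<psi> \<bullet> \<psi>' = Id2 C b"
    and s: "(\<psi> \<ast> Id2 C i) \<bullet> inv_cell C (Asc C p k i) = \<gamma> \<bullet> (Id2 C p \<ast> \<phi>)"
    by (auto simp: cat_iso_def lifting_cat_def lifting_ob_def)
  show ?thesis by (rule that[OF k _ _ s]) (use c in \<open>blast intro: inv_cellsI(1)\<close>)+
qed

text \<open>
  The 2-cells \<open>\<rho>0\<close>, \<open>\<rho>1\<close> from \<open>q \<odot> e0\<close>, \<open>q \<odot> e1\<close> to a common target make \<open>e0\<close>, \<open>e1\<close> a cylinder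
  with projection \<open>q\<close>, and \<open>(k, \<phi>0, \<phi>1, \<psi>)\<close> is a morphism from \<open>K\<close> to it over \<open>(n, \<nu>)\<close>.
\<close>

definition cylinder_lift ::
  "('o, 'a, 'c) wcyl \<Rightarrow> 'o \<Rightarrow> 'a \<Rightarrow> 'a \<Rightarrow> 'c \<Rightarrow> 'a \<Rightarrow> 'a \<Rightarrow> 'c \<Rightarrow> 'c \<Rightarrow> 'a \<Rightarrow> 'c \<Rightarrow> 'c \<Rightarrow> 'c \<Rightarrow> bool" where
  "cylinder_lift K W q n \<nu> e0 e1 \<rho>0 \<rho>1 k \<phi>0 \<phi>1 \<psi> \<longleftrightarrow> k \<in> hom C (cyW K) W \<and>
     \<psi> \<in> inv_cells C (q \<odot> k) (n \<odot> cys K) \<and>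
     \<phi>0 \<in> inv_cells C (k \<odot> cyd0 K) e0 \<and> \<phi>1 \<in> inv_cells C (k \<odot> cyd1 K) e1 \<and>
     \<rho>0 \<bullet> (Id2 C q \<ast> \<phi>0) = (\<nu> \<bullet> (Id2 C n \<ast> cya0 K) \<bullet> Asc C n (cys K) (cyd0 K)) \<bullet>
       (\<psi> \<ast> Id2 C (cyd0 K)) \<bullet> inv_cell C (Asc C q k (cyd0 K)) \<and>
     \<rho>1 \<bullet> (Id2 C q \<ast> \<phi>1) = (\<nu> \<bullet> (Id2 C n \<ast> cya1 K) \<bullet> Asc C n (cys K) (cyd1 K)) \<bullet>
       (\<psi> \<ast> Id2 C (cyd1 K)) \<bullet> inv_cell C (Asc C q k (cyd1 K))"

text \<open>Isolates the one property of the good cylinder that the transfer of homotopies relies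
  on: it maps to every cylinder whose projection is a trivial fibration, over any arrow
  \<open>n\<close> of the bases. The cell \<nu> stands in for the strict equality of
  \<open>n \<odot> Id1 C X\<close> and \<open>z\<close>.\<close>

definition lifting_cylinder :: "'a set \<Rightarrow> 'a set \<Rightarrow> 'o \<Rightarrow> ('o, 'a, 'c) wcyl \<Rightarrow> bool" where
  "lifting_cylinder Fib Weq X K \<longleftrightarrow> w_cylinder C Weq X K \<and> cyZ K = X \<and> cyx K = Id1 C X \<and>
     (\<forall>W Z q n e0 e1 z \<rho>0 \<rho>1 \<nu>. q \<in> Fib \<inter> Weq \<longrightarrow> q \<in> hom C W Z \<longrightarrow> n \<in> hom C X Z \<longrightarrow>
        e0 \<in> hom C X W \<longrightarrow> e1 \<in> hom C X W \<longrightarrow> \<rho>0 \<in> inv_cells C (q \<odot> e0) z \<longrightarrow>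
        \<rho>1 \<in> inv_cells C (q \<odot> e1) z \<longrightarrow> \<nu> \<in> inv_cells C (n \<odot> Id1 C X) z \<longrightarrow>
        (\<exists>k \<phi>0 \<phi>1 \<psi>. cylinder_lift K W q n \<nu> e0 e1 \<rho>0 \<rho>1 k \<phi>0 \<phi>1 \<psi>))"

end

text \<open>The part of \<open>same_class\<close> about targets, separated from the condition on
  ends so that it can be verified one homotopy at a time.\<close>

definition hats_agree ::
  "('o, 'a, 'c) bicat \<Rightarrow> 'a set \<Rightarrow> ('o, 'a, 'c) whtpy list \<Rightarrow> ('o, 'a, 'c) whtpy list \<Rightarrow> bool" where
  "hats_agree C Weq S T \<longleftrightarrow>
     (\<forall>(D :: ('o, 'a, ('a + 'c + nat) list) bicat) F0 F1 F2.
        localizing C Weq D F0 F1 F2 \<longrightarrow> hat_seq C D F1 F2 S = hat_seq C D F1 F2 T)"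

lemma hats_agree_Cons:
  assumes "hats_agree C Weq [H] [H']" "hats_agree C Weq S S'" "S \<noteq> []" "S' \<noteq> []"
  shows "hats_agree C Weq (H # S) (H' # S')"
proof -
  obtain G R G' R' where "S = G # R" "S' = G' # R'" using assms(3,4) by (metis neq_Nil_conv)
  then show ?thesis using assms(1,2) by (simp add: hats_agree_def)
qed

section \<open>Construction of the cylinder and transfer of homotopies to it\<close>

context model_bicategory
begin

text \<open>The ends \<open>e0\<close>, \<open>e1\<close> extend to one arrow out of
  \<open>S\<close>, which together with \<open>n \<odot> p\<close> forms a square from
  \<open>i\<close> to \<open>q\<close>. Since \<open>i\<close> is a cofibration and \<open>q\<close>
  a trivial fibration, the square has a filler, and restricting it along \<open>u\<close> and
  \<open>v\<close> gives the morphism of cylinders.\<close>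

lemma bicopower_cylinder:
  assumes S: "bicopower X S u v" and i: "i \<in> Cof" "i \<in> hom C S P" and p: "p \<in> Weq" "p \<in> hom C P X"
    and \<beta>0: "\<beta>0 \<in> inv_cells C (p \<odot> (i \<odot> u)) (Id1 C X)" and \<beta>1: "\<beta>1 \<in> inv_cells C (p \<odot> (i \<odot> v)) (Id1 C X)"
  shows "lifting_cylinder Fib Weq X \<lparr>cyW = P, cyZ = X, cyd0 = i \<odot> u, cyd1 = i \<odot> v, cyx = Id1 C X,
    cys = p, cya0 = \<beta>0, cya1 = \<beta>1\<rparr>" (is "lifting_cylinder _ _ _ ?K")
proof -
  have u: "u \<in> hom C X S" and v: "v \<in> hom C X S" using S by (auto simp: bicopower_def)
  note iu = Comp1_hom[OF u i(2)] and iv = Comp1_hom[OF v i(2)]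
  have X: "X \<in> Obj C" using hom_Obj[OF u] by blast
  have K: "w_cylinder C Weq X ?K"
    using p i u v iu iv \<beta>0 \<beta>1 X hom_Obj Id1_hom[OF X] by (auto simp: w_cylinder_def)
  have lift: "\<exists>k \<phi>0 \<phi>1 \<psi>. cylinder_lift ?K W q n \<nu> e0 e1 \<rho>0 \<rho>1 k \<phi>0 \<phi>1 \<psi>"
    if q: "q \<in> Fib \<inter> Weq" "q \<in> hom C W Z" and n: "n \<in> hom C X Z" and e: "e0 \<in> hom C X W" "e1 \<in> hom C X W"
      and \<rho>: "\<rho>0 \<in> inv_cells C (q \<odot> e0) z" "\<rho>1 \<in> inv_cells C (q \<odot> e1) z" and \<nu>: "\<nu> \<in> inv_cells C (n \<odot> Id1 C X) z"
    for W Z q n e0 e1 z \<rho>0 \<rho>1 \<nu>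
  proof -
    from S e obtain a \<tau>0 \<tau>1 where a: "a \<in> hom C S W" and \<tau>: "\<tau>0 \<in> inv_cells C (a \<odot> u) e0" "\<tau>1 \<in> inv_cells C (a \<odot> v) e1"
      unfolding bicopower_def by (meson ex_in_conv)
    note np = Comp1_hom[OF p(2) n] and qa = Comp1_hom[OF a q(2)]
    note npi = Comp1_hom[OF i(2) np]
    \<comment> \<open>\<open>M\<close>, \<open>N\<close> and \<open>l\<close> are the comparison
      cells to \<open>z\<close>: the first two start at restrictions of \<open>n \<odot> p\<close>
      in two bracketings, the last at the restriction of \<open>q \<odot> a\<close>.\<close>
    define M where "M d \<beta> = \<nu> \<bullet> (Id2 C n \<ast> \<beta>) \<bullet> Asc C n p d" for d \<beta>
    have M: "M (i \<odot> w) \<beta> \<in> inv_cells C ((n \<odot> p) \<odot> (i \<odot> w)) z"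
      if "w \<in> hom C X S" "\<beta> \<in> inv_cells C (p \<odot> (i \<odot> w)) (Id1 C X)" for w \<beta>
      unfolding M_def
      using Vcomp_inv_cells[OF Vcomp_inv_cells[OF Asc_cells whisker_l_inv] \<nu>,
          OF Comp1_hom[OF that(1) i(2)] p(2) n Comp1_hom[OF Comp1_hom[OF that(1) i(2)] p(2)] n that(2)] .
    define N where "N w \<beta> = M (i \<odot> w) \<beta> \<bullet> Asc C (n \<odot> p) i w" for w \<beta>
    have N: "N w \<beta> \<in> inv_cells C (((n \<odot> p) \<odot> i) \<odot> w) z"
      if "w \<in> hom C X S" "\<beta> \<in> inv_cells C (p \<odot> (i \<odot> w)) (Id1 C X)" for w \<beta>
      unfolding N_def by (rule Vcomp_inv_cells[OF Asc_cells[OF that(1) i(2) np] M[OF that]])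
    define l where "l w \<rho> \<tau> = \<rho> \<bullet> (Id2 C q \<ast> \<tau>) \<bullet> Asc C q a w" for w \<rho> \<tau>
    have l: "l w \<rho> \<tau> \<in> inv_cells C ((q \<odot> a) \<odot> w) z"
      if "w \<in> hom C X S" "\<rho> \<in> inv_cells C (q \<odot> e) z" "\<tau> \<in> inv_cells C (a \<odot> w) e" for w \<rho> \<tau> e
      unfolding l_def
      by (rule Vcomp_inv_cells[OF Vcomp_inv_cells[OF Asc_cells[OF that(1) a q(2)]
              whisker_l_inv[OF Comp1_hom[OF that(1) a] q(2) that(3)]] that(2)])
    note N0 = N[OF u \<beta>0] and N1 = N[OF v \<beta>1]
    note l0 = l[OF u \<rho>(1) \<tau>(1)] and l1 = l[OF v \<rho>(2) \<tau>(2)]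
    \<comment> \<open>\<gamma> is built from its restrictions to the two summands, chosen so that it
      carries \<open>N\<close> to \<open>l\<close> on each of them; this is what
      \<open>lift_restrict\<close> asks for.\<close>
    from S qa npi Vcomp_inv_cells[OF l0 inv_cell_inv_cells[OF N0]] Vcomp_inv_cells[OF l1 inv_cell_inv_cells[OF N1]]
    obtain \<gamma> where \<gamma>: "\<gamma> \<in> inv_cells C (q \<odot> a) ((n \<odot> p) \<odot> i)"
      and \<gamma>u: "\<gamma> \<ast> Id2 C u = inv_cell C (N u \<beta>0) \<bullet> l u \<rho>0 \<tau>0"
      and \<gamma>v: "\<gamma> \<ast> Id2 C v = inv_cell C (N v \<beta>1) \<bullet> l v \<rho>1 \<tau>1"
      unfolding bicopower_def by meson
    have 0: "N u \<beta>0 \<bullet> (\<gamma> \<ast> Id2 C u) = l u \<rho>0 \<tau>0"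
      unfolding \<gamma>u by (rule Vcomp_cancel_right[OF inv_cells_cells[OF l0] inv_cell_cells[OF N0]
            inv_cells_cells[OF N0] inv_cell_right[OF N0]])
    have 1: "N v \<beta>1 \<bullet> (\<gamma> \<ast> Id2 C v) = l v \<rho>1 \<tau>1"
      unfolding \<gamma>v by (rule Vcomp_cancel_right[OF inv_cells_cells[OF l1] inv_cell_cells[OF N1]
            inv_cells_cells[OF N1] inv_cell_right[OF N1]])
    have "lifting_property C i q" using M1 i q by blast
    then obtain k \<phi> \<psi> where k: "k \<in> hom C P W" and \<phi>: "\<phi> \<in> inv_cells C (k \<odot> i) a"
      and \<psi>: "\<psi> \<in> inv_cells C (q \<odot> k) (n \<odot> p)"
      and sq: "(\<psi> \<ast> Id2 C i) \<bullet> inv_cell C (Asc C q k i) = \<gamma> \<bullet> (Id2 C q \<ast> \<phi>)"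
      using lifting_propertyD[OF _ i(2) q(2) a np \<gamma>] by blast
    \<comment> \<open>Restricting the filler along an inclusion \<open>w\<close> gives the cell from
      an end of the cylinder to \<open>e0\<close> or \<open>e1\<close>.\<close>
    define f where "f \<tau> w = \<tau> \<bullet> (\<phi> \<ast> Id2 C w) \<bullet> inv_cell C (Asc C k i w)" for \<tau> w
    have f: "f \<tau> w \<in> inv_cells C (k \<odot> (i \<odot> w)) e"
      if "w \<in> hom C X S" "\<tau> \<in> inv_cells C (a \<odot> w) e" for w \<tau> e
      unfolding f_def
      by (rule Vcomp_inv_cells[OF Vcomp_inv_cells[OF Asc_inv[OF that(1) i(2) k]
              whisker_r_inv[OF that(1) Comp1_hom[OF i(2) k] \<phi>]] that(2)])
    have R: "\<rho> \<bullet> (Id2 C q \<ast> f \<tau> w) = M (i \<odot> w) \<beta> \<bullet> (\<psi> \<ast> Id2 C (i \<odot> w)) \<bullet> inv_cell C (Asc C q k (i \<odot> w))"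
      if w: "w \<in> hom C X S" and \<rho>: "\<rho> \<in> inv_cells C (q \<odot> e) z" and \<tau>: "\<tau> \<in> inv_cells C (a \<odot> w) e"
        and \<beta>: "\<beta> \<in> inv_cells C (p \<odot> (i \<odot> w)) (Id1 C X)" and c: "N w \<beta> \<bullet> (\<gamma> \<ast> Id2 C w) = l w \<rho> \<tau>"
      for w \<rho> \<tau> e \<beta>
      unfolding f_def
      by (rule lift_restrict[OF w i(2) q(2) np k a inv_cells_cells[OF \<tau>] inv_cells_cells[OF \<phi>]
            inv_cells_cells[OF \<psi>] inv_cells_cells[OF \<rho>] inv_cells_cells[OF \<gamma>] inv_cells_cells[OF M[OF w \<beta>]] sq
            c[unfolded N_def l_def]])
    have "cylinder_lift ?K W q n \<nu> e0 e1 \<rho>0 \<rho>1 k (f \<tau>0 u) (f \<tau>1 v) \<psi>"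
      unfolding cylinder_lift_def
      using k \<psi> f[OF u \<tau>(1)] f[OF v \<tau>(2)] R[OF u \<rho>(1) \<tau>(1) \<beta>0 0] R[OF v \<rho>(2) \<tau>(2) \<beta>1 1]
      by (simp add: M_def)
    then show ?thesis by blast
  qed
  show ?thesis unfolding lifting_cylinder_def using K lift by simp
qed

text \<open>Cofibrancy of \<open>X\<close> makes the inclusions of \<open>X + X\<close>
  cofibrations, hence the vertex of the factored codiagonal cofibrant; fibrancy of \<open>X\<close>
  passes to the vertex along the trivial fibration.\<close>

lemma fc_lifting_cylinder:
  assumes "X \<in> fc_objects C Fib Cof"
  obtains K where "lifting_cylinder Fib Weq X K" "cyW K \<in> fc_objects C Fib Cof"
proof -
  obtain I t where I: "biinitial C I" and t: "t \<in> hom C I X" "t \<in> Cof"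
    using assms by (auto simp: fc_objects_def cofibrant_def)
  obtain T r where T: "biterminal C T" and r: "r \<in> hom C X T" "r \<in> Fib"
    using assms by (auto simp: fc_objects_def fibrant_def)
  obtain S u \<gamma> v where po: "bipushout C t t S u \<gamma> v" using M0_bipushout[OF t(1,1)] by blast
  have S: "bicopower X S u v" by (rule bipushout_bicopower[OF I t(1) po])
  have u: "u \<in> hom C X S" and v: "v \<in> hom C X S" using S by (auto simp: bicopower_def)
  have X: "X \<in> Obj C" using hom_Obj[OF u] by blast
  \<comment> \<open>The codiagonal, restricting to the identity on both summands up to invertible
    cells.\<close>
  from S Id1_hom[OF X] obtain c \<tau>0 \<tau>1 where c: "c \<in> hom C S X"
    and \<tau>0: "\<tau>0 \<in> inv_cells C (c \<odot> u) (Id1 C X)" and \<tau>1: "\<tau>1 \<in> inv_cells C (c \<odot> v) (Id1 C X)"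
    unfolding bicopower_def by (meson ex_in_conv)
  obtain i p \<omega> where i: "i \<in> Cof" and p: "p \<in> Fib \<inter> Weq" and ip: "Dom C p = Cod C i"
    and \<omega>: "\<omega> \<in> inv_cells C c (p \<odot> i)"
    using M2_right[OF hom_Arr[OF c]] by blast
  define P where "P = Cod C i"
  have a: "i \<in> Arr C" "p \<in> Arr C" using i p Cof_Arr Fib_Arr by auto
  have i': "i \<in> hom C (Dom C i) P" and p': "p \<in> hom C P (Cod C p)"
    using a ip by (auto simp: hom_def P_def)
  \<comment> \<open>The factorization axiom names only the middle object; the outer ends are read
    off from the invertible cell \<omega>.\<close>
  have "p \<odot> i \<in> hom C S X" using cells_hom[OF inv_cells_cells[OF \<omega>] c] .
  then have "Dom C i = S" "Cod C p = X" using Comp1_hom[OF i' p'] by (auto simp: hom_def)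
  then have i': "i \<in> hom C S P" and p': "p \<in> hom C P X" using i' p' by auto
  have \<beta>: "\<tau> \<bullet> (inv_cell C \<omega> \<ast> Id2 C w) \<bullet> inv_cell C (Asc C p i w) \<in> inv_cells C (p \<odot> (i \<odot> w)) (Id1 C X)"
    if "w \<in> hom C X S" "\<tau> \<in> inv_cells C (c \<odot> w) (Id1 C X)" for w \<tau>
    by (rule Vcomp_inv_cells[OF Vcomp_inv_cells[OF Asc_inv[OF that(1) i' p']
            whisker_r_inv[OF that(1) Comp1_hom[OF i' p'] inv_cell_inv_cells[OF \<omega>]]] that(2)])
  \<comment> \<open>The composite from the biinitial object through \<open>X\<close> and
    \<open>S\<close> to \<open>P\<close> consists of cofibrations: \<open>v\<close> is a biPushout
    of \<open>t\<close>.\<close>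
  have "v \<odot> t \<in> Cof" using M3_Cof_comp[OF t(2) M3_Cof_bipushout[OF po t(2)]] t(1) v by (simp add: hom_def)
  moreover have vt: "v \<odot> t \<in> hom C I S" by (rule Comp1_hom[OF t(1) v])
  ultimately have "i \<odot> (v \<odot> t) \<in> Cof" using M3_Cof_comp[OF _ i] i' by (simp add: hom_def)
  then have cof: "cofibrant C Cof P"
    unfolding cofibrant_def using I Comp1_hom[OF vt i'] hom_Obj(2)[OF i'] by blast
  have "r \<odot> p \<in> Fib" using M3_Fib_comp[of p r] p r p' by (simp add: hom_def)
  then have "fibrant C Fib P"
    unfolding fibrant_def using T Comp1_hom[OF p' r(1)] hom_Obj(2)[OF i'] by blast
  with cof have P: "P \<in> fc_objects C Fib Cof" by (simp add: fc_objects_def)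
  show thesis
    by (rule that[OF bicopower_cylinder[OF S i i' _ p' \<beta>[OF u \<tau>0] \<beta>[OF v \<tau>1]]]) (use p P in auto)
qed

text \<open>An arbitrary cylinder has no trivial fibration as projection, so it is first embedded by
  \<open>t\<close> into one that has. The homotopy extends along \<open>t\<close> and is then pulled
  back along a lift \<open>k\<close> from \<open>K'\<close>; naturality of the cylinder cells keeps
  the associated 2-cell.\<close>

lemma w_homotopy_on_lifting_cylinder:
  assumes K': "lifting_cylinder Fib Weq X K'" and Y: "fibrant C Fib Y" and f: "f \<in> hom C X Y"
    and H: "w_homotopy C Weq f g H"
  shows "\<exists>H'. w_homotopy C Weq f g H' \<and> hcyl H' = K' \<and> hats_agree C Weq [H] [H']"
proof -
  define K where "K = hcyl H"
  have df: "Dom C f = X" "Cod C f = Y" using f by (auto simp: hom_def)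
  have K: "w_cylinder C Weq X K" and h: "hmap H \<in> hom C (cyW K) Y" and g: "g \<in> hom C X Y"
    and \<eta>: "heta H \<in> cells C f (hmap H \<odot> cyd0 K)" and \<epsilon>: "heps H \<in> cells C (hmap H \<odot> cyd1 K) g"
    using H by (auto simp: w_homotopy_def K_def df)
  have s: "cys K \<in> hom C (cyW K) (cyZ K)" "cys K \<in> Weq" and x: "cyx K \<in> hom C X (cyZ K)"
    and d: "cyd0 K \<in> hom C X (cyW K)" "cyd1 K \<in> hom C X (cyW K)"
    and \<alpha>: "cya0 K \<in> inv_cells C (cys K \<odot> cyd0 K) (cyx K)" "cya1 K \<in> inv_cells C (cys K \<odot> cyd1 K) (cyx K)"
    using K by (auto simp: w_cylinder_def)
  have K'w: "w_cylinder C Weq X K'" and K'': "cyZ K' = X" "cyx K' = Id1 C X"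
    using K' by (auto simp: lifting_cylinder_def)
  have d': "cyd0 K' \<in> hom C X (cyW K')" "cyd1 K' \<in> hom C X (cyW K')"
    using K'w by (auto simp: w_cylinder_def)
  obtain t q \<sigma> where t: "t \<in> Cof" and q: "q \<in> Fib \<inter> Weq" and tq: "Dom C q = Cod C t"
    and \<sigma>: "\<sigma> \<in> inv_cells C (cys K) (q \<odot> t)"
    using M2_right[OF hom_Arr[OF s(1)]] by blast
  define W where "W = Cod C t"
  have a: "t \<in> Arr C" "q \<in> Arr C" using t q Cof_Arr Fib_Arr by auto
  have t': "t \<in> hom C (Dom C t) W" and q': "q \<in> hom C W (Cod C q)"
    using a tq by (auto simp: hom_def W_def)
  have "q \<odot> t \<in> hom C (cyW K) (cyZ K)" using cells_hom[OF inv_cells_cells[OF \<sigma>] s(1)] .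
  then have "Dom C t = cyW K" "Cod C q = cyZ K" using Comp1_hom[OF t' q'] by (auto simp: hom_def)
  then have t': "t \<in> hom C (cyW K) W" and q': "q \<in> hom C W (cyZ K)" using t' q' by auto
  note \<sigma>' = inv_cell_inv_cells[OF \<sigma>]
  \<comment> \<open>Two of three turns the cofibration \<open>t\<close> into a trivial one, so that
    it lifts against fibrations.\<close>
  have tW: "t \<in> Weq" using M5_two_of_three[OF t' q', of "cys K"] \<sigma>' q s(2) by blast
  obtain T y where T: "biterminal C T" and y: "y \<in> hom C Y T" "y \<in> Fib"
    using Y by (auto simp: fibrant_def)
  obtain b where b: "b \<in> hom C W T" using biterminalD(1)[OF T hom_Obj(2)[OF t']] by blast
  \<comment> \<open>Extending \<open>hmap H\<close> along \<open>t\<close> is a lifting problem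
    against \<open>y\<close>; its square commutes up to a cell because \<open>T\<close> is
    biterminal.\<close>
  obtain \<gamma> where \<gamma>: "\<gamma> \<in> inv_cells C (y \<odot> hmap H) (b \<odot> t)"
    using biterminal_inv_cells[OF T Comp1_hom[OF h y(1)] Comp1_hom[OF t' b]] by blast
  have "lifting_property C t y" using M1 t y(2) tW by blast
  then obtain h' \<theta> where h': "h' \<in> hom C W Y" and \<theta>: "\<theta> \<in> inv_cells C (h' \<odot> t) (hmap H)"
    using lifting_propertyD[OF _ t' y(1) h b \<gamma>] by blast
  \<comment> \<open>The cells making \<open>t \<odot> cyd0 K\<close> and
    \<open>t \<odot> cyd1 K\<close> a cylinder with projection \<open>q\<close>.\<close>
  define \<rho> where "\<rho> \<alpha> d = \<alpha> \<bullet> (inv_cell C \<sigma> \<ast> Id2 C d) \<bullet> inv_cell C (Asc C q t d)" for \<alpha> d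
  have \<rho>: "\<rho> \<alpha> d \<in> inv_cells C (q \<odot> (t \<odot> d)) (cyx K)"
    if "d \<in> hom C X (cyW K)" "\<alpha> \<in> inv_cells C (cys K \<odot> d) (cyx K)" for \<alpha> d
    unfolding \<rho>_def
    by (rule Vcomp_inv_cells[OF Vcomp_inv_cells[OF Asc_inv[OF that(1) t' q']
            whisker_r_inv[OF that(1) Comp1_hom[OF t' q'] \<sigma>']] that(2)])
  \<comment> \<open>The base arrow \<open>n\<close> of the lift is \<open>cyx K\<close> itself, as
    \<open>K'\<close> lies over the identity of \<open>X\<close>; hence \<nu> is the right
    unitor.\<close>
  note \<nu> = Run_cells[OF x]
  obtain k \<phi>0 \<phi>1 \<psi> where L: "cylinder_lift K' W q (cyx K) (Run C (cyx K)) (t \<odot> cyd0 K) (t \<odot> cyd1 K)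
      (\<rho> (cya0 K) (cyd0 K)) (\<rho> (cya1 K) (cyd1 K)) k \<phi>0 \<phi>1 \<psi>"
    using K' q q' x Comp1_hom[OF d(1) t'] Comp1_hom[OF d(2) t'] \<rho>[OF d(1) \<alpha>(1)] \<rho>[OF d(2) \<alpha>(2)] \<nu>
    unfolding lifting_cylinder_def by meson
  then have k: "k \<in> hom C (cyW K') W" and \<psi>: "\<psi> \<in> inv_cells C (q \<odot> k) (cyx K \<odot> cys K')"
    and \<phi>0: "\<phi>0 \<in> inv_cells C (k \<odot> cyd0 K') (t \<odot> cyd0 K)" and \<phi>1: "\<phi>1 \<in> inv_cells C (k \<odot> cyd1 K') (t \<odot> cyd1 K)"
    by (auto simp: cylinder_lift_def)
  \<comment> \<open>Compares an end of the new homotopy with the same end of \<open>H\<close>: pass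
    from \<open>k\<close> to \<open>t\<close> by \<phi>, then from \<open>h' \<odot> t\<close> to
    \<open>hmap H\<close> by \<theta>.\<close>
  define \<theta>' where "\<theta>' \<phi> d' d = (\<theta> \<ast> Id2 C d) \<bullet> inv_cell C (Asc C h' t d) \<bullet> (Id2 C h' \<ast> \<phi>) \<bullet> Asc C h' k d'" for \<phi> d' d
  have \<theta>': "\<theta>' \<phi> d' d \<in> inv_cells C ((h' \<odot> k) \<odot> d') (hmap H \<odot> d)"
    if "d \<in> hom C X (cyW K)" "d' \<in> hom C X (cyW K')" "\<phi> \<in> inv_cells C (k \<odot> d') (t \<odot> d)" for \<phi> d d'
    unfolding \<theta>'_def
    by (rule Vcomp_inv_cells[OF Vcomp_inv_cells[OF Vcomp_inv_cells[OF Asc_cells[OF that(2) k h']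
            whisker_l_inv[OF Comp1_hom[OF that(2) k] h' that(3)]] Asc_inv[OF that(1) t' h']]
            whisker_r_inv[OF that(1) Comp1_hom[OF t' h'] \<theta>]])
  note \<theta>0 = \<theta>'[OF d(1) d'(1) \<phi>0] and \<theta>1 = \<theta>'[OF d(2) d'(2) \<phi>1]
  define H' where "H' = \<lparr>hcyl = K', hmap = h' \<odot> k, heta = inv_cell C (\<theta>' \<phi>0 (cyd0 K') (cyd0 K)) \<bullet> heta H,
      heps = heps H \<bullet> \<theta>' \<phi>1 (cyd1 K') (cyd1 K)\<rparr>"
  have hk: "h' \<odot> k \<in> hom C (cyW K') Y" by (rule Comp1_hom[OF k h'])
  have "w_homotopy C Weq f g H'"
    using f g K'w hk Vcomp_cells[OF \<eta> inv_cell_cells[OF \<theta>0]] Vcomp_cells[OF inv_cells_cells[OF \<theta>1] \<epsilon>]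
    by (simp add: w_homotopy_def H'_def df hom_Arr[OF f])
  moreover have "hat_htpy C D F1 F2 H' = hat_htpy C D F1 F2 H"
    if F: "localizing C Weq D F0 F1 F2" for D :: "('o, 'a, ('a + 'c + nat) list) bicat" and F0 F1 F2
  proof -
    interpret D: bicategory D using F by (simp add: localizing_def)
    interpret L: localization C D Weq F0 F1 F2
      using F Weq_Arr by unfold_locales (auto simp: localizing_def)
    let ?\<delta> = "hat_cyl C D F1 F2 K" and ?\<delta>' = "hat_cyl C D F1 F2 K'"
    note \<delta> = L.hat_cyl_props(1)[OF K] and \<delta>' = L.hat_cyl_props(1)[OF K'w]
    have m: "L.Fsq (k \<odot> cyd0 K') (k \<odot> cyd1 K') (Id2 D (F1 k) \<ast>\<^bsub>D\<^esub> ?\<delta>')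
        (t \<odot> cyd0 K) (t \<odot> cyd1 K) (Id2 D (F1 t) \<ast>\<^bsub>D\<^esub> ?\<delta>) \<phi>0 \<phi>1"
      by (rule L.hat_cyl_morphism[OF K K'w t' k q' _ _ _ \<sigma> inv_cells_cells[OF \<psi>]
            inv_cells_cells[OF \<phi>0] inv_cells_cells[OF \<phi>1]])
        (use L q x inv_cells_cells[OF \<nu>] in \<open>auto simp: cylinder_lift_def \<rho>_def K''\<close>)
    note kd = Comp1_hom[OF d'(1) k] Comp1_hom[OF d'(2) k]
    \<comment> \<open>The square for \<open>k\<close> and \<open>t\<close>, whiskered with
      \<open>h'\<close> and pasted with associators and \<theta>; its connecting cells are those
      given by \<open>\<theta>'\<close>.\<close>
    note sq = L.Fsq_trans[OF L.Fsq_trans[OF L.Fsq_trans[OF L.Fsq_Asc[OF d' k h' \<delta>'] L.Fsq_whisker[OF kd h' m]]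
          L.Fsq_Asc_inv[OF d t' h' \<delta>]] L.Fsq_exchange[OF d Comp1_hom[OF t' h'] inv_cells_cells[OF \<theta>] \<delta>]]
    show ?thesis unfolding H'_def K_def
      by (rule L.hat_htpy_transfer[OF H _ _ _ \<theta>0[unfolded K_def]])
        (use K'w hk sq in \<open>auto simp: df K_def \<theta>'_def\<close>)
  qed
  then have "hats_agree C Weq [H] [H']" by (simp add: hats_agree_def)
  ultimately show ?thesis by (intro exI[of _ H']) (simp add: H'_def)
qed

end

section \<open>Classes of homotopies on a fixed cylinder\<close>

text \<open>Sequences are stored in reverse, so the source is read from the last entry and the
  target from the head. Thus a sequence determines its ends.\<close>

lemma w_seq_ends:
  "w_seq C Weq f g S \<Longrightarrow> S \<noteq> [] \<and> f = Src C (heta (last S)) \<and> g = Trg C (heps (hd S))"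
  by (induction rule: w_seq.induct) (auto simp: w_homotopy_def cells_def)

lemma w_seq_unique: "w_seq C Weq f g S \<Longrightarrow> w_seq C Weq f' g' S \<Longrightarrow> f = f' \<and> g = g'"
  using w_seq_ends by metis

lemma w_seq_hom: "w_seq C Weq f g S \<Longrightarrow> f \<in> hom C X Y \<Longrightarrow> g \<in> hom C X Y"
  by (induction rule: w_seq.induct) (auto simp: w_homotopy_def hom_def)

lemma same_class_refl: "w_seq C Weq f g S \<Longrightarrow> same_class C Weq S S"
  by (auto simp: same_class_def)

text \<open>Since ends are unique, the first clause of \<open>same_class\<close> says for both
  sequences that \<open>R\<close> runs from \<open>f\<close> to \<open>g\<close>.\<close>

lemma hclass_eqI:
  assumes S: "w_seq C Weq f g S" and T: "w_seq C Weq f g T"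
    and a: "hats_agree C Weq S T"
  shows "hclass C Weq S = hclass C Weq T"
proof -
  have "(\<exists>f g. w_seq C Weq f g S \<and> w_seq C Weq f g R) \<longleftrightarrow> w_seq C Weq f g R"
    "(\<exists>f g. w_seq C Weq f g T \<and> w_seq C Weq f g R) \<longleftrightarrow> w_seq C Weq f g R" for R
    using S T w_seq_unique[OF S] w_seq_unique[OF T] by metis+
  then show ?thesis unfolding hclass_def same_class_def using a
    by (simp add: hats_agree_def cong: imp_cong)
qed

text \<open>All members of a class share their ends, so the description in \<open>ho_src\<close> has
  exactly one solution.\<close>

lemma ho_src_hclass:
  assumes S: "w_seq C Weq f g S"
  shows "ho_src C Weq (hclass C Weq S) = f"
  unfolding ho_src_def
proof (rule the_equality)
  have "S \<in> hclass C Weq S" using same_class_refl[OF S] by (simp add: hclass_def)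
  then show "\<exists>g. \<exists>T \<in> hclass C Weq S. w_seq C Weq f g T" using S by blast
next
  fix f' assume "\<exists>g'. \<exists>T \<in> hclass C Weq S. w_seq C Weq f' g' T"
  then obtain T g' f1 g1 where "w_seq C Weq f' g' T" "w_seq C Weq f1 g1 S" "w_seq C Weq f1 g1 T"
    by (auto simp: hclass_def same_class_def)
  then show "f' = f" using w_seq_unique[OF S] w_seq_unique[of C Weq f' g' T] by metis
qed

definition homotopies_on ::
  "('o, 'a, 'c) bicat \<Rightarrow> 'a set \<Rightarrow> ('o, 'a, 'c) wcyl \<Rightarrow> 'o \<Rightarrow> 'o \<Rightarrow> ('o, 'a, 'c) whtpy set" where
  "homotopies_on C Weq K X Y = {H. hcyl H = K \<and> (\<exists>f \<in> hom C X Y. \<exists>g \<in> hom C X Y. w_homotopy C Weq f g H)}"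

context model_bicategory
begin

text \<open>Every intermediate arrow again goes from \<open>X\<close> to \<open>Y\<close>, so the
  same cylinder serves for all entries and they are replaced one by one.\<close>

lemma w_seq_on_lifting_cylinder:
  assumes K: "lifting_cylinder Fib Weq X K" and Y: "fibrant C Fib Y"
    and S: "w_seq C Weq f g S" and f: "f \<in> hom C X Y"
  shows "\<exists>S' \<in> lists (homotopies_on C Weq K X Y). w_seq C Weq f g S' \<and> hats_agree C Weq S S'"
proof -
  have *: "\<exists>H' \<in> homotopies_on C Weq K X Y. w_homotopy C Weq f g H' \<and> hats_agree C Weq [H] [H']"
    if H: "w_homotopy C Weq f g H" and f: "f \<in> hom C X Y" for f g H
  proof -
    obtain H' where H': "w_homotopy C Weq f g H'" "hcyl H' = K" "hats_agree C Weq [H] [H']"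
      using w_homotopy_on_lifting_cylinder[OF K Y f H] by blast
    have "H' \<in> homotopies_on C Weq K X Y"
      using H' f w_seq_hom[OF w_seq.single[OF H'(1)] f] unfolding homotopies_on_def by blast
    then show ?thesis using H' by blast
  qed
  from S f show ?thesis
  proof induction
    case (single f g H)
    from *[OF this] obtain H' where "H' \<in> homotopies_on C Weq K X Y" "w_homotopy C Weq f g H'"
      "hats_agree C Weq [H] [H']" by blast
    then show ?case by (intro bexI[of _ "[H']"]) (simp_all add: w_seq.single)
  next
    case (snoc f g S l H)
    from snoc.IH[OF snoc.prems] obtain S' where S': "S' \<in> lists (homotopies_on C Weq K X Y)"
      "w_seq C Weq f g S'" "hats_agree C Weq S S'" by blast
    from *[OF snoc.hyps(2) w_seq_hom[OF snoc.hyps(1) snoc.prems]]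
    obtain H' where H': "H' \<in> homotopies_on C Weq K X Y" "w_homotopy C Weq g l H'"
      "hats_agree C Weq [H] [H']" by blast
    have "S \<noteq> []" "S' \<noteq> []" using w_seq_ends[OF snoc.hyps(1)] w_seq_ends[OF S'(2)] by simp_all
    then have "hats_agree C Weq (H # S) (H' # S')" by (rule hats_agree_Cons[OF H'(3) S'(3)])
    then show ?case using w_seq.snoc[OF S'(2) H'(2)] S'(1) H'(1) by (intro bexI[of _ "H' # S'"]) simp_all
  qed
qed

lemma Ho_cells_subset:
  assumes K: "lifting_cylinder Fib Weq X K" and Y: "fibrant C Fib Y" and f: "f \<in> hom C X Y"
  shows "cells (Ho C Fib Cof Weq) f g \<subseteq> hclass C Weq ` lists (homotopies_on C Weq K X Y)"
proof
  fix \<mu> assume "\<mu> \<in> cells (Ho C Fib Cof Weq) f g"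
  then obtain S f' g' where \<mu>: "\<mu> = hclass C Weq S" and S: "w_seq C Weq f' g' S" and "ho_src C Weq \<mu> = f"
    by (auto simp: cells_def Ho_def full_sub_def ho_bicat_def)
  then have "f' = f" using ho_src_hclass[OF S] by simp
  then have S: "w_seq C Weq f g' S" using S by simp
  obtain S' where "S' \<in> lists (homotopies_on C Weq K X Y)" "w_seq C Weq f g' S'"
    "hats_agree C Weq S S'"
    using w_seq_on_lifting_cylinder[OF K Y S f] by blast
  then show "\<mu> \<in> hclass C Weq ` lists (homotopies_on C Weq K X Y)"
    using hclass_eqI[OF S] unfolding \<mu> by blast
qed

end

section \<open>Small sets\<close>

lemma small_mono: "small \<kappa> B \<Longrightarrow> A \<subseteq> B \<Longrightarrow> small \<kappa> A"
  unfolding small_def using card_of_mono1 ordLeq_ordLess_trans by blast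

lemma small_image: "small \<kappa> A \<Longrightarrow> small \<kappa> (f ` A)"
  unfolding small_def using card_of_image ordLeq_ordLess_trans by blast

text \<open>Uncountability enters as smallness of the set of natural numbers, which pads sets to
  infinite ones and indexes the lengths of lists.\<close>

lemma uncountable_cardinal_infinite:
  assumes "uncountable_cardinal \<kappa>"
  shows "infinite (Field \<kappa>)" "Card_order \<kappa>" "small \<kappa> (UNIV :: nat set)"
proof -
  show c: "Card_order \<kappa>" using assms by (simp add: uncountable_cardinal_def)
  have l: "natLeq <o \<kappa>" using assms by (simp add: uncountable_cardinal_def)
  then show "infinite (Field \<kappa>)"
    using infinite_iff_natLeq_ordLeq card_of_Field_ordIso[OF c]
    by (meson ordIso_symmetric ordLeq_ordIso_trans ordLess_imp_ordLeq)
  show "small \<kappa> (UNIV :: nat set)"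
    unfolding small_def by (rule ordIso_ordLess_trans[OF card_of_nat l])
qed

text \<open>As \<kappa> may be singular, countable unions are estimated by one infinite small set
  \<open>M\<close> instead of by \<kappa>. The disjoint sum of both sets with the natural numbers
  works, since sums of two sets stay below any infinite cardinal.\<close>

lemma small_bound:
  assumes "uncountable_cardinal \<kappa>" "small \<kappa> A" "small \<kappa> B"
  obtains M :: "('a + 'b + nat) set" where "infinite M" "small \<kappa> M" "|A :: 'a set| \<le>o |M|" "|B :: 'b set| \<le>o |M|"
proof -
  note u = uncountable_cardinal_infinite[OF assms(1)]
  let ?M = "A <+> B <+> (UNIV :: nat set)"
  have "small \<kappa> ?M"
    unfolding small_def
    by (intro card_of_Plus_ordLess_infinite_Field[OF u(1,2)] assms(2,3)[unfolded small_def] u(3)[unfolded small_def])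
  moreover have "infinite ?M" by (simp add: finite_Plus_iff)
  moreover have "|A| \<le>o |?M|" by (rule card_of_Plus1)
  moreover have "|B| \<le>o |?M|"
    by (rule ordLeq_transitive[OF card_of_Plus1 card_of_Plus2])
  ultimately show thesis using that by blast
qed

lemma card_of_Times_ordLeq:
  assumes "infinite M" "|A| \<le>o |M|" "|B| \<le>o |M|"
  shows "|A \<times> B| \<le>o |M|"
  by (rule card_of_Sigma_ordLeq_infinite[OF assms(1,2)]) (use assms(3) in blast)

lemma small_Times:
  assumes "uncountable_cardinal \<kappa>" "small \<kappa> A" "small \<kappa> B"
  shows "small \<kappa> (A \<times> B)"
  by (rule small_bound[OF assms]) (simp add: small_def ordLeq_ordLess_trans[OF card_of_Times_ordLeq])

text \<open>Lists are graded by length: each grade has cardinality at most that of \<open>M\<close>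
  by induction, and so does their countable union.\<close>

lemma small_lists:
  fixes A :: "'a set"
  assumes "uncountable_cardinal \<kappa>" "small \<kappa> A"
  shows "small \<kappa> (lists A)"
proof -
  obtain M :: "('a + nat + nat) set" where M: "infinite M" "small \<kappa> M" "|A| \<le>o |M|" "|UNIV :: nat set| \<le>o |M|"
    by (rule small_bound[OF assms uncountable_cardinal_infinite(3)[OF assms(1)]])
  define L where "L n = {xs \<in> lists A. length xs = n}" for n
  have "|L n| \<le>o |M|" for n
  proof (induction n)
    case 0
    have "finite (L 0)" by (rule finite_subset[of _ "{[]}"]) (auto simp: L_def)
    then show ?case
      using M(1) by (intro ordLess_imp_ordLeq finite_ordLess_infinite) (simp_all add: card_of_well_order_on Field_card_of)
  next
    case (Suc n)
    have "L (Suc n) \<subseteq> (\<lambda>(x, xs). x # xs) ` (A \<times> L n)"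
      by (auto simp: L_def image_iff length_Suc_conv)
    then show ?case
      by (rule ordLeq_transitive[OF ordLeq_transitive[OF card_of_mono1 card_of_image]
            card_of_Times_ordLeq[OF M(1,3) Suc]])
  qed
  then have "|\<Union>n. L n| \<le>o |M|" by (intro card_of_UNION_ordLeq_infinite[OF M(1,4)] ballI)
  moreover have "lists A = (\<Union>n. L n)" by (auto simp: L_def)
  ultimately show ?thesis using M(2) unfolding small_def by (simp add: ordLeq_ordLess_trans)
qed

section \<open>Local smallness\<close>

lemma locally_small_full_sub:
  assumes "locally_small \<kappa> C"
  shows "locally_small \<kappa> (full_sub C S)"
  unfolding locally_small_def
proof (intro ballI)
  fix X Y assume "X \<in> Obj (full_sub C S)" "Y \<in> Obj (full_sub C S)"
  then have *: "small_cat \<kappa> (hom_cat C X Y)" using assms by (auto simp: locally_small_def full_sub_def)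
  have h: "hom (full_sub C S) X Y \<subseteq> hom C X Y" by (auto simp: full_sub_def hom_def)
  have c: "cells (full_sub C S) f g \<subseteq> cells C f g" for f g by (auto simp: full_sub_def cells_def)
  have "(\<Union>x\<in>hom (full_sub C S) X Y. \<Union>y\<in>hom (full_sub C S) X Y. cells (full_sub C S) x y)
    \<subseteq> (\<Union>x\<in>hom C X Y. \<Union>y\<in>hom C X Y. cells C x y)"
    by (intro UN_mono h c)
  from small_mono[of \<kappa>, OF _ this] small_mono[of \<kappa>, OF _ h] *
  show "small_cat \<kappa> (hom_cat (full_sub C S) X Y)" by (simp add: small_cat_def hom_cat_def)
qed

text \<open>With the cylinder fixed, a homotopy is its map together with two 2-cells.\<close>

lemma small_homotopies_on:
  assumes \<kappa>: "uncountable_cardinal \<kappa>" and h: "small \<kappa> (hom C (cyW K) Y)"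
    and c: "small \<kappa> (\<Union>f \<in> hom C X Y. \<Union>g \<in> hom C X Y. cells C f g)" (is "small \<kappa> ?M")
    and C: "bicategory C"
  shows "small \<kappa> (homotopies_on C Weq K X Y)"
proof -
  interpret bicategory C by (rule C)
  have "H \<in> (\<lambda>(h, e, p). \<lparr>hcyl = K, hmap = h, heta = e, heps = p\<rparr>) ` (hom C (cyW K) Y \<times> ?M \<times> ?M)"
    if H: "H \<in> homotopies_on C Weq K X Y" for H
  proof -
    from H obtain f g where fg: "f \<in> hom C X Y" "g \<in> hom C X Y" and H: "w_homotopy C Weq f g H" "hcyl H = K"
      unfolding homotopies_on_def by blast
    have "Dom C f = X" "Cod C f = Y" using fg by (simp_all add: hom_def)
    then have d: "cyd0 K \<in> hom C X (cyW K)" "cyd1 K \<in> hom C X (cyW K)"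
      and m: "hmap H \<in> hom C (cyW K) Y" "heta H \<in> cells C f (hmap H \<odot>\<^bsub>C\<^esub> cyd0 K)"
        "heps H \<in> cells C (hmap H \<odot>\<^bsub>C\<^esub> cyd1 K) g"
      using H by (simp_all add: w_homotopy_def w_cylinder_def)
    \<comment> \<open>The composites of \<open>hmap H\<close> with the ends of \<open>K\<close> are
      also arrows from \<open>X\<close> to \<open>Y\<close>, so both cells lie in the hom-category
      of \<open>X\<close> and \<open>Y\<close>.\<close>
    have "heta H \<in> ?M" "heps H \<in> ?M"
      using fg m Comp1_hom[OF d(1) m(1)] Comp1_hom[OF d(2) m(1)] by blast+
    then have "(hmap H, heta H, heps H) \<in> hom C (cyW K) Y \<times> ?M \<times> ?M" using m(1) by simp
    then show ?thesis by (rule rev_image_eqI) (simp add: H(2)[symmetric])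
  qed
  then show ?thesis
    by (rule small_mono[OF small_image[OF small_Times[OF \<kappa> h small_Times[OF \<kappa> c c]]] subsetI])
qed

text \<open>The vertex of the cylinder is fibrant-cofibrant, so local smallness of the
  fibrant-cofibrant part bounds its arrows to \<open>Y\<close> as well as the 2-cells between arrows
  from \<open>X\<close> to \<open>Y\<close>. Lists of homotopies made from these name all
  2-cells.\<close>

lemma (in model_bicategory) locally_small_Ho:
  assumes \<kappa>: "uncountable_cardinal \<kappa>" and small: "locally_small \<kappa> (fc_bicat C Fib Cof)"
  shows "locally_small \<kappa> (Ho C Fib Cof Weq)"
  unfolding locally_small_def
proof (intro ballI)
  let ?B = "fc_bicat C Fib Cof" and ?H = "Ho C Fib Cof Weq"
  fix X Y assume "X \<in> Obj ?H" "Y \<in> Obj ?H"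
  then have X: "X \<in> fc_objects C Fib Cof" and Y: "Y \<in> fc_objects C Fib Cof"
    by (auto simp: Ho_def full_sub_def)
  have O: "Z \<in> Obj ?B" if "Z \<in> fc_objects C Fib Cof" for Z
    using that by (auto simp: fc_bicat_def full_sub_def fc_objects_def fibrant_def)
  have hom_eq: "hom ?B U V = hom C U V" "hom ?H U V = hom C U V"
    if "U \<in> fc_objects C Fib Cof" "V \<in> fc_objects C Fib Cof" for U V
    using that by (auto simp: hom_def fc_bicat_def Ho_def full_sub_def ho_bicat_def)
  have cells_eq: "cells ?B f g = cells C f g" if "f \<in> hom C X Y" for f g
    using that X Y by (auto simp: cells_def hom_def fc_bicat_def full_sub_def)
  obtain K where K: "lifting_cylinder Fib Weq X K" "cyW K \<in> fc_objects C Fib Cof"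
    using fc_lifting_cylinder[OF X] .
  have s: "small_cat \<kappa> (hom_cat ?B X Y)" "small_cat \<kappa> (hom_cat ?B (cyW K) Y)"
    using small O X Y K(2) by (auto simp: locally_small_def)
  have c: "small \<kappa> (\<Union>f \<in> hom C X Y. \<Union>g \<in> hom C X Y. cells C f g)" and h: "small \<kappa> (hom C X Y)"
    using s(1) by (simp_all add: small_cat_def hom_cat_def hom_eq[OF X Y] cells_eq cong: SUP_cong)
  have "small \<kappa> (hom C (cyW K) Y)"
    using s(2) by (simp add: small_cat_def hom_cat_def hom_eq[OF K(2) Y])
  from small_image[OF small_lists[OF \<kappa> small_homotopies_on[OF \<kappa> this c bicategory_axioms]]]
  have "small \<kappa> (hclass C Weq ` lists (homotopies_on C Weq K X Y))" .
  moreover have "fibrant C Fib Y" using Y by (simp add: fc_objects_def)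
  then have "(\<Union>f \<in> hom C X Y. \<Union>g \<in> hom C X Y. cells ?H f g) \<subseteq> hclass C Weq ` lists (homotopies_on C Weq K X Y)"
    by (intro UN_least Ho_cells_subset[OF K(1)])
  ultimately have "small \<kappa> (\<Union>f \<in> hom C X Y. \<Union>g \<in> hom C X Y. cells ?H f g)" by (rule small_mono)
  then show "small_cat \<kappa> (hom_cat ?H X Y)"
    using h by (simp add: small_cat_def hom_cat_def hom_eq[OF X Y])
qed

theorem corollary6p9:
  fixes C :: "('o, 'a, 'c) bicat" and Fib Cof Weq :: "'a set" and \<kappa> :: "'k rel"
  assumes "model_bicategory C Fib Cof Weq"
    and "uncountable_cardinal \<kappa>"
  shows "(locally_small \<kappa> (fc_bicat C Fib Cof) \<longrightarrow> locally_small \<kappa> (Ho C Fib Cof Weq)) \<and>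
         (locally_small \<kappa> C \<longrightarrow> locally_small \<kappa> (Ho C Fib Cof Weq))"
proof -
  interpret model_bicategory C Fib Cof Weq by fact
  \<comment> \<open>A full sub-bicategory inherits local smallness, which reduces the second
    implication to the first.\<close>
  show ?thesis
    using locally_small_Ho[OF assms(2)] locally_small_full_sub[of \<kappa> C] by (auto simp: fc_bicat_def)
qed

end
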